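(* Let $X\subset\mathbb R^2$ be a smooth plane dendroid. If $E(X)$ is $1$-dimensional, then $X$ contains a Bellamy dendroid or a Cantor set of arcs.
   Context: A continuum is a compact connected metric space. It is hereditarily unicoherent if every two of its subcontinua have connected intersection. A dendroid is a hereditarily unicoherent, arcwise connected continuum (hence uniquely arcwise connected); for $x,y$ in a dendroid $X$, $\alpha(x,y)$ denotes the unique arc in $X$ with endpoints $x$ and $y$ (with $\alpha(x,x)=\{x\}$). A plane dendroid is a dendroid $X\subset\mathbb R^2$. A dendroid $X$ is smooth if there exists $p\in X$ such that whenever $x_n\to x$ in $X$, $\alpha(x_n,p)\to\alpha(x,p)$ in the Hausdorff distance. A point $e\in X$ is an endpoint if $e$ is an endpoint of every arc in $X$ that contains it; $E(X)$ is the set of all endpoints of $X$, with the subspace topology. Dimension is the topological dimension of separable metrizable spaces. A Bellamy dendroid is a (non-degenerate, i.e. having more than one point) smooth plane dendroid $K$ whose endpoint set $E(K)$ is connected. A Cantor set of arcs is a continuous collection of pairwise-disjoint arcs whose decomposition space is a Cantor set (i.e. a family $\{A_c:c\in C\}$ of pairwise disjoint arcs indexed by a Cantor set $C$ such that $c\mapsto A_c$ is continuous with respect to the Hausdorff distance). *)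

theory Defs
  imports "HOL-Analysis.Analysis"
begin

definition continuum :: "'a::metric_space set \<Rightarrow> bool" where
  "continuum X \<longleftrightarrow> X \<noteq> {} \<and> compact X \<and> connected X"

definition hereditarily_unicoherent :: "'a::metric_space set \<Rightarrow> bool" where
  "hereditarily_unicoherent X \<longleftrightarrow>
     (\<forall>A B. A \<subseteq> X \<and> B \<subseteq> X \<and> continuum A \<and> continuum B \<longrightarrow> connected (A \<inter> B))"

definition arcwise_connected :: "'a::topological_space set \<Rightarrow> bool" where
  "arcwise_connected X \<longleftrightarrow>
     (\<forall>x\<in>X. \<forall>y\<in>X. x \<noteq> y \<longrightarrow>
        (\<exists>g. arc g \<and> path_image g \<subseteq> X \<and> pathstart g = x \<and> pathfinish g = y))"

definition dendroid :: "'a::metric_space set \<Rightarrow> bool" where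
  "dendroid X \<longleftrightarrow> continuum X \<and> hereditarily_unicoherent X \<and> arcwise_connected X"

text \<open>The arc \<open>\<alpha>(x,y)\<close>, as a point set. The description is well-defined for points \<open>x\<close>, \<open>y\<close>
  of a dendroid, because dendroids are uniquely arcwise connected.\<close>

definition arc_between :: "'a::metric_space set \<Rightarrow> 'a \<Rightarrow> 'a \<Rightarrow> 'a set" where
  "arc_between X x y =
     (if x = y then {x}
      else THE A. \<exists>g. arc g \<and> path_image g = A \<and> A \<subseteq> X \<and> pathstart g = x \<and> pathfinish g = y)"

text \<open>Only meaningful for nonempty bounded sets (otherwise the suprema or \<^const>\<open>infdist\<close> take
  default values); below it is applied to compact nonempty sets only.\<close>

definition hausdorff_distance :: "'a::metric_space set \<Rightarrow> 'a set \<Rightarrow> real" where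
  "hausdorff_distance A B = max (SUP a\<in>A. infdist a B) (SUP b\<in>B. infdist b A)"

definition smooth_dendroid :: "'a::metric_space set \<Rightarrow> bool" where
  "smooth_dendroid X \<longleftrightarrow> dendroid X \<and>
     (\<exists>p\<in>X. \<forall>s x. (\<forall>n::nat. s n \<in> X) \<and> x \<in> X \<and> s \<longlonglongrightarrow> x \<longrightarrow>
        (\<lambda>n. hausdorff_distance (arc_between X (s n) p) (arc_between X x p)) \<longlonglongrightarrow> 0)"

definition endpoints :: "'a::topological_space set \<Rightarrow> 'a set" where
  "endpoints X =
     {e \<in> X. \<forall>g. arc g \<and> path_image g \<subseteq> X \<and> e \<in> path_image g \<longrightarrow>
               e = pathstart g \<or> e = pathfinish g}"

text \<open>Small inductive dimension, which agrees with the other topological dimensions on separable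
  metrizable spaces.\<close>

definition has_dimension :: "'a topology \<Rightarrow> nat \<Rightarrow> bool" where
  "has_dimension T n \<longleftrightarrow> T dim_le int n \<and> \<not> T dim_le (int n - 1)"

definition Bellamy_dendroid :: "(real^2) set \<Rightarrow> bool" where
  "Bellamy_dendroid K \<longleftrightarrow>
     smooth_dendroid K \<and> (\<exists>x\<in>K. \<exists>y\<in>K. x \<noteq> y) \<and> connected (endpoints K)"

text \<open>The type \<^typ>\<open>nat \<Rightarrow> bool\<close> carries the product topology of discrete two-point spaces.\<close>

definition Cantor_set :: "'a::topological_space set \<Rightarrow> bool" where
  "Cantor_set C \<longleftrightarrow> C homeomorphic (UNIV :: (nat \<Rightarrow> bool) set)"

text \<open>Taking the index set among subsets of the real line is no restriction, as every
  Cantor set is homeomorphic to one of these.\<close>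

definition Cantor_set_of_arcs :: "'a::metric_space set set \<Rightarrow> bool" where
  "Cantor_set_of_arcs \<A> \<longleftrightarrow>
     (\<exists>(C :: real set) A. Cantor_set C \<and> \<A> = A ` C \<and>
        (\<forall>c\<in>C. \<exists>g. arc g \<and> path_image g = A c) \<and>
        disjoint_family_on A C \<and>
        (\<forall>c\<in>C. ((\<lambda>d. hausdorff_distance (A d) (A c)) \<longlongrightarrow> 0) (at c within C)))"

end

theory Submission
  imports Defs "HOL-Complex_Analysis.Complex_Analysis"
begin

text \<open>
  Order the dendroid \<open>X\<close> by \<open>x \<le> y\<close> iff \<open>x\<close> lies on the arc from the root \<open>p\<close> to \<open>y\<close>, where \<open>p\<close> is
  a point of smoothness. Smoothness gives a continuous strictly increasing height on \<open>X\<close>, whose level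
  sets are compact and totally disconnected. Apart from \<open>p\<close>, the endpoints are the maximal points.

  Planarity enters through a linear order. Near a given endpoint, two incomparable points can be
  compared by the angle that the difference vector turns through when they are reached along arcs
  starting at a common accessible point; this order is an open relation and it is linear on the
  endpoints. For an endpoint \<open>s\<close> whose order neighbourhoods are not small in the metric, some arc of
  \<open>X\<close> runs along the branches close to \<open>s\<close>, and the arcs for different \<open>s\<close> are disjoint. If there were
  uncountably many of them, a Cantor scheme would produce a Cantor set of arcs. So all but countably
  many endpoints are order-regular.

  If two endpoints \<open>u, v\<close> are not separated by a clopen initial segment of the order, the order
  interval between them is connected: the order boundary of a clopen subset would be countable and
  hence have an isolated point, where the order could be cut. The closure of that interval contains
  its own infimum, because each level set is totally disconnected, and the arcs from the infimum to
  the interval form a Bellamy dendroid.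

  Otherwise every regular endpoint has small clopen order-convex neighbourhoods. Choose a height \<open>r\<close>
  that is taken by no irregular endpoint. The endpoints above a small clopen piece of the level set at
  height \<open>r\<close>, together with disjoint clopen order-convex neighbourhoods of the endpoints on that
  piece, form a small clopen set. Hence the endpoint set has dimension at most \<open>0\<close>.
\<close>


section \<open>Totally ordered metric spaces\<close>

text \<open>A plane embedding gives the ends of a dendroid only a cyclic order. Cutting it at an arc
  that reaches \<open>X\<close> from outside at \<open>a\<close> makes it linear, but says nothing
  about points on the arc from \<open>p\<close> to \<open>a\<close>. As \<open>a\<close> can be
  chosen different from any given endpoint \<open>e\<close> other than \<open>p\<close>, and
  \<open>e\<close> is maximal, some neighbourhood of \<open>e\<close> is free of that arc; hence the
  order is only local. Most endpoints need not be accessible from outside, so the order is defined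
  through winding numbers, which are locally constant, and evaluated at accessible points, which are
  dense.

  The metric topology on the endpoints may be strictly finer than the order topology. A metric
  neighbourhood is sure to contain an order interval around its centre only if the centre is
  regular. This is why irregular endpoints have to be countable in number, and why the height
  \<open>r\<close> avoids theirs: the delicate points of the clopen set under construction are the
  endpoints at height exactly \<open>r\<close>.

  The root \<open>p\<close> may be an endpoint without being maximal. It is a single point, and is
  added last.\<close>

locale ordered_space =
  fixes S :: "'a::metric_space set" and less :: "'a \<Rightarrow> 'a \<Rightarrow> bool" (infix "\<sqsubset>" 50)
  assumes irrefl: "x \<in> S \<Longrightarrow> \<not> x \<sqsubset> x"
    and trans: "x \<in> S \<Longrightarrow> y \<in> S \<Longrightarrow> z \<in> S \<Longrightarrow> x \<sqsubset> y \<Longrightarrow> y \<sqsubset> z \<Longrightarrow> x \<sqsubset> z"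
    and total: "x \<in> S \<Longrightarrow> y \<in> S \<Longrightarrow> x \<noteq> y \<Longrightarrow> x \<sqsubset> y \<or> y \<sqsubset> x"
    and open_below: "x \<in> S \<Longrightarrow> openin (top_of_set S) {y \<in> S. y \<sqsubset> x}"
    and open_above: "x \<in> S \<Longrightarrow> openin (top_of_set S) {y \<in> S. x \<sqsubset> y}"
begin

abbreviation lesseq (infix "\<sqsubseteq>" 50) where "x \<sqsubseteq> y \<equiv> x = y \<or> x \<sqsubset> y"

definition cut :: "'a set \<Rightarrow> bool" where
  "cut L \<longleftrightarrow> openin (top_of_set S) L \<and> openin (top_of_set S) (S - L) \<and>
     (\<forall>x\<in>L. \<forall>y\<in>S. y \<sqsubset> x \<longrightarrow> y \<in> L)"

text \<open>The rays are open, so the metric topology refines the order topology; regularity says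
  that on the right of \<open>s\<close> the order intervals at \<open>s\<close> are also metrically
  small. A last point is regular by convention, and a point with an immediate successor is regular
  because the interval between them is empty.\<close>

definition right_regular :: "'a \<Rightarrow> bool" where
  "right_regular s \<longleftrightarrow> (\<exists>v\<in>S. s \<sqsubset> v) \<longrightarrow>
     (\<forall>e>0. \<exists>w\<in>S. s \<sqsubset> w \<and> (\<forall>x\<in>S. s \<sqsubset> x \<longrightarrow> x \<sqsubset> w \<longrightarrow> dist x s < e))"

definition left_regular :: "'a \<Rightarrow> bool" where
  "left_regular s \<longleftrightarrow> (\<exists>v\<in>S. v \<sqsubset> s) \<longrightarrow>
     (\<forall>e>0. \<exists>w\<in>S. w \<sqsubset> s \<and> (\<forall>x\<in>S. x \<sqsubset> s \<longrightarrow> w \<sqsubset> x \<longrightarrow> dist x s < e))"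

lemma reverse: "ordered_space S (\<lambda>x y. y \<sqsubset> x)"
  by unfold_locales (use irrefl trans total open_below open_above in blast)+

lemma not_less: "x \<in> S \<Longrightarrow> y \<in> S \<Longrightarrow> \<not> x \<sqsubset> y \<longleftrightarrow> y \<sqsubseteq> x"
  using irrefl trans total by blast

lemma le_less_trans: "x \<in> S \<Longrightarrow> y \<in> S \<Longrightarrow> z \<in> S \<Longrightarrow> x \<sqsubseteq> y \<Longrightarrow> y \<sqsubset> z \<Longrightarrow> x \<sqsubset> z"
  and less_le_trans: "x \<in> S \<Longrightarrow> y \<in> S \<Longrightarrow> z \<in> S \<Longrightarrow> x \<sqsubset> y \<Longrightarrow> y \<sqsubseteq> z \<Longrightarrow> x \<sqsubset> z"
  and le_trans: "x \<in> S \<Longrightarrow> y \<in> S \<Longrightarrow> z \<in> S \<Longrightarrow> x \<sqsubseteq> y \<Longrightarrow> y \<sqsubseteq> z \<Longrightarrow> x \<sqsubseteq> z"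
  using trans by blast+

lemma asym: "x \<in> S \<Longrightarrow> y \<in> S \<Longrightarrow> x \<sqsubset> y \<Longrightarrow> \<not> y \<sqsubseteq> x"
  using irrefl trans by blast

text \<open>A Baire category argument by nested intervals.\<close>

lemma countable_isolated_point:
  assumes B: "countable B" "B \<noteq> {}" "B \<subseteq> S"
    and sup: "\<And>f :: nat \<Rightarrow> 'a. (\<And>n. f n \<in> B) \<Longrightarrow> (\<And>n. f n \<sqsubset> f (Suc n)) \<Longrightarrow> \<exists>r\<in>B. \<forall>n. f n \<sqsubset> r \<Longrightarrow>
      \<exists>c\<in>B. (\<forall>n. f n \<sqsubset> c) \<and> (\<forall>r\<in>B. (\<forall>n. f n \<sqsubset> r) \<longrightarrow> c \<sqsubseteq> r)"
  shows "\<exists>b\<in>B. ((\<exists>l\<in>B. l \<sqsubset> b) \<longrightarrow> (\<exists>l\<in>B. l \<sqsubset> b \<and> (\<forall>x\<in>B. \<not> (l \<sqsubset> x \<and> x \<sqsubset> b)))) \<and>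
               ((\<exists>r\<in>B. b \<sqsubset> r) \<longrightarrow> (\<exists>r\<in>B. b \<sqsubset> r \<and> (\<forall>x\<in>B. \<not> (b \<sqsubset> x \<and> x \<sqsubset> r))))"
proof (rule ccontr)
  assume neg: "\<not> ?thesis"
  have BS: "x \<in> S" if "x \<in> B" for x using that B by auto
  define LL where "LL b \<longleftrightarrow> (\<exists>l\<in>B. l \<sqsubset> b) \<and> (\<forall>l\<in>B. l \<sqsubset> b \<longrightarrow> (\<exists>x\<in>B. l \<sqsubset> x \<and> x \<sqsubset> b))" for b
  define RL where "RL b \<longleftrightarrow> (\<exists>r\<in>B. b \<sqsubset> r) \<and> (\<forall>r\<in>B. b \<sqsubset> r \<longrightarrow> (\<exists>x\<in>B. b \<sqsubset> x \<and> x \<sqsubset> r))" for b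
  have LR: "LL b \<or> RL b" if "b \<in> B" for b
    using neg that unfolding LL_def RL_def by blast
  obtain \<beta> :: "nat \<Rightarrow> 'a" where \<beta>: "range \<beta> = B"
    using B range_from_nat_into by metis
  \<comment> \<open>A state is an interval with ends in \<open>B\<close> and a further point of
    \<open>B\<close> inside, so that it can be shrunk again.\<close>
  define P where "P s \<longleftrightarrow> fst s \<in> B \<and> snd s \<in> B \<and> (\<exists>b\<in>B. fst s \<sqsubset> b \<and> b \<sqsubset> snd s)" for s :: "'a \<times> 'a"
  have step: "\<exists>s'. P s' \<and> fst s \<sqsubset> fst s' \<and> snd s' \<sqsubseteq> snd s \<and> \<not> (fst s' \<sqsubseteq> x \<and> x \<sqsubseteq> snd s')"
    if s: "P s" and x: "x \<in> B" for s x
  proof -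
    obtain l r where lr: "s = (l, r)" "l \<in> B" "r \<in> B" "\<exists>b\<in>B. l \<sqsubset> b \<and> b \<sqsubset> r"
      using s unfolding P_def by (cases s) auto
    have "\<exists>b\<in>B. l \<sqsubset> b \<and> b \<sqsubset> r \<and> b \<noteq> x"
    proof -
      obtain b where b: "b \<in> B" "l \<sqsubset> b" "b \<sqsubset> r" using lr by blast
      show ?thesis
      proof (cases "b = x")
        case True
        from LR[OF b(1)] show ?thesis
        proof
          assume "LL b"
          then obtain y where "y \<in> B" "l \<sqsubset> y" "y \<sqsubset> b" using lr b unfolding LL_def by blast
          then show ?thesis using b True BS irrefl trans lr by metis
        next
          assume "RL b"
          then obtain y where "y \<in> B" "b \<sqsubset> y" "y \<sqsubset> r" using lr b unfolding RL_def by blast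
          then show ?thesis using b True BS irrefl trans lr by metis
        qed
      qed (use b in blast)
    qed
    then obtain b where b: "b \<in> B" "l \<sqsubset> b" "b \<sqsubset> r" "b \<noteq> x" by blast
    from LR[OF b(1)] show ?thesis
    proof
      assume L: "LL b"
      \<comment> \<open>If \<open>x\<close> lies between \<open>l\<close> and \<open>b\<close>, the
        new interval starts beyond \<open>x\<close>; otherwise \<open>x\<close> is outside
        anyway.\<close>
      define l1 where "l1 = (if l \<sqsubset> x \<and> x \<sqsubset> b then x else l)"
      have l1: "l1 \<in> B" "l1 \<sqsubset> b" "l \<sqsubseteq> l1" using lr b x by (auto simp: l1_def)
      then obtain b1 where b1: "b1 \<in> B" "l1 \<sqsubset> b1" "b1 \<sqsubset> b" using L unfolding LL_def by blast
      then obtain b2 where b2: "b2 \<in> B" "b1 \<sqsubset> b2" "b2 \<sqsubset> b" using L unfolding LL_def by blast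
      have "l \<sqsubset> b1" using l1 b1 lr BS le_less_trans by metis
      moreover have "\<not> (b1 \<sqsubseteq> x \<and> x \<sqsubseteq> b)"
      proof
        assume h: "b1 \<sqsubseteq> x \<and> x \<sqsubseteq> b"
        then have "x \<sqsubset> b" "l \<sqsubset> x" using b(4) \<open>l \<sqsubset> b1\<close> BS[OF lr(2)] BS[OF b1(1)] BS[OF x] less_le_trans by blast+
        then have "l1 = x" by (simp add: l1_def)
        then show False using h b1(2) BS[OF x] BS[OF b1(1)] irrefl trans by blast
      qed
      ultimately show ?thesis
        using b1 b2 b lr by (intro exI[of _ "(b1, b)"]) (auto simp: P_def)
    next
      assume R: "RL b"
      define r1 where "r1 = (if b \<sqsubset> x \<and> x \<sqsubset> r then x else r)"
      have r1: "r1 \<in> B" "b \<sqsubset> r1" "r1 \<sqsubseteq> r" using lr b x by (auto simp: r1_def)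
      then obtain b1 where b1: "b1 \<in> B" "b \<sqsubset> b1" "b1 \<sqsubset> r1" using R unfolding RL_def by blast
      then obtain b2 where b2: "b2 \<in> B" "b \<sqsubset> b2" "b2 \<sqsubset> b1" using R unfolding RL_def by blast
      have "b1 \<sqsubset> r" using r1 b1 lr BS less_le_trans by metis
      moreover have "\<not> (b \<sqsubseteq> x \<and> x \<sqsubseteq> b1)"
      proof
        assume h: "b \<sqsubseteq> x \<and> x \<sqsubseteq> b1"
        then have "b \<sqsubset> x" "x \<sqsubset> r" using b(4) \<open>b1 \<sqsubset> r\<close> BS[OF lr(3)] BS[OF b1(1)] BS[OF x] le_less_trans by blast+
        then have "r1 = x" by (simp add: r1_def)
        then show False using h b1(3) BS[OF x] BS[OF b1(1)] irrefl trans by blast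
      qed
      ultimately show ?thesis
        using b1 b2 b lr by (intro exI[of _ "(b, b1)"]) (auto simp: P_def)
    qed
  qed
  have "\<exists>s. P s"
  proof -
    obtain b where b: "b \<in> B" using B by blast
    from LR[OF b] show ?thesis
    proof
      assume L: "LL b"
      then obtain l where "l \<in> B" "l \<sqsubset> b" unfolding LL_def by blast
      then show ?thesis using L b unfolding LL_def P_def by (intro exI[of _ "(l, b)"]) auto
    next
      assume R: "RL b"
      then obtain r where "r \<in> B" "b \<sqsubset> r" unfolding RL_def by blast
      then show ?thesis using R b unfolding RL_def P_def by (intro exI[of _ "(b, r)"]) auto
    qed
  qed
  then have "\<exists>s. \<forall>n. P (s n) \<and> (fst (s n) \<sqsubset> fst (s (Suc n)) \<and> snd (s (Suc n)) \<sqsubseteq> snd (s n) \<and>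
       \<not> (fst (s (Suc n)) \<sqsubseteq> \<beta> n \<and> \<beta> n \<sqsubseteq> snd (s (Suc n))))"
    by (intro dependent_nat_choice step) (use \<beta> in auto)
  then obtain s :: "nat \<Rightarrow> 'a \<times> 'a" where s: "\<And>n. P (s n)"
    "\<And>n. fst (s n) \<sqsubset> fst (s (Suc n)) \<and> snd (s (Suc n)) \<sqsubseteq> snd (s n) \<and>
       \<not> (fst (s (Suc n)) \<sqsubseteq> \<beta> n \<and> \<beta> n \<sqsubseteq> snd (s (Suc n)))"
    by blast
  have sB: "fst (s n) \<in> B" "snd (s n) \<in> B" for n using s(1)[of n] by (auto simp: P_def)
  have lr: "fst (s n) \<sqsubset> snd (s n)" for n using s(1)[of n] BS trans unfolding P_def by metis
  have up: "fst (s m) \<sqsubseteq> fst (s n)" if "m \<le> n" for m n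
    using that
  proof (induction n)
    case (Suc n)
    then show ?case using s(2)[of n] sB BS trans by (metis le_Suc_eq)
  qed auto
  have dn: "snd (s n) \<sqsubseteq> snd (s m)" if "m \<le> n" for m n
    using that
  proof (induction n)
    case (Suc n)
    then show ?case using s(2)[of n] sB BS trans by (metis le_Suc_eq)
  qed auto
  have cross: "fst (s m) \<sqsubset> snd (s n)" for m n
  proof (cases "m \<le> n")
    case True
    show ?thesis using up[OF True] lr[of n] sB BS le_less_trans by metis
  next
    case False
    then show ?thesis using dn[of n m] lr[of m] sB BS less_le_trans by (metis nat_le_linear)
  qed
  \<comment> \<open>The supremum of the left ends is in \<open>B\<close> and in all the closed
    intervals, although stage \<open>n\<close> discarded \<open>\<beta> n\<close>.\<close>
  obtain c where c: "c \<in> B" "\<And>n. fst (s n) \<sqsubset> c" "\<And>r. r \<in> B \<Longrightarrow> (\<forall>n. fst (s n) \<sqsubset> r) \<Longrightarrow> c \<sqsubseteq> r"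
    using sup[of "\<lambda>n. fst (s n)"] sB s(2) cross by blast
  obtain n where "c = \<beta> n" using c(1) \<beta> by auto
  then show False using s(2)[of n] c(2) c(3)[OF sB(2)] cross by blast
qed

end

section \<open>Order intervals whose ends no clopen cut separates\<close>

locale unseparated = ordered_space +
  fixes u v
  assumes uv: "u \<in> S" "v \<in> S" "u \<sqsubset> v"
    and unsep: "cut L \<Longrightarrow> u \<in> L \<Longrightarrow> v \<in> L"
begin

definition C where "C = {x \<in> S. u \<sqsubseteq> x \<and> x \<sqsubseteq> v}"

lemma C_S: "x \<in> C \<Longrightarrow> x \<in> S" by (simp add: C_def)

lemma uv_C: "u \<in> C" "v \<in> C" using uv by (auto simp: C_def)

lemma reverse': "unseparated S (\<lambda>x y. y \<sqsubset> x) v u"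
proof -
  interpret rev: ordered_space S "\<lambda>x y. y \<sqsubset> x" by (rule reverse)
  show ?thesis
  proof unfold_locales
    fix L assume L: "rev.cut L" "v \<in> L"
    have "L \<subseteq> S" using L openin_imp_subset unfolding rev.cut_def by blast
    then have "S - (S - L) = L" by auto
    then have "cut (S - L)"
      using L(1) unfolding rev.cut_def cut_def by auto
    then show "u \<in> L" using unsep[of "S - L"] L uv by auto
  qed (use uv in auto)
qed

text \<open>The order version of local constancy. In the application \<open>P\<close> is membership
  in a clopen set, hence locally constant for the metric, and the points where
  \<open>right_const\<close> or \<open>left_const\<close> fails form its order boundary.\<close>

definition right_const :: "('a \<Rightarrow> bool) \<Rightarrow> 'a \<Rightarrow> bool" where
  "right_const P b \<longleftrightarrow> b = v \<or> (\<exists>r\<in>C. b \<sqsubset> r \<and> (\<forall>y\<in>C. b \<sqsubseteq> y \<longrightarrow> y \<sqsubseteq> r \<longrightarrow> P y = P b))"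

definition left_const :: "('a \<Rightarrow> bool) \<Rightarrow> 'a \<Rightarrow> bool" where
  "left_const P b \<longleftrightarrow> b = u \<or> (\<exists>l\<in>C. l \<sqsubset> b \<and> (\<forall>y\<in>C. y \<sqsubseteq> b \<longrightarrow> l \<sqsubseteq> y \<longrightarrow> P y = P b))"

text \<open>Otherwise the points up to \<open>d\<close> would form a neighbourhood of
  \<open>d\<close> as well, hence a cut between \<open>u\<close> and \<open>v\<close>. Thus points
  close to \<open>d\<close> both in the order and in the metric exist on its right even if
  \<open>d\<close> is irregular.\<close>

lemma right_limit:
  assumes "d \<in> C" "d \<noteq> v" "e > 0" "w \<in> S" "d \<sqsubset> w"
  shows "\<exists>x\<in>C. d \<sqsubset> x \<and> x \<sqsubset> w \<and> dist x d < e"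
proof (rule ccontr)
  assume neg: "\<not> ?thesis"
  have d: "d \<in> S" "d \<sqsubset> v" "u \<sqsubseteq> d" using assms by (auto simp: C_def)
  let ?L = "{x \<in> S. x \<sqsubseteq> d}"
  have "?L = {x \<in> S. x \<sqsubset> d} \<union> (S \<inter> ball d e) \<inter> {x \<in> S. x \<sqsubset> v} \<inter> {x \<in> S. x \<sqsubset> w}" (is "_ = ?R")
  proof
    show "?L \<subseteq> ?R" using d assms by auto
    show "?R \<subseteq> ?L"
    proof
      fix x assume x: "x \<in> ?R"
      show "x \<in> ?L"
      proof (rule ccontr)
        assume nx: "x \<notin> ?L"
        then have "x \<in> S" "x \<noteq> d" "\<not> x \<sqsubset> d" using x by auto
        moreover from this have "d \<sqsubset> x" using total[of x d] d(1) by blast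
        moreover have "dist x d < e" "x \<sqsubset> v" "x \<sqsubset> w"
          using x \<open>\<not> x \<sqsubset> d\<close> by (simp_all add: dist_commute)
        moreover have "u \<sqsubset> x" by (rule le_less_trans[OF uv(1) d(1) _ d(3)]) fact+
        ultimately show False using neg by (auto simp: C_def)
      qed
    qed
  qed
  moreover have "openin (top_of_set S) ?R"
    by (rule openin_Un[OF open_below[OF d(1)] openin_Int[OF openin_Int[OF
      openin_open_Int[OF open_ball] open_below[OF uv(2)]] open_below[OF assms(4)]]])
  ultimately have "openin (top_of_set S) ?L" by simp
  moreover have "S - ?L = {x \<in> S. d \<sqsubset> x}" using d irrefl total trans by blast
  then have "openin (top_of_set S) (S - ?L)" using open_above d by simp
  ultimately have "cut ?L"
    unfolding cut_def using d trans by blast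
  then have "v \<in> ?L" using unsep d uv by blast
  then show False using d uv irrefl trans by blast
qed

text \<open>A gap at \<open>L\<close> would make \<open>L\<close> and its complement unions of open
  rays, and so make \<open>L\<close> a cut between \<open>u\<close> and \<open>v\<close>.\<close>

lemma max_or_min:
  assumes L: "L \<subseteq> S" "\<And>x y. x \<in> L \<Longrightarrow> y \<in> S \<Longrightarrow> y \<sqsubset> x \<Longrightarrow> y \<in> L" "u \<in> L" "v \<notin> L"
  shows "(\<exists>m\<in>L \<inter> C. \<forall>x\<in>L. x \<sqsubseteq> m) \<or> (\<exists>c\<in>C - L. \<forall>x\<in>S - L. c \<sqsubseteq> x)"
proof (rule ccontr)
  assume neg: "\<not> ?thesis"
  have 1: "\<exists>x\<in>L. m \<sqsubset> x" if m: "m \<in> L" for m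
  proof (rule ccontr)
    assume h: "\<not> ?thesis"
    have mS: "m \<in> S" using L m by auto
    have mx: "\<forall>x\<in>L. x \<sqsubseteq> m" using h L m total by blast
    moreover have "m \<in> C" using mx L m uv mS total[of m v] unfolding C_def by blast
    ultimately show False using neg m by blast
  qed
  have 2: "\<exists>x\<in>S - L. x \<sqsubset> c" if c: "c \<in> S - L" for c
  proof (rule ccontr)
    assume h: "\<not> ?thesis"
    have mn: "\<forall>x\<in>S - L. c \<sqsubseteq> x" using h c total by blast
    moreover have "c \<in> C" using mn L c uv total[of c u] unfolding C_def by blast
    ultimately show False using neg c by blast
  qed
  have "L = (\<Union>m\<in>L. {x \<in> S. x \<sqsubset> m})" using 1 L by blast
  moreover have "openin (top_of_set S) (\<Union>m\<in>L. {x \<in> S. x \<sqsubset> m})"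
    using L by (intro openin_Union) (auto intro: open_below)
  ultimately have "openin (top_of_set S) L" by simp
  moreover have "S - L = (\<Union>m\<in>S - L. {x \<in> S. m \<sqsubset> x})" using 2 L by blast
  moreover have "openin (top_of_set S) (\<Union>m\<in>S - L. {x \<in> S. m \<sqsubset> x})"
    using L by (intro openin_Union) (auto intro: open_above)
  ultimately have "cut L" unfolding cut_def using L by auto
  then show False using unsep L by blast
qed

text \<open>The points below some \<open>f n\<close> form an initial segment without maximum, so its
  complement has a least element.\<close>

lemma increasing_sup:
  fixes f :: "nat \<Rightarrow> 'a"
  assumes f: "\<And>n. f n \<in> C" "\<And>n. f n \<sqsubset> f (Suc n)"
  obtains c where "c \<in> C" "\<And>n. f n \<sqsubset> c" "\<And>y. y \<in> S \<Longrightarrow> (\<And>n. f n \<sqsubset> y) \<Longrightarrow> c \<sqsubseteq> y"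
proof -
  let ?L = "{x \<in> S. \<exists>n. x \<sqsubset> f n}"
  have fS: "f n \<in> S" for n using f C_S by blast
  have "u \<sqsubset> f (Suc 0)"
    using le_less_trans[OF uv(1) fS[of 0] fS[of "Suc 0"]] f(1)[of 0] f(2)[of 0] by (simp add: C_def)
  then have "u \<in> ?L" using uv by blast
  moreover have "v \<notin> ?L"
  proof
    assume "v \<in> ?L"
    then obtain n where "v \<sqsubset> f n" by blast
    moreover have "f n \<sqsubseteq> v" using f(1)[of n] by (simp add: C_def)
    ultimately show False
      using less_le_trans[OF uv(2) fS[of n] uv(2)] irrefl[OF uv(2)] by blast
  qed
  moreover have "y \<in> ?L" if "x \<in> ?L" "y \<in> S" "y \<sqsubset> x" for x y
    using that fS trans by blast
  ultimately have "(\<exists>m\<in>?L \<inter> C. \<forall>x\<in>?L. x \<sqsubseteq> m) \<or> (\<exists>c\<in>C - ?L. \<forall>x\<in>S - ?L. c \<sqsubseteq> x)"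
    by (intro max_or_min) auto
  moreover have "\<not> (\<exists>m\<in>?L \<inter> C. \<forall>x\<in>?L. x \<sqsubseteq> m)"
  proof
    assume "\<exists>m\<in>?L \<inter> C. \<forall>x\<in>?L. x \<sqsubseteq> m"
    then obtain m n where m: "m \<in> S" "m \<sqsubset> f n" "\<forall>x\<in>?L. x \<sqsubseteq> m" by blast
    have "f n \<in> ?L" using f(2) fS by blast
    then show False using m asym[OF m(1) fS m(2)] by blast
  qed
  ultimately obtain c where c: "c \<in> C" "c \<notin> ?L" "\<And>x. x \<in> S - ?L \<Longrightarrow> c \<sqsubseteq> x" by blast
  show thesis
  proof
    show "c \<in> C" by fact
    show "f n \<sqsubset> c" for n
    proof (rule ccontr)
      assume "\<not> f n \<sqsubset> c"
      then have "c \<sqsubset> f (Suc n)"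
        using not_less[OF fS C_S[OF c(1)]] le_less_trans[OF C_S[OF c(1)] fS fS _ f(2)] by blast
      then show False using c(2) C_S[OF c(1)] by blast
    qed
    show "c \<sqsubseteq> y" if "y \<in> S" "\<And>n. f n \<sqsubset> y" for y
      using c(3)[of y] that asym[OF fS that(1)] by blast
  qed
qed

text \<open>Regularity puts an order interval inside the ball on which \<open>P\<close> is constant,
  and \<open>right_limit\<close> supplies its right end in \<open>C\<close>.\<close>

lemma right_regular_imp_right_const:
  assumes "b \<in> C" "right_regular b" "e > 0" "\<And>y. y \<in> C \<Longrightarrow> dist y b < e \<Longrightarrow> P y = P b"
  shows "right_const P b"
proof (cases "b = v")
  case False
  have bv: "b \<in> S" "b \<sqsubset> v" using False assms by (auto simp: C_def)
  then obtain w where w: "w \<in> S" "b \<sqsubset> w" "\<And>x. x \<in> S \<Longrightarrow> b \<sqsubset> x \<Longrightarrow> x \<sqsubset> w \<Longrightarrow> dist x b < e"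
    using assms(2,3) uv unfolding right_regular_def by blast
  obtain x where x: "x \<in> C" "b \<sqsubset> x" "x \<sqsubset> w"
    using right_limit[OF assms(1) False assms(3) w(1,2)] by blast
  have "P y = P b" if "y \<in> C" "b \<sqsubseteq> y" "y \<sqsubseteq> x" for y
  proof (cases "y = b")
    case False
    have "y \<sqsubset> w" using that x C_S le_less_trans w by blast
    then show ?thesis using False that w(3)[of y] C_S assms(4) by blast
  qed simp
  then show ?thesis unfolding right_const_def using x by blast
qed (simp add: right_const_def)

text \<open>Induction along the order: let \<open>L\<close> be the initial segment generated by the
  points up to which \<open>P\<close> keeps its value at \<open>x\<close>. Either \<open>L\<close>
  has a maximum or its complement a minimum, and one-sided constancy there would extend
  \<open>L\<close>.\<close>

lemma change_point:
  assumes xy: "x \<in> C" "y \<in> C" "x \<sqsubset> y" "P x \<noteq> P y"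
  shows "\<exists>b\<in>C. x \<sqsubseteq> b \<and> b \<sqsubseteq> y \<and> \<not> (right_const P b \<and> left_const P b)"
proof (rule ccontr)
  assume neg: "\<not> ?thesis"
  have S: "x \<in> S" "y \<in> S" using xy C_S by auto
  define good where "good w \<longleftrightarrow> w \<in> C \<and> x \<sqsubseteq> w \<and> (\<forall>y'\<in>C. x \<sqsubseteq> y' \<longrightarrow> y' \<sqsubseteq> w \<longrightarrow> P y' = P x)" for w
  define L where "L = {z \<in> S. \<exists>w. good w \<and> z \<sqsubseteq> w}"
  have LS: "L \<subseteq> S" by (auto simp: L_def)
  have goodC: "good w \<Longrightarrow> w \<in> C" for w by (simp add: good_def)
  have goodD: "good w \<Longrightarrow> y' \<in> C \<Longrightarrow> x \<sqsubseteq> y' \<Longrightarrow> y' \<sqsubseteq> w \<Longrightarrow> P y' = P x" for w y'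
    unfolding good_def by blast
  have goodL: "good w \<Longrightarrow> w \<in> L" for w using C_S by (auto simp: L_def good_def)
  have down: "b \<in> L" if h: "a \<in> L" "b \<in> S" "b \<sqsubseteq> a" for a b
  proof -
    obtain w where w: "good w" "a \<sqsubseteq> w" "a \<in> S" using h unfolding L_def by blast
    have "b \<sqsubseteq> w" by (rule le_trans[OF h(2) w(3) C_S[OF goodC[OF w(1)]] h(3) w(2)])
    then show ?thesis using w h(2) unfolding L_def by blast
  qed
  have "good x" unfolding good_def using xy asym[OF S(1)] C_S by metis
  then have xL: "x \<in> L" by (rule goodL)
  have uL: "u \<in> L" by (rule down[OF xL uv(1)]) (use xy in \<open>simp add: C_def\<close>)
  have yL: "y \<notin> L"
  proof
    assume "y \<in> L"
    then obtain w where "y \<sqsubseteq> w" "good w" unfolding L_def by blast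
    then show False using goodD xy by blast
  qed
  have vL: "v \<notin> L"
  proof
    assume "v \<in> L"
    then have "y \<in> L" by (rule down[OF _ S(2)]) (use xy in \<open>simp add: C_def\<close>)
    then show False using yL by simp
  qed
  have "(\<exists>m\<in>L \<inter> C. \<forall>x\<in>L. x \<sqsubseteq> m) \<or> (\<exists>c\<in>C - L. \<forall>x\<in>S - L. c \<sqsubseteq> x)"
    by (rule max_or_min[OF LS]) (use down uL vL in auto)
  then show False
  proof
    assume "\<exists>m\<in>L \<inter> C. \<forall>x\<in>L. x \<sqsubseteq> m"
    then obtain m where m: "m \<in> L" "m \<in> C" "\<And>z. z \<in> L \<Longrightarrow> z \<sqsubseteq> m" by blast
    note mS = C_S[OF m(2)]
    obtain w where w: "good w" "m \<sqsubseteq> w" using m(1) unfolding L_def by blast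
    have "w = m"
      using m(3)[OF goodL[OF w(1)]] w(2) asym[OF C_S[OF goodC[OF w(1)]] mS] by blast
    then have gm: "good m" using w by simp
    have xm: "x \<sqsubseteq> m" using gm by (simp add: good_def)
    have my: "m \<sqsubset> y"
    proof (rule ccontr)
      assume "\<not> m \<sqsubset> y"
      then have "y \<sqsubseteq> m" using not_less[OF mS S(2)] by blast
      then show False using down[OF m(1) S(2)] yL by blast
    qed
    have "right_const P m" using neg m(2) xm my by blast
    moreover have "m \<noteq> v" using vL m(1) by blast
    ultimately obtain r where r: "r \<in> C" "m \<sqsubset> r" "\<And>y'. y' \<in> C \<Longrightarrow> m \<sqsubseteq> y' \<Longrightarrow> y' \<sqsubseteq> r \<Longrightarrow> P y' = P m"
      unfolding right_const_def by blast
    have Pm: "P m = P x" by (rule goodD[OF gm m(2) xm]) simp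
    have "P y' = P x" if h: "y' \<in> C" "x \<sqsubseteq> y'" "y' \<sqsubseteq> r" for y'
    proof (cases "y' \<sqsubset> m")
      case True
      then show ?thesis using goodD[OF gm h(1,2)] by blast
    next
      case False
      then have "m \<sqsubseteq> y'" using not_less[OF C_S[OF h(1)] mS] by blast
      then show ?thesis using r(3)[OF h(1) _ h(3)] Pm by blast
    qed
    moreover have "x \<sqsubseteq> r" using le_less_trans[OF S(1) mS C_S[OF r(1)] xm r(2)] by blast
    ultimately have "good r" using r(1) unfolding good_def by blast
    then show False using m(3)[OF goodL] asym[OF mS C_S[OF r(1)] r(2)] by blast
  next
    assume "\<exists>c\<in>C - L. \<forall>x\<in>S - L. c \<sqsubseteq> x"
    then obtain c where c: "c \<in> C" "c \<notin> L" "\<And>z. z \<in> S \<Longrightarrow> z \<notin> L \<Longrightarrow> c \<sqsubseteq> z" by blast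
    note cS = C_S[OF c(1)]
    have xc: "x \<sqsubset> c"
    proof (rule ccontr)
      assume "\<not> x \<sqsubset> c"
      then have "c \<sqsubseteq> x" using not_less[OF S(1) cS] by blast
      then show False using down[OF xL cS] c(2) by blast
    qed
    have "c \<sqsubseteq> y" using c(3) S yL by blast
    then have "left_const P c" using neg c(1) xc by blast
    moreover have "c \<noteq> u" using uL c by blast
    ultimately obtain l where l: "l \<in> C" "l \<sqsubset> c" "\<And>y'. y' \<in> C \<Longrightarrow> y' \<sqsubseteq> c \<Longrightarrow> l \<sqsubseteq> y' \<Longrightarrow> P y' = P c"
      unfolding left_const_def by blast
    note lS = C_S[OF l(1)]
    have "l \<in> L" using c(3)[OF lS] asym[OF lS cS l(2)] by blast
    then obtain w where w: "good w" "l \<sqsubseteq> w" unfolding L_def by blast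
    note wS = C_S[OF goodC[OF w(1)]]
    have Pxc: "P x = P c"
    proof (cases "x \<sqsubset> l")
      case True
      then have "P l = P x" using goodD[OF w(1) l(1) _ w(2)] by blast
      moreover have "P l = P c" using l(3)[OF l(1)] l(2) by blast
      ultimately show ?thesis by simp
    next
      case False
      then have "l \<sqsubseteq> x" using not_less[OF S(1) lS] by blast
      then show ?thesis using l(3)[OF xy(1)] xc by blast
    qed
    have "P y' = P x" if h: "y' \<in> C" "x \<sqsubseteq> y'" "y' \<sqsubseteq> c" for y'
    proof (cases "w \<sqsubset> y'")
      case True
      then have "l \<sqsubset> y'" using le_less_trans[OF lS wS C_S[OF h(1)] w(2)] by blast
      then show ?thesis using l(3)[OF h(1,3)] Pxc by blast
    next
      case False
      then have "y' \<sqsubseteq> w" using not_less[OF wS C_S[OF h(1)]] by blast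
      then show ?thesis using goodD[OF w(1) h(1,2)] by blast
    qed
    then have "good c" using c(1) xc unfolding good_def by blast
    then show False using goodL c(2) by blast
  qed
qed

text \<open>Between \<open>b\<close> and \<open>w\<close> there is no change point, so
  \<open>P\<close> has one value there. By \<open>right_limit\<close> this stretch has a point
  metrically close to \<open>b\<close>, which fixes the value as \<open>P b\<close>. This takes the
  place of regularity at \<open>b\<close>.\<close>

lemma isolated_imp_right_const:
  assumes b: "b \<in> C" "e > 0" "\<And>y. y \<in> C \<Longrightarrow> dist y b < e \<Longrightarrow> P y = P b"
    and w: "w \<in> C" "b \<sqsubset> w" "\<And>x. x \<in> C \<Longrightarrow> b \<sqsubset> x \<Longrightarrow> x \<sqsubset> w \<Longrightarrow> right_const P x \<and> left_const P x"
  shows "right_const P b"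
proof (cases "b = v")
  case False
  obtain x where x: "x \<in> C" "b \<sqsubset> x" "x \<sqsubset> w" "dist x b < e"
    using right_limit[OF b(1) False b(2) C_S[OF w(1)] w(2)] by blast
  have "P y = P b" if h: "y \<in> C" "b \<sqsubseteq> y" "y \<sqsubseteq> x" for y
  proof (rule ccontr)
    assume ne: "P y \<noteq> P b"
    moreover have "P x = P b" using b(3) x by blast
    ultimately have y: "y \<sqsubset> x" "P y \<noteq> P x" "b \<sqsubset> y" using h by auto
    obtain z where z: "z \<in> C" "y \<sqsubseteq> z" "z \<sqsubseteq> x" "\<not> (right_const P z \<and> left_const P z)"
      using change_point[OF h(1) x(1) y(1,2)] by blast
    have "b \<sqsubset> z" by (rule less_le_trans[OF C_S[OF b(1)] C_S[OF h(1)] C_S[OF z(1)] y(3) z(2)])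
    moreover have "z \<sqsubset> w" by (rule le_less_trans[OF C_S[OF z(1)] C_S[OF x(1)] C_S[OF w(1)] z(3) x(3)])
    ultimately show False using w(3) z by blast
  qed
  then show ?thesis unfolding right_const_def using x by blast
qed (simp add: right_const_def)

text \<open>The order boundary \<open>B\<close> of a clopen set contains irregular points only, and
  it is nonempty by \<open>change_point\<close>. It contains the suprema of its increasing
  sequences, so the Baire argument applies and yields a point isolated in \<open>B\<close>; there
  \<open>isolated_imp_right_const\<close> and its mirror image contradict membership in
  \<open>B\<close>.\<close>

theorem connected_interval:
  assumes D: "countable {s \<in> S. \<not> (right_regular s \<and> left_regular s)}"
  shows "connected C"
proof (rule ccontr)
  assume "\<not> connected C"
  then obtain A where A: "openin (top_of_set C) A" "closedin (top_of_set C) A" "A \<noteq> {}" "A \<noteq> C"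
    unfolding connected_clopen by blast
  define P where "P x \<longleftrightarrow> x \<in> A" for x
  have "A \<subseteq> C" using A openin_imp_subset by blast
  have loc: "\<exists>e>0. \<forall>y\<in>C. dist y b < e \<longrightarrow> P y = P b" if b: "b \<in> C" for b
  proof (cases "b \<in> A")
    case True
    then obtain e where "e > 0" "\<And>y. y \<in> C \<Longrightarrow> dist y b < e \<Longrightarrow> y \<in> A"
      using A(1) unfolding openin_euclidean_subtopology_iff by blast
    then show ?thesis using True unfolding P_def by blast
  next
    case False
    have "openin (top_of_set C) (C - A)" using A(2) by (simp add: closedin_def)
    then obtain e where "e > 0" "\<And>y. y \<in> C \<Longrightarrow> dist y b < e \<Longrightarrow> y \<in> C - A"
      using False b unfolding openin_euclidean_subtopology_iff by blast
    then show ?thesis using False unfolding P_def by blast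
  qed
  interpret rev: unseparated S "\<lambda>x y. y \<sqsubset> x" v u by (rule reverse')
  have revC: "rev.C = C" unfolding rev.C_def C_def by blast
  have rev_const: "rev.right_const P b \<longleftrightarrow> left_const P b" "rev.left_const P b \<longleftrightarrow> right_const P b" for b
    unfolding rev.right_const_def left_const_def rev.left_const_def right_const_def revC by blast+
  have rev_reg: "rev.right_regular b \<longleftrightarrow> left_regular b" for b
    unfolding rev.right_regular_def left_regular_def by blast
  define B where "B = {b \<in> C. \<not> (right_const P b \<and> left_const P b)}"
  have "B \<subseteq> {s \<in> S. \<not> (right_regular s \<and> left_regular s)}"
  proof
    fix b assume b: "b \<in> B"
    then have bC: "b \<in> C" by (simp add: B_def)
    obtain e where e: "e > 0" "\<And>y. y \<in> C \<Longrightarrow> dist y b < e \<Longrightarrow> P y = P b" using loc[OF bC] by blast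
    show "b \<in> {s \<in> S. \<not> (right_regular s \<and> left_regular s)}"
      using right_regular_imp_right_const[where P = P, OF bC _ e]
        rev.right_regular_imp_right_const[where P = P, unfolded revC, OF bC _ e] b C_S[OF bC]
      by (auto simp: rev_const rev_reg B_def)
  qed
  then have "countable B" using D countable_subset by blast
  obtain a a' where "a \<in> A" "a' \<in> C - A" using A \<open>A \<subseteq> C\<close> by blast
  then have aa: "a \<in> C" "a' \<in> C" "P a \<noteq> P a'" "a \<noteq> a'" using \<open>A \<subseteq> C\<close> by (auto simp: P_def)
  then have "B \<noteq> {}"
    using change_point[of a a' P] change_point[of a' a P] total[of a a'] C_S unfolding B_def by blast
  have BC: "x \<in> C" if "x \<in> B" for x using that by (simp add: B_def)
  have supB: "\<exists>c\<in>B. (\<forall>n. f n \<sqsubset> c) \<and> (\<forall>r\<in>B. (\<forall>n. f n \<sqsubset> r) \<longrightarrow> c \<sqsubseteq> r)"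
    if f: "\<And>n. f n \<in> B" "\<And>n. f n \<sqsubset> f (Suc n)" for f :: "nat \<Rightarrow> 'a"
  proof -
    have fC: "f n \<in> C" "f n \<in> S" for n using f BC C_S by blast+
    obtain c where c: "c \<in> C" "\<And>n. f n \<sqsubset> c" "\<And>y. y \<in> S \<Longrightarrow> (\<And>n. f n \<sqsubset> y) \<Longrightarrow> c \<sqsubseteq> y"
      using increasing_sup[of f] fC f(2) by blast
    \<comment> \<open>Otherwise some \<open>f (Suc n)\<close> would lie inside a stretch on which
      \<open>P\<close> is constant, and so outside \<open>B\<close>.\<close>
    have "\<not> left_const P c"
    proof
      assume "left_const P c"
      moreover have "c \<noteq> u" using c(2)[of 0] fC(1)[of 0] asym[OF fC(2) uv(1), of 0] by (auto simp: C_def)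
      ultimately obtain l where l: "l \<in> C" "l \<sqsubset> c" "\<And>y. y \<in> C \<Longrightarrow> y \<sqsubseteq> c \<Longrightarrow> l \<sqsubseteq> y \<Longrightarrow> P y = P c"
        unfolding left_const_def by blast
      have "\<exists>n. l \<sqsubseteq> f n"
      proof (rule ccontr)
        assume "\<not> (\<exists>n. l \<sqsubseteq> f n)"
        then have "\<And>n. f n \<sqsubset> l" using not_less[OF fC(2) C_S[OF l(1)]] by blast
        then show False using c(3)[OF C_S[OF l(1)]] asym[OF C_S[OF l(1)] C_S[OF c(1)] l(2)] by blast
      qed
      then obtain n where n: "l \<sqsubseteq> f n" by blast
      let ?g = "f (Suc n)"
      have lg: "l \<sqsubset> ?g" by (rule le_less_trans[OF C_S[OF l(1)] fC(2) fC(2) n f(2)])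
      have eq: "P y = P c" if h: "y \<in> C" "l \<sqsubseteq> y" "y \<sqsubseteq> f (Suc (Suc n))" for y
      proof -
        have "y \<sqsubset> c" by (rule le_less_trans[OF C_S[OF h(1)] fC(2) C_S[OF c(1)] h(3) c(2)])
        then show ?thesis using l(3) h by blast
      qed
      have eqg: "P ?g = P c" by (rule eq) (use fC lg f(2) in auto)
      have "right_const P ?g"
        unfolding right_const_def
      proof (intro disjI2 bexI[of _ "f (Suc (Suc n))"] conjI ballI impI)
        show "?g \<sqsubset> f (Suc (Suc n))" using f by blast
        fix y assume y: "y \<in> C" "?g \<sqsubseteq> y" "y \<sqsubseteq> f (Suc (Suc n))"
        have "l \<sqsubset> y" by (rule less_le_trans[OF C_S[OF l(1)] fC(2) C_S[OF y(1)] lg y(2)])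
        with eqg show "P y = P ?g" using eq[OF y(1)] y by metis
      qed (use fC in blast)
      moreover have "left_const P ?g"
        unfolding left_const_def
      proof (intro disjI2 bexI[of _ l] conjI ballI impI)
        show "l \<sqsubset> ?g" by fact
        fix y assume y: "y \<in> C" "y \<sqsubseteq> ?g" "l \<sqsubseteq> y"
        have "y \<sqsubset> f (Suc (Suc n))" by (rule le_less_trans[OF C_S[OF y(1)] fC(2) fC(2) y(2) f(2)])
        with eqg show "P y = P ?g" using eq[OF y(1)] y by metis
      qed (use l in blast)
      ultimately show False using f(1) by (auto simp: B_def)
    qed
    then have "c \<in> B" using c(1) by (simp add: B_def)
    then show ?thesis using c BC C_S by blast
  qed
  obtain b where b: "b \<in> B"
     "(\<exists>l\<in>B. l \<sqsubset> b) \<longrightarrow> (\<exists>l\<in>B. l \<sqsubset> b \<and> (\<forall>x\<in>B. \<not> (l \<sqsubset> x \<and> x \<sqsubset> b)))"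
     "(\<exists>r\<in>B. b \<sqsubset> r) \<longrightarrow> (\<exists>r\<in>B. b \<sqsubset> r \<and> (\<forall>x\<in>B. \<not> (b \<sqsubset> x \<and> x \<sqsubset> r)))"
    using countable_isolated_point[OF \<open>countable B\<close> \<open>B \<noteq> {}\<close> _ supB] BC C_S by blast
  have bC: "b \<in> C" using b BC by blast
  obtain e where e: "e > 0" "\<And>y. y \<in> C \<Longrightarrow> dist y b < e \<Longrightarrow> P y = P b" using loc[OF bC] by blast
  have "right_const P b"
  proof (cases "b = v")
    case False
    then have "b \<sqsubset> v" using bC by (auto simp: C_def)
    \<comment> \<open>The next point of \<open>B\<close>, or \<open>v\<close> if there is
      none.\<close>
    then obtain w where w: "w \<in> C" "b \<sqsubset> w" "\<forall>x\<in>B. \<not> (b \<sqsubset> x \<and> x \<sqsubset> w)"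
      using b(3) BC uv_C by blast
    show ?thesis
      by (rule isolated_imp_right_const[where P = P, OF bC e w(1,2)]) (use w(3) in \<open>auto simp: B_def\<close>)
  qed (simp add: right_const_def)
  moreover have "left_const P b"
  proof (cases "b = u")
    case False
    then have "u \<sqsubset> b" using bC by (auto simp: C_def)
    then obtain w where w: "w \<in> C" "w \<sqsubset> b" "\<forall>x\<in>B. \<not> (w \<sqsubset> x \<and> x \<sqsubset> b)"
      using b(2) BC uv_C by blast
    show ?thesis
      by (rule rev.isolated_imp_right_const[where P = P, unfolded rev_const revC, OF bC e w(1,2)]) (use w(3) in \<open>auto simp: B_def\<close>)
  qed (simp add: left_const_def)
  ultimately show False using b(1) by (simp add: B_def)
qed

end

section \<open>Sides of paths in the upper half-plane\<close>

text \<open>Logarithms of one number form a discrete set; the gap \<open>1\<close> used below only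
  has to be less than \<open>2 * pi\<close>.\<close>

lemma exp_constant_imp_constant:
  fixes f :: "'a::topological_space \<Rightarrow> complex"
  assumes "connected S" "continuous_on S f" "\<And>x. x \<in> S \<Longrightarrow> exp (f x) = c" "x \<in> S" "y \<in> S"
  shows "f x = f y"
proof -
  have "\<exists>a. \<forall>x\<in>S. f x = a"
  proof (rule continuous_discrete_range_constant[OF assms(1,2), unfolded constant_on_def])
    fix x assume "x \<in> S"
    show "\<exists>e>0. \<forall>y. y \<in> S \<and> f y \<noteq> f x \<longrightarrow> e \<le> norm (f y - f x)"
    proof (intro exI[of _ 1] conjI allI impI)
      fix y assume y: "y \<in> S \<and> f y \<noteq> f x"
      then have "exp (f y) = exp (f x)" using assms(3) \<open>x \<in> S\<close> by simp
      then obtain n :: int where n: "f y = f x + (of_int (2 * n) * pi) * \<i>"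
        using exp_eq by metis
      then have "n \<noteq> 0" using y by auto
      have "norm (f y - f x) = 2 * \<bar>of_int n\<bar> * pi"
        unfolding n by (simp add: norm_mult)
      moreover have "1 \<le> \<bar>real_of_int n\<bar>" using \<open>n \<noteq> 0\<close> by linarith
      moreover have "pi > 1" using pi_gt3 by linarith
      ultimately show "1 \<le> norm (f y - f x)"
        by (smt (verit, best) mult_less_cancel_right1 mult_mono)
    qed simp
  qed
  then show ?thesis using assms(4,5) by metis
qed

text \<open>The branch of the logarithm cut along the positive imaginary axis, with value
  \<open>0\<close> at \<open>1\<close>. It is continuous on the punctured closed lower half-plane,
  real line included; \<open>ln_upper\<close> is its mirror image.\<close>

definition ln_lower :: "complex \<Rightarrow> complex" where
  "ln_lower w = Ln (\<i> * w) - Ln \<i>"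

definition ln_upper :: "complex \<Rightarrow> complex" where
  "ln_upper w = Ln (- \<i> * w) - Ln (- \<i>)"

lemma ln_lower:
  shows "w \<noteq> 0 \<Longrightarrow> exp (ln_lower w) = w"
    and "continuous_on {w. Im w \<le> 0 \<and> w \<noteq> 0} ln_lower"
proof -
  show "w \<noteq> 0 \<Longrightarrow> exp (ln_lower w) = w"
    by (simp add: ln_lower_def exp_diff del: Ln_ii)
  have "\<i> * w \<notin> \<real>\<^sub>\<le>\<^sub>0" if "Im w \<le> 0" "w \<noteq> 0" for w
    using that by (auto simp: complex_nonpos_Reals_iff complex_eq_iff)
  then show "continuous_on {w. Im w \<le> 0 \<and> w \<noteq> 0} ln_lower"
    unfolding ln_lower_def by (auto intro!: continuous_intros)
qed

lemma ln_upper: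
  shows "w \<noteq> 0 \<Longrightarrow> exp (ln_upper w) = w"
    and "continuous_on {w. Im w \<ge> 0 \<and> w \<noteq> 0} ln_upper"
proof -
  show "w \<noteq> 0 \<Longrightarrow> exp (ln_upper w) = w"
    by (simp add: ln_upper_def exp_diff del: Ln_minus_ii)
  have "- \<i> * w \<notin> \<real>\<^sub>\<le>\<^sub>0" if "Im w \<ge> 0" "w \<noteq> 0" for w
    using that by (auto simp: complex_nonpos_Reals_iff complex_eq_iff)
  then show "continuous_on {w. Im w \<ge> 0 \<and> w \<noteq> 0} ln_upper"
    unfolding ln_upper_def by (auto intro!: continuous_intros)
qed

text \<open>The branches agree on the positive reals and are \<open>2 * pi * \<i>\<close> apart on
  the negative ones. This jump turns positions on the real line into values of
  \<open>side\<close>.\<close>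

lemma ln_lower_upper_real:
  fixes r :: real
  assumes "r \<noteq> 0"
  shows "ln_lower r = ln \<bar>r\<bar> - (if r < 0 then \<i> * pi else 0)"
    and "ln_upper r = ln \<bar>r\<bar> + (if r < 0 then \<i> * pi else 0)"
proof -
  have 1: "Ln (\<i> * r) = ln \<bar>r\<bar> + (if r < 0 then - \<i> * pi / 2 else \<i> * pi / 2)"
  proof (cases "r < 0")
    case True
    have "\<i> * r = of_real \<bar>r\<bar> * - \<i>" using True by simp
    also have "Ln \<dots> = of_real (ln \<bar>r\<bar>) + Ln (- \<i>)"
      using assms by (subst Ln_times_of_real) (auto simp: Ln_of_real)
    finally show ?thesis using True by simp
  next
    case False
    have "\<i> * r = of_real \<bar>r\<bar> * \<i>" using False by simp
    also have "Ln \<dots> = of_real (ln \<bar>r\<bar>) + Ln \<i>"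
      using assms by (subst Ln_times_of_real) (auto simp: Ln_of_real)
    finally show ?thesis using False by simp
  qed
  have 2: "Ln (- \<i> * r) = ln \<bar>r\<bar> + (if r < 0 then \<i> * pi / 2 else - \<i> * pi / 2)"
  proof (cases "r < 0")
    case True
    have "- \<i> * r = of_real \<bar>r\<bar> * \<i>" using True by simp
    also have "Ln \<dots> = of_real (ln \<bar>r\<bar>) + Ln \<i>"
      using assms by (subst Ln_times_of_real) (auto simp: Ln_of_real)
    finally show ?thesis using True by simp
  next
    case False
    have "- \<i> * r = of_real \<bar>r\<bar> * - \<i>" using False by simp
    also have "Ln \<dots> = of_real (ln \<bar>r\<bar>) + Ln (- \<i>)"
      using assms by (subst Ln_times_of_real) (auto simp: Ln_of_real)
    finally show ?thesis using False by simp
  qed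
  show "ln_lower r = ln \<bar>r\<bar> - (if r < 0 then \<i> * pi else 0)"
    unfolding ln_lower_def 1 by simp
  show "ln_upper r = ln \<bar>r\<bar> + (if r < 0 then \<i> * pi else 0)"
    unfolding ln_upper_def 2 by simp
qed

text \<open>The logarithm of \<open>z - y\<close> at the end of \<open>P\<close>, continued along \<open>P\<close> from the lower half-plane branch at
  its start. The difference \<open>side P Q\<close> is an odd multiple of \<open>\<i> * pi\<close>, and its value decides which of
  the two endpoints comes first.\<close>

definition path_arg :: "(real \<Rightarrow> complex) \<Rightarrow> complex \<Rightarrow> complex" where
  "path_arg P y = 2 * complex_of_real pi * \<i> * winding_number P y + ln_lower (pathstart P - y)"

definition side :: "(real \<Rightarrow> complex) \<Rightarrow> (real \<Rightarrow> complex) \<Rightarrow> complex" where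
  "side P Q = path_arg P (pathfinish Q) - path_arg Q (pathfinish P)"

lemma side_swap: "side Q P = - side P Q"
  by (simp add: side_def)

lemma exp_path_arg:
  assumes "path P" "y \<notin> path_image P"
  shows "exp (path_arg P y) = pathfinish P - y"
proof -
  have "pathstart P \<noteq> y" using assms by auto
  then show ?thesis
    using winding_number_exp_2pi[OF assms] by (simp add: path_arg_def exp_add ln_lower)
qed

text \<open>With a real start, \<open>pathstart P - y\<close> lies in the closed lower half-plane
  for every \<open>y\<close> in the upper one, where \<open>ln_lower\<close> and hence
  \<open>path_arg P\<close> are continuous.\<close>

definition free_pair :: "(real \<Rightarrow> complex) \<Rightarrow> (real \<Rightarrow> complex) \<Rightarrow> bool" where
  "free_pair P Q \<longleftrightarrow> path P \<and> path Q \<and> pathstart P = pathstart Q \<and> Im (pathstart P) = 0 \<and>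
     path_image P \<subseteq> {z. Im z \<ge> 0} \<and> path_image Q \<subseteq> {z. Im z \<ge> 0} \<and>
     pathfinish P \<notin> path_image Q \<and> pathfinish Q \<notin> path_image P"

lemma free_pair_swap: "free_pair P Q \<Longrightarrow> free_pair Q P"
  by (auto simp: free_pair_def)

lemma continuous_on_path_arg:
  assumes "path P" "Im (pathstart P) = 0"
  shows "continuous_on ({y. Im y \<ge> 0} - path_image P) (path_arg P)"
proof -
  have "continuous_on ({y. Im y \<ge> 0} - path_image P) (winding_number P)"
    by (rule continuous_on_subset[OF continuous_on_winding_number[OF assms(1)]]) auto
  moreover have "continuous_on ({y. Im y \<ge> 0} - path_image P) (\<lambda>y. ln_lower (pathstart P - y))"
    by (rule continuous_on_compose2[OF ln_lower(2)]) (use assms in \<open>auto intro!: continuous_intros\<close>)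
  ultimately show ?thesis
    unfolding path_arg_def[abs_def] by (intro continuous_intros)
qed

text \<open>Pushing the endpoint of one path around while it avoids the other path rotates the two
  difference vectors \<open>x - y\<close> and \<open>y - x\<close> by the same angle.\<close>

lemma side_join:
  assumes f: "free_pair P Q" and g: "path g" "pathstart g = pathfinish P"
    "path_image g \<subseteq> {z. Im z \<ge> 0}" "path_image g \<inter> path_image Q = {}"
  shows "free_pair (P +++ g) Q" "side (P +++ g) Q = side P Q"
proof -
  let ?y = "pathfinish Q"
  have y: "?y \<notin> path_image g" using g by auto
  show "free_pair (P +++ g) Q"
    using f g y by (auto simp: free_pair_def path_image_join)
  obtain q where q: "path q" "pathfinish q - pathstart q = 2 * complex_of_real pi * \<i> * winding_number g ?y"
    "\<And>t. t \<in> {0..1} \<Longrightarrow> g t = ?y + exp (q t)"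
    using winding_number_as_continuous_log[OF g(1) y] by metis
  \<comment> \<open>Both terms are continuous logarithms along \<open>g\<close>, of
    \<open>?y - g t\<close> and of \<open>g t - ?y\<close>; their difference is a logarithm of
    \<open>-1\<close> and therefore constant.\<close>
  define k where "k = (\<lambda>t. path_arg Q (g t) - q t)"
  have "continuous_on {0..1} (\<lambda>t. path_arg Q (g t))"
    by (rule continuous_on_compose2[OF continuous_on_path_arg])
      (use f g in \<open>auto simp: free_pair_def path_def path_image_def\<close>)
  then have "continuous_on {0..1} k"
    unfolding k_def using q(1) by (intro continuous_intros) (auto simp: path_def)
  moreover have "exp (k t) = - 1" if "t \<in> {0..1}" for t
  proof -
    have "g t \<in> path_image g" using that by (auto simp: path_image_def)
    then have "g t \<notin> path_image Q" using g by blast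
    then have "exp (path_arg Q (g t)) = ?y - g t"
      using f by (intro exp_path_arg) (auto simp: free_pair_def)
    moreover have "exp (q t) = g t - ?y" using q(3)[OF that] by simp
    moreover have "g t - ?y \<noteq> 0" using y \<open>g t \<in> path_image g\<close> by auto
    ultimately show ?thesis by (simp add: k_def exp_diff divide_simps)
  qed
  ultimately have "k 0 = k 1"
    by (intro exp_constant_imp_constant[of "{0..1}" k "-1"]) auto
  then have 1: "path_arg Q (pathfinish g) - path_arg Q (pathstart g) = 2 * complex_of_real pi * \<i> * winding_number g ?y"
    using q(2) by (simp add: k_def pathstart_def pathfinish_def algebra_simps)
  have "winding_number (P +++ g) ?y = winding_number P ?y + winding_number g ?y"
    using f g y by (intro winding_number_join) (auto simp: free_pair_def)
  then show "side (P +++ g) Q = side P Q"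
    using 1 by (simp add: side_def path_arg_def g(2) algebra_simps)
qed

lemma side_cong:
  assumes "pathstart P = pathstart P'" "pathfinish P = pathfinish P'"
    "winding_number P (pathfinish Q) = winding_number P' (pathfinish Q)"
  shows "side P Q = side P' Q"
  using assms by (simp add: side_def path_arg_def)

text \<open>Seen from a real point, the path stays in the closed upper half-plane, so the single
  branch \<open>ln_upper\<close> follows its argument and only the ends matter.\<close>

lemma path_arg_real:
  assumes "path P" "path_image P \<subseteq> {z. Im z \<ge> 0}" "y \<notin> path_image P" "Im y = 0"
  shows "path_arg P y =
    ln_upper (pathfinish P - y) - ln_upper (pathstart P - y) + ln_lower (pathstart P - y)"
proof -
  obtain q where q: "path q" "pathfinish q - pathstart q = 2 * complex_of_real pi * \<i> * winding_number P y"
    "\<And>t. t \<in> {0..1} \<Longrightarrow> P t = y + exp (q t)"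
    using winding_number_as_continuous_log[OF assms(1,3)] by metis
  define k where "k = (\<lambda>t. ln_upper (P t - y) - q t)"
  have "continuous_on {0..1} (\<lambda>t. ln_upper (P t - y))"
    by (rule continuous_on_compose2[OF ln_upper(2)])
      (use assms in \<open>auto simp: path_def path_image_def intro!: continuous_intros\<close>)
  then have "continuous_on {0..1} k"
    unfolding k_def using q(1) by (intro continuous_intros) (auto simp: path_def)
  moreover have "exp (k t) = 1" if "t \<in> {0..1}" for t
  proof -
    have "P t - y \<noteq> 0" using assms(3) that by (auto simp: path_image_def)
    moreover have "exp (q t) = P t - y" using q(3)[OF that] by simp
    ultimately show ?thesis by (simp add: k_def exp_diff ln_upper(1))
  qed
  ultimately have "k 0 = k 1"
    by (intro exp_constant_imp_constant[of "{0..1}" k 1]) auto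
  then show ?thesis
    using q(2) by (simp add: k_def path_arg_def pathstart_def pathfinish_def algebra_simps)
qed

text \<open>The linear order obtained by cutting the circle \<open>\<real> \<union> {\<infinity>}\<close> at \<open>t\<close>.\<close>

definition cut_less :: "real \<Rightarrow> real \<Rightarrow> real \<Rightarrow> bool" where
  "cut_less t a b \<longleftrightarrow> (t < a \<and> (a < b \<or> b < t)) \<or> (a < b \<and> b < t)"

text \<open>All differences of ends are real, and their signs decide. Thus \<open>side\<close>
  records the cyclic order of \<open>t\<close>, \<open>a\<close>, \<open>b\<close> on the boundary
  of the half-plane.\<close>

lemma side_real:
  fixes t a b :: real
  assumes f: "free_pair P Q" and "pathstart P = of_real t" "pathfinish P = of_real a"
    "pathfinish Q = of_real b"
  shows "side P Q = (if cut_less t a b then \<i> * pi else - (\<i> * pi))"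
    and "a \<noteq> b" "a \<noteq> t" "b \<noteq> t"
proof -
  show ne: "a \<noteq> b" "a \<noteq> t" "b \<noteq> t"
    using f assms(2-) pathfinish_in_path_image[of P] pathstart_in_path_image[of P]
      pathfinish_in_path_image[of Q] pathstart_in_path_image[of Q]
    unfolding free_pair_def by (metis, metis, metis)
  have 1: "path_arg P b = ln_upper (complex_of_real (a - b)) - ln_upper (complex_of_real (t - b))
      + ln_lower (complex_of_real (t - b))"
    using f assms by (subst path_arg_real) (auto simp: free_pair_def)
  have 2: "path_arg Q a = ln_upper (complex_of_real (b - a)) - ln_upper (complex_of_real (t - a))
      + ln_lower (complex_of_real (t - a))"
    using f assms by (subst path_arg_real) (auto simp: free_pair_def)
  show "side P Q = (if cut_less t a b then \<i> * pi else - (\<i> * pi))"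
    unfolding side_def assms 1 2 using ne ln_lower_upper_real[of "a - b"]
      ln_lower_upper_real[of "b - a"] ln_lower_upper_real[of "t - a"] ln_lower_upper_real[of "t - b"]
    by (simp add: cut_less_def abs_minus_commute)
qed

text \<open>Since \<open>- S\<close> is connected, a path off \<open>S\<close> leads from
  \<open>y\<close> far away. A loop close to \<open>S\<close> misses this path, a ball around
  \<open>y\<close> and the outside of a large disc, so the ball lies in the unbounded component of
  its complement.\<close>

lemma winding_number_zero_near:
  assumes S: "compact S" "connected (- S)" "y \<notin> S"
  obtains d where "d > 0"
    "\<And>g z. path g \<Longrightarrow> pathfinish g = pathstart g \<Longrightarrow> z \<in> ball y d \<Longrightarrow>
      path_image g \<subseteq> (\<Union>w\<in>S. ball w d) \<Longrightarrow> winding_number g z = 0"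
proof -
  obtain r where r: "r > 0" "S \<subseteq> ball 0 r"
    using compact_imp_bounded[OF S(1)] bounded_subset_ballD[of S 0] by metis
  obtain v :: complex where v: "norm v = r + 2"
    using vector_choose_size[of "r+2"] r by auto
  have "path_connected (- S)"
    using S by (simp add: compact_imp_closed open_Compl connected_open_path_connected)
  moreover have "v \<in> - S" using v r by auto
  ultimately obtain p where p: "path p" "path_image p \<subseteq> - S" "pathstart p = y" "pathfinish p = v"
    using S(3) unfolding path_connected_def by (metis ComplI)
  have "\<exists>e>0. \<forall>w\<in>S. \<forall>z\<in>path_image p. e \<le> dist w z"
    by (rule separate_compact_closed) (use p S in \<open>auto simp: closed_path_image\<close>)
  then obtain e where e: "e > 0" "\<And>w z. w \<in> S \<Longrightarrow> z \<in> path_image p \<Longrightarrow> e \<le> dist w z" by blast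
  \<comment> \<open>Half of \<open>e\<close> keeps the loop off the ball around \<open>y\<close> as
    well as off the path; the bound \<open>1\<close> keeps it inside the disc of radius
    \<open>r + 2\<close>.\<close>
  define d where "d = min (e/2) 1"
  show ?thesis
  proof
    show "d > 0" using e by (simp add: d_def)
    fix g z assume g: "path g" "pathfinish g = pathstart g" "z \<in> ball y d"
      "path_image g \<subseteq> (\<Union>w\<in>S. ball w d)"
    define A where "A = ball y d \<union> path_image p \<union> - ball 0 (r + 2)"
    have "connected (ball y d \<union> path_image p)"
    proof (intro connected_Un connected_path_image p connected_ball)
      have "y \<in> ball y d \<inter> path_image p"
        using p(3) \<open>d > 0\<close> pathstart_in_path_image[of p] by simp
      then show "ball y d \<inter> path_image p \<noteq> {}" by blast
    qed
    moreover have "connected (- ball (0::complex) (r + 2))"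
      by (intro connected_complement_bounded_convex) auto
    moreover have "v \<in> path_image p" using p(4) by (metis pathfinish_in_path_image)
    ultimately have "connected A"
      unfolding A_def using v by (intro connected_Un[of "ball y d \<union> path_image p" "- ball 0 (r + 2)"]) auto
    moreover have "A \<inter> path_image g = {}"
    proof -
      have "x \<notin> A" if x: "x \<in> path_image g" for x
      proof -
        obtain w where w: "w \<in> S" "dist w x < d" using x g(4) by auto
        have "dist w x < e" using w(2) zero_le_dist[of w x] e(1) unfolding d_def by linarith
        then have "x \<notin> path_image p" using e(2)[OF w(1)] by fastforce
        moreover have "dist w y \<ge> e" using e w(1) p(3) by (metis pathstart_in_path_image)
        then have "dist y x \<ge> d"
          using w(2) dist_triangle[of w y x] by (auto simp: d_def dist_commute)
        moreover have "norm x < r + 2"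
        proof -
          have "norm w < r" using w r by auto
          then show ?thesis using w(2) norm_triangle_sub[of x w] by (auto simp: d_def dist_norm norm_minus_commute)
        qed
        ultimately show ?thesis by (auto simp: A_def)
      qed
      then show ?thesis by auto
    qed
    moreover have "\<not> bounded A"
    proof
      assume "bounded A"
      then have "bounded (- ball (0::complex) (r+2))" by (rule bounded_subset) (auto simp: A_def)
      moreover have "bounded (ball (0::complex) (r+2))" by simp
      ultimately have "bounded (UNIV :: complex set)"
        by (metis Compl_partition2 bounded_Un)
      then show False by simp
    qed
    moreover have "z \<in> A" using g(3) by (simp add: A_def)
    ultimately have "z \<in> outside (path_image g)"
      unfolding outside by (auto simp: disjoint_eq_subset_Compl intro: bounded_subset dest: connected_component_maximal)
    then show "winding_number g z = 0"
      by (intro winding_number_zero_in_outside g)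
  qed
qed


text \<open>A point \<open>u\<close> off \<open>X\<close> near \<open>x\<close> can be joined to the
  lower half-plane off \<open>X\<close> and \<open>G\<close>. The part of this path above the real
  line, followed by the segment from \<open>u\<close> towards \<open>x\<close> up to its first point
  of \<open>X\<close>, contains the arc. The arc meets \<open>X \<union> G\<close> in one point, so
  the complement stays connected and the construction can be repeated with the arc added to
  \<open>G\<close>.\<close>

lemma access_path:
  assumes X: "compact X" "X \<subseteq> {z. Im z > 0}" "interior X = {}"
    and G: "compact G" "G \<subseteq> {z. Im z \<ge> 0}" "connected (- (X \<union> G))"
    and x: "x \<in> X" "x \<notin> G" "0 < d"
  obtains g t where "arc g" "pathstart g = complex_of_real t" "pathfinish g \<in> X"
    "dist (pathfinish g) x < d" "path_image g \<inter> X = {pathfinish g}" "path_image g \<inter> G = {}"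
    "path_image g \<subseteq> {z. Im z \<ge> 0}" "connected (- (X \<union> (G \<union> path_image g)))"
proof -
  have "open ({z. Im z > 0} - G)" "x \<in> {z. Im z > 0} - G"
    using X x G compact_imp_closed open_halfspace_Im_gt[of 0] by (auto intro!: open_Diff)
  then obtain e' where e': "e' > 0" "ball x e' \<subseteq> {z. Im z > 0} - G"
    by (meson openE)
  define e where "e = min e' d"
  have e: "e > 0" "e \<le> d" "ball x e \<subseteq> {z. Im z > 0} - G"
    using e' x by (auto simp: e_def)
  have "\<not> ball x e \<subseteq> X"
    using X(3) e(1) by (metis centre_in_ball empty_iff interior_maximal open_ball subset_iff)
  then obtain u where u: "u \<in> ball x e" "u \<notin> X" by blast
  have op: "open (- (X \<union> G))"
    using X G by (intro open_Compl closed_Un compact_imp_closed)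
  have "- \<i> \<in> - (X \<union> G)" "u \<in> - (X \<union> G)"
    using X(2) G(2) u e(3) by auto
  then obtain p where p: "path p" "path_image p \<subseteq> - (X \<union> G)" "pathstart p = u" "pathfinish p = - \<i>"
    using connected_open_path_connected[OF op G(3)] unfolding path_connected_def by metis
  have cl: "closed {z. Im z \<ge> 0}" by (rule closed_halfspace_Im_ge)
  have "pathstart p \<in> {z. Im z \<ge> 0}" using p(3) u e(3) by force
  moreover have "pathfinish p \<notin> {z. Im z \<ge> 0}" using p(4) by auto
  ultimately obtain h where h: "path h" "pathstart h = u"
    "path_image h \<subseteq> path_image p \<inter> {z. Im z \<ge> 0}" "pathfinish h \<in> frontier {z. Im z \<ge> 0}"
    using exists_path_subpath_to_frontier_closed[OF cl p(1)] p(3) by metis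
  have "frontier {z. Im z \<ge> 0} = {z. Im z = 0}"
    using frontier_halfspace_ge[of \<i> 0] by (simp add: inner_complex_def)
  then have Im0: "Im (pathfinish h) = 0" using h(4) by auto
  define t where "t = Re (pathfinish h)"
  have t: "pathfinish h = of_real t" using Im0 by (simp add: t_def complex_eq_iff)
  \<comment> \<open>The parameters at which the segment from \<open>u\<close> to \<open>x\<close> is
    in \<open>X\<close>; the least of them gives the end of the arc.\<close>
  define T where "T = {0..1} \<inter> linepath u x -` X"
  have "compact T"
  proof -
    have "closedin (top_of_set {0..1}) T"
      unfolding T_def by (rule continuous_closedin_preimage)
        (use X compact_imp_closed in \<open>auto intro!: continuous_intros\<close>)
    then show ?thesis using closedin_compact by blast
  qed
  moreover have "1 \<in> T" using x by (auto simp: T_def linepath_def)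
  ultimately obtain s where s: "s \<in> T" "\<And>r. r \<in> T \<Longrightarrow> s \<le> r"
    using compact_attains_inf[of T] by blast
  define a where "a = linepath u x s"
  have a: "a \<in> X" using s by (auto simp: T_def a_def)
  have s01: "0 \<le> s" "s \<le> 1" using s by (auto simp: T_def)
  have seg: "closed_segment u a \<subseteq> closed_segment u x"
    unfolding a_def using s01 by (intro subset_closed_segment[THEN iffD2]) (auto simp: linepath_in_path)
  have segX: "closed_segment u a \<inter> X \<subseteq> {a}"
  proof
    fix z assume z: "z \<in> closed_segment u a \<inter> X"
    then obtain r where r: "0 \<le> r" "r \<le> 1" "z = linepath u a r"
      by (metis IntD1 imageE linepath_image_01 atLeastAtMost_iff)
    have z2: "z = linepath u x (r * s)"
      unfolding r a_def linepath_def by (simp add: algebra_simps)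
    moreover have "r * s \<le> 1" using r s01 by (simp add: mult_le_one)
    ultimately have "r * s \<in> T" using z r s01 by (auto simp: T_def)
    then have "s \<le> r * s" using s by blast
    then have "r * s = s" using r s01 mult_left_le_one_le[of s r] by linarith
    then have "z = linepath u x s" using z2 by metis
    then show "z \<in> {a}" by (simp add: a_def)
  qed
  have segb: "closed_segment u a \<subseteq> ball x e"
    using seg u(1) e(1) by (meson centre_in_ball closed_segment_subset convex_ball subset_trans)
  define q where "q = reversepath h +++ linepath u a"
  have q: "path q" "pathstart q = of_real t" "pathfinish q = a"
    "path_image q \<subseteq> path_image h \<union> closed_segment u a"
    using h t by (auto simp: q_def path_image_join)
  have "of_real t \<noteq> a" using a X(2) by auto
  then obtain g where g: "arc g" "path_image g \<subseteq> path_image q" "pathstart g = of_real t" "pathfinish g = a"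
    using path_contains_arc[OF q(1-3)] by metis
  have gX: "path_image g \<inter> X = {pathfinish g}"
    using g q(4) h(3) p(2) segX a pathfinish_in_path_image[of g] by blast
  have gG: "path_image g \<inter> G = {}"
    using g q(4) h(3) p(2) segb e(3) by blast
  show thesis
  proof (rule that[OF g(1,3)])
    show "pathfinish g \<in> X" using a g by simp
    have "a \<in> ball x e" using segb by auto
    then show "dist (pathfinish g) x < d" using e(2) by (simp add: g(4) dist_commute)
    show "path_image g \<inter> X = {pathfinish g}" "path_image g \<inter> G = {}" by fact+
    show "path_image g \<subseteq> {z. Im z \<ge> 0}"
    proof
      fix z assume "z \<in> path_image g"
      then consider "z \<in> path_image h" | "z \<in> ball x e" using g(2) q(4) segb by blast
      then have "0 \<le> Im z"
      proof cases
        case 1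
        then show ?thesis using h(3) by auto
      next
        case 2
        then have "0 < Im z" using e(3) by blast
        then show ?thesis by simp
      qed
      then show "z \<in> {z. Im z \<ge> 0}" by simp
    qed
    have "connected (- ((X \<union> G) \<union> path_image g))"
    proof (rule Janiszewski_connected)
      have "(X \<union> G) \<inter> path_image g = {pathfinish g}" using gX gG by (metis Int_Un_distrib2 Int_commute Un_empty_right)
      then show "connected ((X \<union> G) \<inter> path_image g)" by simp
      show "connected (- path_image g)" using g(1) by (intro connected_arc_complement) auto
    qed (use X G g in \<open>auto simp: compact_arc_image closed_arc_image compact_Un\<close>)
    then show "connected (- (X \<union> (G \<union> path_image g)))" by (simp add: Un_assoc)
  qed
qed

text \<open>On incomparable pairs off \<open>I a\<close>, \<open>side\<close> is locally constant.
  As accessible points are dense, totality and transitivity need to be checked only for points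
  reached from the real line by disjoint arcs, where they are properties of a cyclic order of real
  numbers. What enters of smoothness is the upper semicontinuity of \<open>I\<close>.\<close>

lemma planar_order:
  fixes X :: "complex set" and I :: "complex \<Rightarrow> complex set"
  assumes X: "compact X" "X \<subseteq> {z. Im z > 0}" "interior X = {}" "connected (- X)"
    and I: "\<And>x. x \<in> X \<Longrightarrow> I x \<subseteq> X" "\<And>x. x \<in> X \<Longrightarrow> connected (- I x)"
      "\<And>x y. x \<in> X \<Longrightarrow> y \<in> X \<Longrightarrow> connected (I x \<inter> I y)"
      "\<And>x. x \<in> X \<Longrightarrow> \<exists>g. path g \<and> pathstart g = p \<and> pathfinish g = x \<and> path_image g = I x"
    and usc: "\<And>x e. x \<in> X \<Longrightarrow> e > 0 \<Longrightarrow> \<exists>d>0. \<forall>x'\<in>X. dist x' x < d \<longrightarrow> I x' \<subseteq> (\<Union>w\<in>I x. ball w e)"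
    and e: "p \<in> X" "e \<in> X" "e \<noteq> p" "\<And>x. x \<in> X \<Longrightarrow> e \<in> I x \<Longrightarrow> x = e"
  obtains a R where "a \<in> X" "e \<notin> I a"
    "\<And>x y. R x y \<Longrightarrow> x \<in> X - I a \<and> y \<in> X - I a \<and> x \<notin> I y \<and> y \<notin> I x"
    "\<And>x y. x \<in> X - I a \<Longrightarrow> y \<in> X - I a \<Longrightarrow> x \<notin> I y \<Longrightarrow> y \<notin> I x \<Longrightarrow> R x y \<longleftrightarrow> \<not> R y x"
    "\<And>x y. R x y \<Longrightarrow> \<exists>d>0. \<forall>x'\<in>X. \<forall>y'\<in>X. dist x' x < d \<longrightarrow> dist y' y < d \<longrightarrow> R x' y'"
    "\<And>x y z. R x y \<Longrightarrow> R y z \<Longrightarrow> x \<notin> I z \<Longrightarrow> z \<notin> I x \<Longrightarrow> R x z"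
proof -
  \<comment> \<open>The radius \<open>dist p e\<close> excludes \<open>a = e\<close>; by maximality
    \<open>e\<close> is then off \<open>I a\<close>.\<close>
  obtain \<gamma> t where \<gamma>: "arc \<gamma>" "pathstart \<gamma> = complex_of_real t" "pathfinish \<gamma> \<in> X"
    "dist (pathfinish \<gamma>) p < dist p e" "path_image \<gamma> \<inter> X = {pathfinish \<gamma>}"
    "path_image \<gamma> \<subseteq> {z. Im z \<ge> 0}" and con\<gamma>: "connected (- (X \<union> path_image \<gamma>))"
    using access_path[of X "{}" p "dist p e"] X e by auto
  define a where "a = pathfinish \<gamma>"
  have a: "a \<in> X" "a \<noteq> e" "path_image \<gamma> \<inter> X = {a}"
    using \<gamma> by (auto simp: a_def dist_commute)
  then have ea: "e \<notin> I a" using e by blast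
  obtain gp where gp: "\<And>x. x \<in> X \<Longrightarrow> path (gp x) \<and> pathstart (gp x) = p \<and> pathfinish (gp x) = x \<and> path_image (gp x) = I x"
    using I(4) by metis
  have cI: "compact (I x)" if "x \<in> X" for x using gp[OF that] compact_path_image by metis
  have xI: "x \<in> I x" "p \<in> I x" if "x \<in> X" for x
    using gp[OF that] by (metis pathfinish_in_path_image, metis pathstart_in_path_image)
  \<comment> \<open>Each path enters at \<open>a\<close>, runs back to \<open>p\<close> and out to
    \<open>x\<close>. It may retrace itself, which does no harm to winding numbers, and the real
    start is common to all of them.\<close>
  define \<Gamma> where "\<Gamma> x = \<gamma> +++ (reversepath (gp a) +++ gp x)" for x
  define K where "K x = path_image \<gamma> \<union> I a \<union> I x" for x
  have \<Gamma>: "path (\<Gamma> x)" "pathstart (\<Gamma> x) = of_real t" "pathfinish (\<Gamma> x) = x" "path_image (\<Gamma> x) = K x"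
    if "x \<in> X" for x
    using gp[OF that] gp[OF a(1)] \<gamma> arc_imp_path[OF \<gamma>(1)]
    by (auto simp: \<Gamma>_def K_def path_image_join a_def)
  have Kim: "K x \<subseteq> {z. Im z \<ge> 0}" if "x \<in> X" for x
    using I(1)[OF that] I(1)[OF a(1)] \<gamma>(6) X(2) by (force simp: K_def)
  have cK: "compact (K x)" if "x \<in> X" for x using \<Gamma>(1,4)[OF that] compact_path_image by metis
  \<comment> \<open>Janiszewski twice: \<open>I a \<inter> I x\<close> is connected, and
    \<open>\<gamma>\<close> meets the union in \<open>a\<close> only. This prepares for
    \<open>winding_number_zero_near\<close>.\<close>
  have conK: "connected (- K x)" if "x \<in> X" for x
  proof -
    have "connected (- (I a \<union> I x))"
      using that a cI I by (intro Janiszewski_connected) (auto simp: compact_imp_closed)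
    moreover have "(I a \<union> I x) \<inter> path_image \<gamma> = {a}"
      using a xI(1)[OF a(1)] I(1)[OF a(1)] I(1)[OF that] by blast
    ultimately have "connected (- ((I a \<union> I x) \<union> path_image \<gamma>))"
      using that a cI \<gamma>(1) by (intro Janiszewski_connected[of "I a \<union> I x" "path_image \<gamma>"])
         (auto simp: compact_Un closed_arc_image connected_arc_complement)
    then show ?thesis by (simp add: K_def Un_commute Un_left_commute)
  qed
  have KX: "K x \<inter> X = I a \<union> I x" if "x \<in> X" for x
    unfolding K_def using a(3) xI(1)[OF a(1)] I(1)[OF a(1)] I(1)[OF that]
    by (simp add: Int_Un_distrib2 Int_absorb2 insert_absorb)
  have uscK: "\<exists>d>0. \<forall>x'\<in>X. dist x' x < d \<longrightarrow> K x' \<subseteq> (\<Union>w\<in>K x. ball w r)" if "x \<in> X" "r > 0" for x r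
  proof -
    obtain d where d: "d > 0" "\<And>x'. x' \<in> X \<Longrightarrow> dist x' x < d \<Longrightarrow> I x' \<subseteq> (\<Union>w\<in>I x. ball w r)"
      using usc[OF \<open>x \<in> X\<close> \<open>r > 0\<close>] by blast
    have "K x' \<subseteq> (\<Union>w\<in>K x. ball w r)" if "x' \<in> X" "dist x' x < d" for x'
      unfolding K_def
    proof (intro Un_least)
      show "path_image \<gamma> \<subseteq> (\<Union>w\<in>path_image \<gamma> \<union> I a \<union> I x. ball w r)"
        "I a \<subseteq> (\<Union>w\<in>path_image \<gamma> \<union> I a \<union> I x. ball w r)"
        using \<open>r > 0\<close> by (auto intro: centre_in_ball[THEN iffD2])
      show "I x' \<subseteq> (\<Union>w\<in>path_image \<gamma> \<union> I a \<union> I x. ball w r)"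
        using d(2)[OF that] by blast
    qed
    then show ?thesis using d(1) by blast
  qed
  define inc where "inc x y \<longleftrightarrow> x \<in> X - I a \<and> y \<in> X - I a \<and> x \<notin> I y \<and> y \<notin> I x" for x y
  have inc_sym: "inc x y \<Longrightarrow> inc y x" for x y by (auto simp: inc_def)
  have incK: "inc x y \<longleftrightarrow> x \<in> X \<and> y \<in> X \<and> x \<notin> K y \<and> y \<notin> K x" for x y
    unfolding inc_def using KX[of x] KX[of y] by blast
  have free: "free_pair (\<Gamma> x) (\<Gamma> y)" if "inc x y" for x y
    using that \<Gamma> Kim unfolding free_pair_def incK by auto
  have away: "\<exists>d>0. \<forall>x'\<in>ball x d. \<forall>y'\<in>X. dist y' y < d \<longrightarrow> x' \<notin> K y'" if "inc x y" for x y
  proof -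
    have xy: "x \<in> X" "y \<in> X" "x \<notin> K y" using that incK by auto
    have "open (- K y)" using cK[OF xy(2)] compact_imp_closed by blast
    then obtain r where r: "r > 0" "ball x r \<subseteq> - K y" using xy(3) by (meson ComplI openE)
    obtain d where d: "d > 0" "\<And>y'. y' \<in> X \<Longrightarrow> dist y' y < d \<Longrightarrow> K y' \<subseteq> (\<Union>w\<in>K y. ball w (r/2))"
      using uscK[OF xy(2), of "r/2"] r(1) by auto
    show ?thesis
    proof (intro exI[of _ "min d (r/2)"] conjI ballI impI)
      fix x' y' assume h: "x' \<in> ball x (min d (r/2))" "y' \<in> X" "dist y' y < min d (r/2)"
      show "x' \<notin> K y'"
      proof
        assume "x' \<in> K y'"
        then obtain w where w: "w \<in> K y" "dist w x' < r/2" using d(2)[OF h(2)] h(3) by auto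
        have "dist x w < r" using w(2) h(1) dist_triangle[of x w x'] by (auto simp: dist_commute)
        then show False using w(1) r(2) by auto
      qed
    qed (use d r in auto)
  qed
  have inc_open: "\<exists>d>0. \<forall>x'\<in>X. \<forall>y'\<in>X. dist x' x < d \<longrightarrow> dist y' y < d \<longrightarrow> inc x' y'" if i: "inc x y" for x y
  proof -
    obtain d1 where d1: "d1 > 0" "\<forall>x'\<in>ball x d1. \<forall>y'\<in>X. dist y' y < d1 \<longrightarrow> x' \<notin> K y'"
      using away[OF i] by blast
    obtain d2 where d2: "d2 > 0" "\<forall>x'\<in>ball y d2. \<forall>y'\<in>X. dist y' x < d2 \<longrightarrow> x' \<notin> K y'"
      using away[OF inc_sym[OF i]] by blast
    show ?thesis
      by (rule exI[of _ "min d1 d2"]) (use d1 d2 in \<open>auto simp: incK dist_commute\<close>)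
  qed
  \<comment> \<open>Only the first point moves here. The loop \<open>L\<close>, along
    \<open>\<Gamma> x\<close>, a short segment and back along \<open>\<Gamma> x'\<close>, stays near
    \<open>K x\<close> and does not wind around \<open>y'\<close>; \<open>side_join\<close> then
    removes the segment.\<close>
  have side1: "\<exists>d>0. \<forall>x'\<in>X. \<forall>y'\<in>X. dist x' x < d \<longrightarrow> dist y' y < d \<longrightarrow>
      side (\<Gamma> x') (\<Gamma> y') = side (\<Gamma> x) (\<Gamma> y')" if i: "inc x y" for x y
  proof -
    have xy: "x \<in> X" "y \<in> X" "y \<notin> K x" using i incK by auto
    obtain d0 where d0: "d0 > 0" "\<And>g z. path g \<Longrightarrow> pathfinish g = pathstart g \<Longrightarrow> z \<in> ball y d0 \<Longrightarrow>
      path_image g \<subseteq> (\<Union>w\<in>K x. ball w d0) \<Longrightarrow> winding_number g z = 0"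
      using winding_number_zero_near[OF cK conK] xy by metis
    obtain d1 where d1: "d1 > 0" "\<forall>x'\<in>ball x d1. \<forall>y'\<in>X. dist y' y < d1 \<longrightarrow> x' \<notin> K y'"
      using away[OF i] by blast
    obtain d2 where d2: "d2 > 0" "\<And>x'. x' \<in> X \<Longrightarrow> dist x' x < d2 \<Longrightarrow> K x' \<subseteq> (\<Union>w\<in>K x. ball w d0)"
      using uscK[OF xy(1) d0(1)] by blast
    obtain d3 where d3: "d3 > 0" "\<forall>x'\<in>X. \<forall>y'\<in>X. dist x' x < d3 \<longrightarrow> dist y' y < d3 \<longrightarrow> inc x' y'"
      using inc_open[OF i] by blast
    show ?thesis
    proof (intro exI[of _ "min (min d0 d1) (min d2 d3)"] conjI ballI impI)
      fix x' y' assume h: "x' \<in> X" "y' \<in> X" "dist x' x < min (min d0 d1) (min d2 d3)"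
        "dist y' y < min (min d0 d1) (min d2 d3)"
      have i': "inc x' y'" "inc x y'" using h d3 xy by auto
      define L where "L = (\<Gamma> x +++ linepath x x') +++ reversepath (\<Gamma> x')"
      have seg: "closed_segment x x' \<subseteq> ball x (min d0 d1)"
        using h d0 d1 by (intro closed_segment_subset) (auto simp: dist_commute)
      have segK: "closed_segment x x' \<inter> K y' = {}"
        using seg d1(2) h by fastforce
      have "path_image L \<subseteq> (\<Union>w\<in>K x. ball w d0)"
      proof -
        have "K x \<subseteq> (\<Union>w\<in>K x. ball w d0)" using d0(1) by (auto intro: centre_in_ball[THEN iffD2])
        moreover have "K x' \<subseteq> (\<Union>w\<in>K x. ball w d0)" using d2(2) h by simp
        moreover have "x \<in> K x" using xI xy by (auto simp: K_def)
        then have "closed_segment x x' \<subseteq> (\<Union>w\<in>K x. ball w d0)" using seg by fastforce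
        ultimately show ?thesis
          unfolding L_def using \<Gamma>[OF xy(1)] \<Gamma>[OF h(1)] by (auto simp: path_image_join)
      qed
      then have "winding_number L y' = 0"
        using h by (intro d0(2)) (auto simp: L_def \<Gamma> xy dist_commute)
      moreover have yn: "y' \<notin> K x" "y' \<notin> K x'" "y' \<notin> closed_segment x x'"
        using i' segK xI[OF h(2)] by (auto simp: incK K_def)
      ultimately have "winding_number (\<Gamma> x +++ linepath x x') y' = winding_number (\<Gamma> x') y'"
        unfolding L_def
        by (subst (asm) winding_number_join)
           (auto simp: \<Gamma> xy h path_image_join winding_number_reversepath)
      then have "side (\<Gamma> x') (\<Gamma> y') = side (\<Gamma> x +++ linepath x x') (\<Gamma> y')"
        using h xy by (intro side_cong) (auto simp: \<Gamma>)
      also have "\<dots> = side (\<Gamma> x) (\<Gamma> y')"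
      proof (rule side_join(2)[OF free[OF i'(2)]])
        have "x \<in> {z. Im z \<ge> 0}" "x' \<in> {z. Im z \<ge> 0}" using X(2) xy h by force+
        then have "closed_segment x x' \<subseteq> {z. Im z \<ge> 0}"
          by (intro closed_segment_subset convex_halfspace_Im_ge)
        then show "path_image (linepath x x') \<subseteq> {z. Im z \<ge> 0}" by simp
      qed (use segK h xy in \<open>auto simp: \<Gamma>\<close>)
      finally show "side (\<Gamma> x') (\<Gamma> y') = side (\<Gamma> x) (\<Gamma> y')" .
    qed (use d0 d1 d2 d3 in auto)
  qed
  \<comment> \<open>By antisymmetry of \<open>side\<close>, the second point can be moved like the
    first.\<close>
  have side_const: "\<exists>d>0. \<forall>x'\<in>X. \<forall>y'\<in>X. dist x' x < d \<longrightarrow> dist y' y < d \<longrightarrow>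
      inc x' y' \<and> side (\<Gamma> x') (\<Gamma> y') = side (\<Gamma> x) (\<Gamma> y)" if i: "inc x y" for x y
  proof -
    obtain d1 where d1: "d1 > 0" "\<forall>x'\<in>X. \<forall>y'\<in>X. dist x' x < d1 \<longrightarrow> dist y' y < d1 \<longrightarrow>
      side (\<Gamma> x') (\<Gamma> y') = side (\<Gamma> x) (\<Gamma> y')" using side1[OF i] by blast
    obtain d2 where d2: "d2 > 0" "\<forall>x'\<in>X. \<forall>y'\<in>X. dist x' y < d2 \<longrightarrow> dist y' x < d2 \<longrightarrow>
      side (\<Gamma> x') (\<Gamma> y') = side (\<Gamma> y) (\<Gamma> y')" using side1[OF inc_sym[OF i]] by blast
    obtain d3 where d3: "d3 > 0" "\<forall>x'\<in>X. \<forall>y'\<in>X. dist x' x < d3 \<longrightarrow> dist y' y < d3 \<longrightarrow> inc x' y'"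
      using inc_open[OF i] by blast
    have x: "x \<in> X" using i incK by auto
    show ?thesis
    proof (intro exI[of _ "min (min d1 d2) d3"] conjI ballI impI)
      fix x' y' assume h: "x' \<in> X" "y' \<in> X" "dist x' x < min (min d1 d2) d3" "dist y' y < min (min d1 d2) d3"
      show "inc x' y'" using h d3 by simp
      have "side (\<Gamma> x') (\<Gamma> y') = side (\<Gamma> x) (\<Gamma> y')" using h d1 by simp
      also have "\<dots> = - side (\<Gamma> y') (\<Gamma> x)" by (rule side_swap)
      also have "side (\<Gamma> y') (\<Gamma> x) = side (\<Gamma> y) (\<Gamma> x)" using h d2 x by simp
      also have "- side (\<Gamma> y) (\<Gamma> x) = side (\<Gamma> x) (\<Gamma> y)" by (rule side_swap[symmetric])
      finally show "side (\<Gamma> x') (\<Gamma> y') = side (\<Gamma> x) (\<Gamma> y)" .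
    qed (use d1 d2 d3 in auto)
  qed
  define acc where "acc g x r \<longleftrightarrow> arc g \<and> pathstart g = complex_of_real r \<and> pathfinish g = x \<and> x \<in> X \<and>
    path_image g \<inter> X = {x} \<and> path_image g \<subseteq> {z. Im z \<ge> 0} \<and> path_image g \<inter> path_image \<gamma> = {}"
    for g x and r :: real
  \<comment> \<open>Prolonging both paths along the access arcs to the real line does not change
    \<open>side\<close>, and \<open>side_real\<close> evaluates the result.\<close>
  have acc_side: "side (\<Gamma> x) (\<Gamma> y) = (if cut_less t r s then \<i> * pi else - (\<i> * pi)) \<and> r \<noteq> s \<and> r \<noteq> t \<and> s \<noteq> t"
    if i: "inc x y" and g: "acc g x r" and k: "acc k y s" and gk: "path_image g \<inter> path_image k = {}" for x y g k r s
  proof -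
    have xy: "x \<in> X" "y \<in> X" using i by (auto simp: incK)
    note g' = g[unfolded acc_def] and k' = k[unfolded acc_def]
    let ?P = "\<Gamma> x +++ reversepath g" and ?Q = "\<Gamma> y +++ reversepath k"
    have gK: "path_image g \<inter> K y = {}"
    proof -
      have "path_image g \<inter> (I a \<union> I y) \<subseteq> path_image g \<inter> X"
        using I(1)[OF a(1)] I(1)[OF xy(2)] by auto
      then have "path_image g \<inter> (I a \<union> I y) \<subseteq> {x}" using g' by simp
      moreover have "x \<notin> I a \<union> I y" using i by (auto simp: inc_def)
      ultimately have "path_image g \<inter> (I a \<union> I y) = {}" by auto
      then show ?thesis using g' unfolding K_def by auto
    qed
    have kK: "path_image k \<inter> K x = {}"
    proof -
      have "path_image k \<inter> (I a \<union> I x) \<subseteq> path_image k \<inter> X"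
        using I(1)[OF a(1)] I(1)[OF xy(1)] by auto
      then have "path_image k \<inter> (I a \<union> I x) \<subseteq> {y}" using k' by simp
      moreover have "y \<notin> I a \<union> I x" using i by (auto simp: inc_def)
      ultimately have "path_image k \<inter> (I a \<union> I x) = {}" by auto
      then show ?thesis using k' unfolding K_def by auto
    qed
    have 1: "free_pair ?P (\<Gamma> y)" "side ?P (\<Gamma> y) = side (\<Gamma> x) (\<Gamma> y)"
      using side_join[OF free[OF i], of "reversepath g"] g' gK xy by (auto simp: \<Gamma> arc_imp_path)
    have 2: "free_pair ?Q ?P" "side ?Q ?P = side (\<Gamma> y) ?P"
      using side_join[OF free_pair_swap[OF 1(1)], of "reversepath k"] k' kK gk xy g'
      by (auto simp: \<Gamma> arc_imp_path path_image_join Int_Un_distrib Int_commute)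
    have ends: "pathstart ?P = of_real t" "pathfinish ?P = of_real r" "pathfinish ?Q = of_real s"
      using g' k' xy by (auto simp: \<Gamma>)
    have "side (\<Gamma> x) (\<Gamma> y) = side ?P ?Q"
      using 1(2) 2(2) by (metis side_swap minus_minus)
    then show ?thesis
      using side_real[OF free_pair_swap[OF 2(1)] ends] by simp
  qed
  \<comment> \<open>\<open>G\<close> collects the access arcs chosen before, so that the new one is
    disjoint from them.\<close>
  have acc_ex: "\<exists>g x' r. acc g x' r \<and> dist x' x < d \<and> path_image g \<inter> G = {} \<and>
      connected (- (X \<union> (path_image \<gamma> \<union> G \<union> path_image g)))"
    if H: "x \<in> X" "x \<notin> I a" "x \<notin> G" "d > 0" "compact G" "G \<subseteq> {z. Im z \<ge> 0}" "connected (- (X \<union> (path_image \<gamma> \<union> G)))" for x d G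
  proof -
    have "x \<notin> path_image \<gamma>"
    proof
      assume "x \<in> path_image \<gamma>"
      then have "x \<in> {a}" using H(1) a(3) by auto
      then show False using H(2) xI(1)[OF a(1)] by simp
    qed
    then have nx: "x \<notin> path_image \<gamma> \<union> G" using H(3) by simp
    have c: "compact (path_image \<gamma> \<union> G)" "path_image \<gamma> \<union> G \<subseteq> {z. Im z \<ge> 0}"
      using H \<gamma> by (auto simp: compact_Un compact_arc_image)
    obtain g r where "arc g" "pathstart g = complex_of_real r" "pathfinish g \<in> X"
      "dist (pathfinish g) x < d" "path_image g \<inter> X = {pathfinish g}" "path_image g \<inter> (path_image \<gamma> \<union> G) = {}"
      "path_image g \<subseteq> {z. Im z \<ge> 0}" "connected (- (X \<union> ((path_image \<gamma> \<union> G) \<union> path_image g)))"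
      by (rule access_path[OF X(1-3) c H(7) H(1) nx H(4)])
    then show ?thesis unfolding acc_def by blast
  qed
  have acc_notin: "y \<notin> path_image g" if "acc g x' r" "dist x' x < d" "d \<le> dist x y" "y \<in> X" for g x' r x d y
  proof
    assume "y \<in> path_image g"
    then have "y \<in> {x'}" using that(1,4) unfolding acc_def by blast
    then show False using that(2,3) by (simp add: dist_commute)
  qed
  define R where "R x y \<longleftrightarrow> inc x y \<and> side (\<Gamma> x) (\<Gamma> y) = \<i> * pi" for x y
  have pi0: "\<i> * complex_of_real pi \<noteq> - (\<i> * pi)"
    using pi_neq_zero by (simp add: complex_eq_iff)
  have con0: "connected (- (X \<union> (path_image \<gamma> \<union> {})))" using con\<gamma> by simp
  have pairs: "side (\<Gamma> x) (\<Gamma> y) \<in> {\<i> * pi, - (\<i> * pi)}" if i: "inc x y" for x y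
  proof -
    have xy: "x \<in> X" "y \<in> X" "x \<notin> I a" "y \<notin> I a" "x \<noteq> y" using i xI by (auto simp: inc_def)
    obtain d where d: "d > 0" "\<forall>x'\<in>X. \<forall>y'\<in>X. dist x' x < d \<longrightarrow> dist y' y < d \<longrightarrow>
      inc x' y' \<and> side (\<Gamma> x') (\<Gamma> y') = side (\<Gamma> x) (\<Gamma> y)" using side_const[OF i] by blast
    \<comment> \<open>An access arc meets \<open>X\<close> only at its end, so ending closer to
      \<open>x\<close> than \<open>y\<close> is keeps it off \<open>y\<close>.\<close>
    define d' where "d' = min d (dist x y)"
    have d': "d' > 0" "d' \<le> d" using d xy by (auto simp: d'_def)
    obtain g x' r where g: "acc g x' r" "dist x' x < d'"
      "connected (- (X \<union> (path_image \<gamma> \<union> {} \<union> path_image g)))"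
      using acc_ex[OF xy(1,3) _ d'(1) _ _ con0] by auto
    have "y \<notin> path_image g" by (rule acc_notin[OF g(1,2) _ xy(2)]) (simp add: d'_def)
    then obtain k y' s where k: "acc k y' s" "dist y' y < d'" "path_image k \<inter> path_image g = {}"
      using acc_ex[OF xy(2,4) _ d'(1), of "path_image g"] g by (auto simp: acc_def compact_arc_image)
    have "x' \<in> X" "y' \<in> X" using g k by (auto simp: acc_def)
    then have "inc x' y'" "side (\<Gamma> x') (\<Gamma> y') = side (\<Gamma> x) (\<Gamma> y)" using d g k d' by auto
    then show ?thesis using acc_side[OF _ g(1) k(1)] k(3) by (metis Int_commute insertCI)
  qed
  have R_total: "R x y \<longleftrightarrow> \<not> R y x" if "inc x y" for x y
    using pairs[OF that] pi0 inc_sym[OF that] that side_swap[of "\<Gamma> y" "\<Gamma> x"]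
    by (auto simp: R_def)
  have R_open: "\<exists>d>0. \<forall>x'\<in>X. \<forall>y'\<in>X. dist x' x < d \<longrightarrow> dist y' y < d \<longrightarrow> R x' y'" if "R x y" for x y
    using side_const[of x y] that unfolding R_def by auto
  have R_trans: "R x z" if R: "R x y" "R y z" and i: "x \<notin> I z" "z \<notin> I x" for x y z
  proof -
    have ixz: "inc x z" using R i by (auto simp: R_def inc_def)
    have xyz: "x \<in> X" "y \<in> X" "z \<in> X" "x \<notin> I a" "y \<notin> I a" "z \<notin> I a" "x \<noteq> y" "x \<noteq> z" "y \<noteq> z"
      using R i xI by (auto simp: R_def inc_def)
    obtain d1 where d1: "d1 > 0" "\<forall>x'\<in>X. \<forall>y'\<in>X. dist x' x < d1 \<longrightarrow> dist y' y < d1 \<longrightarrow> R x' y'"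
      using R_open[OF R(1)] by blast
    obtain d2 where d2: "d2 > 0" "\<forall>x'\<in>X. \<forall>y'\<in>X. dist x' y < d2 \<longrightarrow> dist y' z < d2 \<longrightarrow> R x' y'"
      using R_open[OF R(2)] by blast
    obtain d3 where d3: "d3 > 0" "\<forall>x'\<in>X. \<forall>y'\<in>X. dist x' x < d3 \<longrightarrow> dist y' z < d3 \<longrightarrow>
      inc x' y' \<and> side (\<Gamma> x') (\<Gamma> y') = side (\<Gamma> x) (\<Gamma> z)" using side_const[OF ixz] by blast
    define d where "d = min (min d1 (min d2 d3)) (min (dist x y) (min (dist x z) (dist y z)))"
    have d: "d > 0" "d \<le> d1" "d \<le> d2" "d \<le> d3" "d \<le> dist x y" "d \<le> dist x z" "d \<le> dist y z"
      using d1 d2 d3 xyz by (auto simp: d_def)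
    obtain g x' r where g: "acc g x' r" "dist x' x < d"
      "connected (- (X \<union> (path_image \<gamma> \<union> {} \<union> path_image g)))"
      using acc_ex[OF xyz(1,4) _ d(1) _ _ con0] by auto
    have "y \<notin> path_image g" by (rule acc_notin[OF g(1,2) d(5) xyz(2)])
    then obtain k y' s where k: "acc k y' s" "dist y' y < d" "path_image k \<inter> path_image g = {}"
      "connected (- (X \<union> (path_image \<gamma> \<union> path_image g \<union> path_image k)))"
      using acc_ex[OF xyz(2,5) _ d(1), of "path_image g"] g by (auto simp: acc_def compact_arc_image)
    have "z \<notin> path_image g \<union> path_image k"
      using acc_notin[OF g(1,2) d(6) xyz(3)] acc_notin[OF k(1,2) d(7) xyz(3)] by simp
    then obtain l z' u where l: "acc l z' u" "dist z' z < d" "path_image l \<inter> (path_image g \<union> path_image k) = {}"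
      using acc_ex[OF xyz(3,6) _ d(1), of "path_image g \<union> path_image k"] g k
      by (auto simp: acc_def compact_arc_image compact_Un Un_assoc)
    have X': "x' \<in> X" "y' \<in> X" "z' \<in> X" using g k l by (auto simp: acc_def)
    then have R': "R x' y'" "R y' z'" "inc x' z'" "side (\<Gamma> x') (\<Gamma> z') = side (\<Gamma> x) (\<Gamma> z)"
      using d1 d2 d3 d g k l by auto
    have "cut_less t r s" "cut_less t s u"
      using acc_side[OF _ g(1) k(1)] acc_side[OF _ k(1) l(1)] k(3) l(3) R'(1,2) pi0
      by (auto simp: R_def Int_Un_distrib Int_commute split: if_splits)
    then have "cut_less t r u" by (auto simp: cut_less_def)
    then have "side (\<Gamma> x') (\<Gamma> z') = \<i> * pi"
      using acc_side[OF R'(3) g(1) l(1)] l(3) by (auto simp: Int_Un_distrib Int_commute)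
    then show ?thesis using R'(4) ixz by (simp add: R_def)
  qed
  show thesis
  proof (rule that[of a R])
    show "R x y \<Longrightarrow> x \<in> X - I a \<and> y \<in> X - I a \<and> x \<notin> I y \<and> y \<notin> I x" for x y
      by (simp add: R_def inc_def)
    show "x \<in> X - I a \<Longrightarrow> y \<in> X - I a \<Longrightarrow> x \<notin> I y \<Longrightarrow> y \<notin> I x \<Longrightarrow> R x y \<longleftrightarrow> \<not> R y x" for x y
      by (rule R_total) (simp add: inc_def)
  qed (fact a(1) ea R_open R_trans)+
qed

section \<open>Smooth dendroids\<close>

text \<open>In the parameter this says that a connected set containing \<open>0\<close> and
  \<open>1\<close> contains \<open>{0..1}\<close>.\<close>

lemma connected_subset_arc_eq:
  fixes g :: "real \<Rightarrow> 'a::t2_space"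
  assumes "arc g" "connected B" "B \<subseteq> path_image g" "pathstart g \<in> B" "pathfinish g \<in> B"
  shows "B = path_image g"
proof -
  obtain k where k: "homeomorphism {0..1} (path_image g) g k"
    using homeomorphism_arc[OF assms(1)] by blast
  have "connected (k ` B)"
    using k assms by (meson connected_continuous_image continuous_on_subset homeomorphism_def)
  moreover have "0 \<in> k ` B" "1 \<in> k ` B"
  proof -
    have "k (g 0) = 0" "k (g 1) = 1" using k by (auto simp: homeomorphism_def)
    then show "0 \<in> k ` B" "1 \<in> k ` B"
      using assms(4,5) unfolding pathstart_def pathfinish_def by (metis image_eqI)+
  qed
  ultimately have 1: "{0..1} \<subseteq> k ` B" by (rule connected_contains_Icc)
  have "path_image g \<subseteq> B"
  proof
    fix z assume z: "z \<in> path_image g"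
    then have "k z \<in> {0..1}" using k by (auto simp: homeomorphism_def)
    then obtain b where "b \<in> B" "k z = k b" using 1 by auto
    then have "z = b" using k z assms(3) unfolding homeomorphism_def by (metis subsetD)
    then show "z \<in> B" using \<open>b \<in> B\<close> by simp
  qed
  then show ?thesis using assms(3) by blast
qed

text \<open>The intersection is connected and contains both ends of each arc, so it is all of
  each.\<close>

lemma hereditarily_unicoherent_unique_arc:
  fixes X :: "'a::metric_space set"
  assumes "hereditarily_unicoherent X" "arc f" "arc g" "path_image f \<subseteq> X" "path_image g \<subseteq> X"
    "pathstart f = pathstart g" "pathfinish f = pathfinish g"
  shows "path_image f = path_image g"
proof -
  have "connected (path_image f \<inter> path_image g)"
    using assms unfolding hereditarily_unicoherent_def continuum_def
    by (metis arc_imp_path compact_path_image connected_path_image path_image_nonempty)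
  then have "path_image f \<inter> path_image g = path_image f" "path_image f \<inter> path_image g = path_image g"
    using assms connected_subset_arc_eq[of f "path_image f \<inter> path_image g"]
      connected_subset_arc_eq[of g "path_image f \<inter> path_image g"]
      pathstart_in_path_image pathfinish_in_path_image by (metis Int_iff Int_lower1 Int_lower2)+
  then show ?thesis by simp
qed

lemma arc_between_eq:
  fixes X :: "'a::metric_space set"
  assumes "hereditarily_unicoherent X" "arc f" "path_image f \<subseteq> X"
  shows "arc_between X (pathstart f) (pathfinish f) = path_image f"
proof -
  have "(THE A. \<exists>g. arc g \<and> path_image g = A \<and> A \<subseteq> X \<and> pathstart g = pathstart f \<and> pathfinish g = pathfinish f)
      = path_image f"
    using assms hereditarily_unicoherent_unique_arc[OF assms(1)] by (intro the_equality) blast+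
  then show ?thesis
    using arc_distinct_ends[OF assms(2)] by (simp add: arc_between_def)
qed

lemma infdist_le_hausdorff:
  assumes "compact A" "B \<noteq> {}" "a \<in> A"
  shows "infdist a B \<le> hausdorff_distance A B"
proof -
  have "compact ((\<lambda>a. infdist a B) ` A)"
    by (intro compact_continuous_image assms continuous_intros)
  then have "infdist a B \<le> (SUP a\<in>A. infdist a B)"
    using assms(3) by (intro cSUP_upper bounded_imp_bdd_above compact_imp_bounded)
  then show ?thesis by (simp add: hausdorff_distance_def)
qed

lemma hausdorff_commute: "hausdorff_distance A B = hausdorff_distance B A"
  by (simp add: hausdorff_distance_def max.commute)

lemma hausdorff_nonneg:
  assumes "compact A" "A \<noteq> {}" "B \<noteq> {}"
  shows "0 \<le> hausdorff_distance A B"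
proof -
  obtain a where "a \<in> A" using assms by blast
  then show ?thesis
    using infdist_le_hausdorff[OF assms(1,3)] infdist_nonneg[of a B] by (meson order_trans)
qed

lemma hausdorff_distance_le:
  assumes "A \<noteq> {}" "B \<noteq> {}" "\<And>a. a \<in> A \<Longrightarrow> \<exists>b\<in>B. dist a b \<le> e" "\<And>b. b \<in> B \<Longrightarrow> \<exists>a\<in>A. dist b a \<le> e"
  shows "hausdorff_distance A B \<le> e"
proof -
  have "infdist a B \<le> e" if "a \<in> A" for a
    using assms(3)[OF that] infdist_le order_trans by blast
  moreover have "infdist b A \<le> e" if "b \<in> B" for b
    using assms(4)[OF that] infdist_le order_trans by blast
  ultimately show ?thesis
    unfolding hausdorff_distance_def by (intro max.boundedI cSUP_least assms)
qed

lemma infdist_le_infdist_add_hausdorff: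
  fixes A B :: "'a::heine_borel set"
  assumes "compact A" "compact B" "A \<noteq> {}" "B \<noteq> {}"
  shows "infdist x B \<le> infdist x A + hausdorff_distance A B"
proof -
  obtain a where a: "a \<in> A" "infdist x A = dist x a"
    using infdist_attains_inf[OF compact_imp_closed[OF assms(1)] assms(3)] by metis
  have "infdist x B \<le> infdist a B + dist x a" by (rule infdist_triangle)
  then show ?thesis using a infdist_le_hausdorff[OF assms(1,4) a(1)] by simp
qed

text \<open>\<open>p\<close> is a point of smoothness; the dense sequence \<open>dn\<close> serves
  to define the height.\<close>

locale rooted_dendroid =
  fixes X :: "'a::euclidean_space set" and p :: 'a and dn :: "nat \<Rightarrow> 'a"
  assumes dendroid: "dendroid X" and p_in: "p \<in> X"
    and smooth: "\<And>s x. (\<And>n::nat. s n \<in> X) \<Longrightarrow> x \<in> X \<Longrightarrow> s \<longlonglongrightarrow> x \<Longrightarrow>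
        (\<lambda>n. hausdorff_distance (arc_between X (s n) p) (arc_between X x p)) \<longlonglongrightarrow> 0"
    and dn: "range dn \<subseteq> X" "X \<subseteq> closure (range dn)"
begin

definition I where "I x = arc_between X x p"

lemma unicoherent_X: "hereditarily_unicoherent X" and compact_X: "compact X"
  using dendroid by (auto simp: dendroid_def continuum_def)

lemma closed_X: "closed X" using compact_X compact_imp_closed by blast

lemma I_p: "I p = {p}" by (simp add: I_def arc_between_def)

lemma I_arc:
  assumes "x \<in> X" "x \<noteq> p"
  obtains g where "arc g" "path_image g = I x" "pathstart g = x" "pathfinish g = p" "I x \<subseteq> X"
proof -
  obtain g where g: "arc g" "path_image g \<subseteq> X" "pathstart g = x" "pathfinish g = p"
    using dendroid assms p_in unfolding dendroid_def arcwise_connected_def by blast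
  then have "I x = path_image g" using arc_between_eq[OF unicoherent_X g(1,2)] by (simp add: I_def)
  then show thesis using that g by metis
qed

lemma I_sub: "x \<in> X \<Longrightarrow> I x \<subseteq> X"
  by (cases "x = p") (use I_arc I_p p_in in auto)

lemma I_in: "x \<in> X \<Longrightarrow> y \<in> I x \<Longrightarrow> y \<in> X"
  using I_sub by blast

lemma I_self: "x \<in> X \<Longrightarrow> x \<in> I x" and p_in_I: "x \<in> X \<Longrightarrow> p \<in> I x"
  by (cases "x = p"; use I_arc[of x] I_p pathstart_in_path_image pathfinish_in_path_image in \<open>metis singletonI\<close>)+

lemma compact_I: "x \<in> X \<Longrightarrow> compact (I x)" and connected_I: "x \<in> X \<Longrightarrow> connected (I x)"
  by (cases "x = p"; use I_arc[of x] I_p compact_arc_image connected_arc_image in \<open>metis compact_sing connected_sing\<close>)+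

lemma closed_I: "x \<in> X \<Longrightarrow> closed (I x)" by (simp add: compact_I compact_imp_closed)

lemma I_ne: "x \<in> X \<Longrightarrow> I x \<noteq> {}" using I_self by blast

lemma I_arc_tail:
  assumes g: "arc g" "path_image g = I x" "pathstart g = x" "pathfinish g = p" "x \<in> X" and t: "t \<in> {0..1}"
  shows "I (g t) = g ` {t..1}"
proof (cases "t = 1")
  case True
  then show ?thesis using g I_p by (simp add: pathfinish_def)
next
  case False
  have a: "arc (subpath t 1 g)" using g t False by (intro arc_subpath_arc) auto
  have im: "path_image (subpath t 1 g) = g ` {t..1}" using t by (simp add: path_image_subpath)
  have "path_image (subpath t 1 g) \<subseteq> X"
    using im I_sub[OF g(5)] g(2) t by (auto simp: path_image_def)
  from arc_between_eq[OF unicoherent_X a this] show ?thesis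
    using im g(4)[unfolded pathfinish_def] by (simp add: I_def)
qed

lemma I_trans:
  assumes "x \<in> X" "y \<in> I x" shows "I y \<subseteq> I x"
proof (cases "x = p")
  case True
  then show ?thesis using assms I_p by simp
next
  case False
  obtain g where g: "arc g" "path_image g = I x" "pathstart g = x" "pathfinish g = p"
    using I_arc[OF assms(1) False] by metis
  obtain t where t: "t \<in> {0..1}" "y = g t" using assms(2) unfolding g(2)[symmetric] path_image_def by auto
  then show ?thesis using I_arc_tail[OF g assms(1) t(1)] g(2) by (auto simp: path_image_def)
qed

lemma I_chain:
  assumes "x \<in> X" "y \<in> I x" "z \<in> I x" shows "y \<in> I z \<or> z \<in> I y"
proof (cases "x = p")
  case True
  then show ?thesis using assms I_p by simp
next
  case False
  obtain g where g: "arc g" "path_image g = I x" "pathstart g = x" "pathfinish g = p"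
    using I_arc[OF assms(1) False] by metis
  obtain s t where t: "s \<in> {0..1}" "y = g s" "t \<in> {0..1}" "z = g t"
    using assms(2,3) unfolding g(2)[symmetric] path_image_def by auto
  show ?thesis
    using I_arc_tail[OF g assms(1) t(1)] I_arc_tail[OF g assms(1) t(3)] t
    by (cases "s \<le> t") auto
qed

lemma I_antisym:
  assumes "x \<in> X" "y \<in> I x" "x \<in> I y" shows "x = y"
proof (rule ccontr)
  assume ne: "x \<noteq> y"
  then have "x \<noteq> p" using assms I_p by auto
  then obtain g where g: "arc g" "path_image g = I x" "pathstart g = x" "pathfinish g = p"
    using I_arc[OF assms(1)] by metis
  obtain t where t: "t \<in> {0..1}" "y = g t" using assms(2) unfolding g(2)[symmetric] path_image_def by auto
  then obtain s where s: "s \<in> {t..1}" "x = g s" using assms(3) I_arc_tail[OF g assms(1) t(1)] by auto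
  have "s = 0"
    using g(1,3) s t unfolding arc_def inj_on_def pathstart_def by auto
  then show False using s t ne by auto
qed

lemma hausdorff_I:
  assumes "x \<in> X" "e > 0"
  shows "\<exists>d>0. \<forall>y\<in>X. dist y x < d \<longrightarrow> hausdorff_distance (I y) (I x) < e"
proof (rule ccontr)
  assume "\<not> ?thesis"
  then have "\<forall>n. \<exists>y\<in>X. dist y x < inverse (real (Suc n)) \<and> \<not> hausdorff_distance (I y) (I x) < e"
    by (metis inverse_positive_iff_positive of_nat_0_less_iff zero_less_Suc)
  then obtain s where s: "\<And>n. s n \<in> X" "\<And>n. dist (s n) x < inverse (real (Suc n))"
    "\<And>n. \<not> hausdorff_distance (I (s n)) (I x) < e" by metis
  have "s \<longlonglongrightarrow> x"
    unfolding tendsto_dist_iff[of s]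
    by (rule tendsto_sandwich[OF _ _ tendsto_const LIMSEQ_inverse_real_of_nat])
      (use s(2) in \<open>auto intro!: always_eventually less_imp_le\<close>)
  from smooth[OF s(1) assms(1) this] have "(\<lambda>n. hausdorff_distance (I (s n)) (I x)) \<longlonglongrightarrow> 0"
    by (simp add: I_def)
  from order_tendstoD(2)[OF this assms(2)] show False
    using s(3) by (auto simp: eventually_sequentially)
qed

lemma I_usc:
  assumes "x \<in> X" "e > 0"
  shows "\<exists>d>0. \<forall>y\<in>X. dist y x < d \<longrightarrow> I y \<subseteq> (\<Union>w\<in>I x. ball w e)"
proof -
  obtain d where d: "d > 0" "\<And>y. y \<in> X \<Longrightarrow> dist y x < d \<Longrightarrow> hausdorff_distance (I y) (I x) < e"
    using hausdorff_I[OF assms] by blast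
  have "I y \<subseteq> (\<Union>w\<in>I x. ball w e)" if y: "y \<in> X" "dist y x < d" for y
  proof
    fix z assume z: "z \<in> I y"
    have "infdist z (I x) < e"
      using infdist_le_hausdorff[OF compact_I[OF y(1)] I_ne[OF assms(1)] z] d(2)[OF y] by simp
    moreover obtain w where "w \<in> I x" "infdist z (I x) = dist z w"
      using infdist_attains_inf[OF closed_I I_ne] assms(1) by metis
    ultimately show "z \<in> (\<Union>w\<in>I x. ball w e)" by (auto simp: dist_commute)
  qed
  then show ?thesis using d(1) by blast
qed

text \<open>By smoothness \<open>I (f n)\<close> converges to \<open>I x\<close>, so a limit of
  points below \<open>f n\<close> is at distance \<open>0\<close> from \<open>I x\<close>.\<close>

lemma closed_order:
  assumes "\<And>n::nat. f n \<in> X" "\<And>n. g n \<in> I (f n)" "f \<longlonglongrightarrow> x" "g \<longlonglongrightarrow> y"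
  shows "x \<in> X" "y \<in> I x"
proof -
  show x: "x \<in> X" using closed_X assms(1,3) closed_sequentially by blast
  have "(\<lambda>n. infdist (g n) (I x)) \<longlonglongrightarrow> infdist y (I x)"
    using assms(4) by (intro tendsto_intros)
  moreover have "(\<lambda>n. infdist (g n) (I x)) \<longlonglongrightarrow> 0"
  proof (rule tendsto_sandwich[OF _ _ tendsto_const])
    show "(\<lambda>n. hausdorff_distance (I (f n)) (I x)) \<longlonglongrightarrow> 0"
      using smooth[OF assms(1) x assms(3)] by (simp add: I_def)
    show "\<forall>\<^sub>F n in sequentially. infdist (g n) (I x) \<le> hausdorff_distance (I (f n)) (I x)"
      using infdist_le_hausdorff[OF compact_I[OF assms(1)] I_ne[OF x] assms(2)] by simp
  qed (simp add: infdist_nonneg)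
  ultimately have "infdist y (I x) = 0" by (rule LIMSEQ_unique)
  then show "y \<in> I x" using in_closed_iff_infdist_zero[OF closed_I I_ne] x by metis
qed

text \<open>A Whitney-type map evaluated at \<open>I x\<close>: the distance from a fixed point to
  \<open>I x\<close> can only decrease when \<open>I x\<close> grows. Subtracting it from
  \<open>dist (dn n) p\<close> gives \<open>p\<close> the height \<open>0\<close>.\<close>

definition ht where "ht x = (\<Sum>n. (1/2)^n * (dist (dn n) p - infdist (dn n) (I x)))"

lemma ht_term:
  assumes "x \<in> X"
  shows "0 \<le> dist (dn n) p - infdist (dn n) (I x)" "dist (dn n) p - infdist (dn n) (I x) \<le> diameter X"
proof -
  show "0 \<le> dist (dn n) p - infdist (dn n) (I x)" using infdist_le[OF p_in_I[OF assms]] by simp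
  have "dist (dn n) p \<le> diameter X"
    using dn p_in compact_imp_bounded[OF compact_X] diameter_bounded_bound by blast
  then show "dist (dn n) p - infdist (dn n) (I x) \<le> diameter X" using infdist_nonneg[of "dn n" "I x"] by linarith
qed

lemma ht_summable:
  assumes "x \<in> X" shows "summable (\<lambda>n. (1/2)^n * (dist (dn n) p - infdist (dn n) (I x)))"
proof (rule summable_comparison_test')
  show "summable (\<lambda>n. (1/2)^n * diameter X)" by (intro summable_mult2 summable_geometric) auto
  show "norm ((1/2)^n * (dist (dn n) p - infdist (dn n) (I x))) \<le> (1/2)^n * diameter X" if "n \<ge> 0" for n
    using ht_term[OF assms, of n] by (auto simp: abs_mult intro!: mult_left_mono)
qed

lemma ht_p: "ht p = 0"
proof -
  have "infdist z {p} = dist z p" for z by (simp add: infdist_def)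
  then show ?thesis by (simp add: ht_def I_p)
qed

lemma ht_diff:
  assumes "x \<in> X" "y \<in> X" shows "ht x - ht y = (\<Sum>n. (1/2)^n * (infdist (dn n) (I y) - infdist (dn n) (I x)))"
    and "summable (\<lambda>n. (1/2)^n * (infdist (dn n) (I y) - infdist (dn n) (I x)))"
proof -
  have eq: "(\<lambda>n. (1/2)^n * (dist (dn n) p - infdist (dn n) (I x)) - (1/2)^n * (dist (dn n) p - infdist (dn n) (I y)))
    = (\<lambda>n. (1/2)^n * (infdist (dn n) (I y) - infdist (dn n) (I x)))"
    by (auto simp: algebra_simps)
  show "ht x - ht y = (\<Sum>n. (1/2)^n * (infdist (dn n) (I y) - infdist (dn n) (I x)))"
    unfolding ht_def using suminf_diff[OF ht_summable[OF assms(1)] ht_summable[OF assms(2)]] eq by simp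
  show "summable (\<lambda>n. (1/2)^n * (infdist (dn n) (I y) - infdist (dn n) (I x)))"
    using summable_diff[OF ht_summable[OF assms(1)] ht_summable[OF assms(2)]] eq by simp
qed

text \<open>\<open>x\<close> has positive distance from the closed set \<open>I y\<close>. A point
  of the dense sequence within half that distance of \<open>x\<close> is strictly closer to
  \<open>I x\<close> than to \<open>I y\<close>, and no other term has the wrong sign.\<close>

lemma ht_strict:
  assumes "x \<in> X" "y \<in> I x" "y \<noteq> x" shows "ht y < ht x"
proof -
  have y: "y \<in> X" using assms I_sub by blast
  have sub: "I y \<subseteq> I x" by (rule I_trans[OF assms(1,2)])
  have "x \<notin> I y" using I_antisym assms by blast
  then have pos: "infdist x (I y) > 0"
    using in_closed_iff_infdist_zero[OF closed_I[OF y] I_ne[OF y]] infdist_nonneg[of x "I y"] by force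
  have "x \<in> closure (range dn)" using dn(2) assms(1) by blast
  then have "\<exists>z\<in>range dn. dist z x < infdist x (I y) / 2"
    using pos unfolding closure_approachable by (metis half_gt_zero)
  then obtain n where n: "dist (dn n) x < infdist x (I y) / 2" by blast
  have "infdist (dn n) (I x) \<le> dist (dn n) x" by (rule infdist_le[OF I_self[OF assms(1)]])
  moreover have "infdist x (I y) \<le> infdist (dn n) (I y) + dist x (dn n)" by (rule infdist_triangle)
  ultimately have "infdist (dn n) (I y) - infdist (dn n) (I x) > 0" using n by (simp add: dist_commute)
  then have "0 < (\<Sum>n. (1/2)^n * (infdist (dn n) (I y) - infdist (dn n) (I x)))"
    using infdist_mono[OF sub I_ne[OF y]]
    by (intro suminf_pos2[where i = n] ht_diff(2) assms y) auto
  then show ?thesis using ht_diff(1)[OF assms(1) y] by simp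
qed

lemma ht_mono: "x \<in> X \<Longrightarrow> y \<in> I x \<Longrightarrow> ht y \<le> ht x"
  using ht_strict by (cases "y = x") force+

lemma ht_nonneg: "x \<in> X \<Longrightarrow> 0 \<le> ht x"
  using ht_mono[OF _ p_in_I] ht_p by simp

text \<open>The distance to a set changes by at most the Hausdorff distance, and the weights sum to
  \<open>2\<close>.\<close>

lemma ht_diff_le:
  assumes "x \<in> X" "y \<in> X" shows "ht x - ht y \<le> 2 * hausdorff_distance (I x) (I y)"
proof -
  let ?H = "hausdorff_distance (I x) (I y)"
  have s: "summable (\<lambda>n. (1/2::real)^n * ?H)" by (intro summable_mult2 summable_geometric) auto
  have "ht x - ht y \<le> (\<Sum>n. (1/2)^n * ?H)"
    unfolding ht_diff(1)[OF assms]
  proof (intro suminf_le s ht_diff(2) assms mult_left_mono)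
    fix n
    show "infdist (dn n) (I y) - infdist (dn n) (I x) \<le> ?H"
      using infdist_le_infdist_add_hausdorff[OF compact_I compact_I I_ne I_ne, OF assms assms, of "dn n"] by linarith
  qed simp
  also have "\<dots> = (\<Sum>n. (1/2)^n) * ?H" by (intro suminf_mult2[symmetric] summable_geometric) auto
  also have "\<dots> = 2 * ?H" by (simp add: suminf_geometric)
  finally show ?thesis .
qed

lemma continuous_ht: "continuous_on X ht"
  unfolding continuous_on_iff
proof (intro ballI allI impI)
  fix x and e :: real assume x: "x \<in> X" "e > 0"
  obtain d where d: "d > 0" "\<And>y. y \<in> X \<Longrightarrow> dist y x < d \<Longrightarrow> hausdorff_distance (I y) (I x) < e/3"
    using hausdorff_I[OF x(1), of "e/3"] x(2) by auto
  have "dist (ht y) (ht x) < e" if "y \<in> X" "dist y x < d" for y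
    using ht_diff_le[OF that(1) x(1)] ht_diff_le[OF x(1) that(1)] d(2)[OF that] x(2)
    by (simp add: dist_real_def abs_less_iff hausdorff_commute[of "I x"])
  then show "\<exists>d>0. \<forall>y\<in>X. dist y x < d \<longrightarrow> dist (ht y) (ht x) < e" using d(1) by blast
qed

lemma I_by_ht:
  assumes "x \<in> X" "y \<in> I x" "z \<in> I x" "ht y \<le> ht z" shows "y \<in> I z"
proof -
  have S: "y \<in> X" "z \<in> X" using assms I_sub by blast+
  from I_chain[OF assms(1-3)] show ?thesis
  proof
    assume "z \<in> I y"
    then have "z = y" using ht_strict[OF S(1), of z] assms(4) by (cases "z = y") auto
    then show ?thesis using I_self S by simp
  qed
qed

text \<open>The point of \<open>I x\<close> at height \<open>t\<close>, where \<open>t\<close> is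
  clamped to the heights occurring on \<open>I x\<close>: lower values give \<open>p\<close>, higher
  ones \<open>x\<close>. Clamping makes the map defined and continuous for all
  \<open>t\<close>.\<close>

definition cut_at where "cut_at t x = (SOME y. y \<in> I x \<and> ht y = max 0 (min t (ht x)))"

lemma cut_at:
  assumes "x \<in> X" shows "cut_at t x \<in> I x" "ht (cut_at t x) = max 0 (min t (ht x))"
proof -
  have "connected (ht ` I x)"
    using continuous_on_subset[OF continuous_ht I_sub] connected_I assms by (intro connected_continuous_image) auto
  moreover have "0 \<in> ht ` I x" using p_in_I[OF assms] ht_p by (metis image_eqI)
  moreover have "ht x \<in> ht ` I x" using I_self[OF assms] by blast
  ultimately have "{0..ht x} \<subseteq> ht ` I x" by (intro connected_contains_Icc)
  moreover have "max 0 (min t (ht x)) \<in> {0..ht x}" using ht_nonneg[OF assms] by auto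
  ultimately have "\<exists>y. y \<in> I x \<and> ht y = max 0 (min t (ht x))" by (metis image_iff subsetD)
  from someI_ex[OF this] show "cut_at t x \<in> I x" "ht (cut_at t x) = max 0 (min t (ht x))"
    by (auto simp: cut_at_def)
qed

lemma cut_at_in: "x \<in> X \<Longrightarrow> cut_at t x \<in> X" using cut_at(1) I_sub by blast

lemma cut_at_unique:
  assumes "x \<in> X" "y \<in> I x" "ht y = max 0 (min t (ht x))" shows "y = cut_at t x"
proof -
  have "y \<in> I (cut_at t x)" "cut_at t x \<in> I y"
    using I_by_ht[OF assms(1)] assms cut_at[OF assms(1)] by auto
  then show ?thesis using I_antisym[of y] assms I_sub by blast
qed

lemma cut_at_ht: "x \<in> X \<Longrightarrow> y \<in> I x \<Longrightarrow> cut_at (ht y) x = y"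
  using cut_at_unique[of x y "ht y"] ht_mono ht_nonneg I_sub by (metis max.absorb2 min.absorb1 subsetD)

text \<open>The target is compact, so a closed graph suffices. A limit of cuts lies on the limit arc
  because the order is closed, and it has the limit height; these two facts determine it.\<close>

lemma continuous_cut_at: "continuous_on (UNIV \<times> X) (\<lambda>(t, x). cut_at t x)"
proof (rule continuous_from_closed_graph[OF compact_X])
  show "(\<lambda>(t, x). cut_at t x) \<in> UNIV \<times> X \<rightarrow> X" using cut_at_in by auto
  show "closed ((\<lambda>x. (x, case x of (t, x) \<Rightarrow> cut_at t x)) ` (UNIV \<times> X))"
    unfolding closed_sequential_limits
  proof (intro allI impI, elim conjE)
    fix f l assume f: "\<forall>n. f n \<in> (\<lambda>x. (x, case x of (t, x) \<Rightarrow> cut_at t x)) ` (UNIV \<times> X)" "f \<longlonglongrightarrow> l"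
    define t where "t n = fst (fst (f n))" for n
    define x where "x n = snd (fst (f n))" for n
    define y where "y n = snd (f n)" for n
    have xy: "x n \<in> X" "y n = cut_at (t n) (x n)" for n
      using f(1)[rule_format, of n] by (auto simp: t_def x_def y_def)
    have lim: "t \<longlonglongrightarrow> fst (fst l)" "x \<longlonglongrightarrow> snd (fst l)" "y \<longlonglongrightarrow> snd l"
      unfolding t_def[abs_def] x_def[abs_def] y_def[abs_def] using f(2) by (auto intro!: tendsto_intros)
    have yI: "y n \<in> I (x n)" for n using cut_at xy by metis
    have l: "snd (fst l) \<in> X" "snd l \<in> I (snd (fst l))" by (rule closed_order[OF xy(1) yI lim(2,3)])+
    have yX: "y n \<in> X" for n using cut_at_in xy by metis
    have "snd l \<in> X" using l I_sub by blast
    then have "(\<lambda>n. ht (y n)) \<longlonglongrightarrow> ht (snd l)"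
      using continuous_ht lim(3) yX unfolding continuous_on_sequentially comp_def by blast
    moreover have "(\<lambda>n. ht (x n)) \<longlonglongrightarrow> ht (snd (fst l))"
      using continuous_ht lim(2) xy(1) l(1) unfolding continuous_on_sequentially comp_def by blast
    then have "(\<lambda>n. max 0 (min (t n) (ht (x n)))) \<longlonglongrightarrow> max 0 (min (fst (fst l)) (ht (snd (fst l))))"
      using lim(1) by (intro tendsto_intros)
    moreover have "(\<lambda>n. ht (y n)) = (\<lambda>n. max 0 (min (t n) (ht (x n))))"
      using cut_at(2)[OF xy(1)] by (simp add: xy(2))
    ultimately have "ht (snd l) = max 0 (min (fst (fst l)) (ht (snd (fst l))))"
      using LIMSEQ_unique by metis
    then have "snd l = cut_at (fst (fst l)) (snd (fst l))" using cut_at_unique l by blast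
    then show "l \<in> (\<lambda>x. (x, case x of (t, x) \<Rightarrow> cut_at t x)) ` (UNIV \<times> X)"
      using l(1) by (intro image_eqI[of _ _ "fst l"]) (auto simp: prod_eq_iff mem_Times_iff split: prod.splits)
  qed
qed

lemma continuous_cut_at_comp:
  assumes "continuous_on S f" "continuous_on S g" "\<And>s. s \<in> S \<Longrightarrow> g s \<in> X"
  shows "continuous_on S (\<lambda>s. cut_at (f s) (g s))"
  using continuous_on_compose2[OF continuous_cut_at, of S "\<lambda>s. (f s, g s)"] assms
  by (auto intro: continuous_intros)

end

section \<open>Order intervals and upper sets\<close>

context rooted_dendroid begin

definition seg where "seg q y = {z \<in> I y. q \<in> I z}"
definition up where "up q = {x \<in> X. q \<in> I x}"

lemma seg_image:
  assumes "y \<in> X" "q \<in> I y" shows "seg q y = (\<lambda>t. cut_at t y) ` {ht q..ht y}"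
proof
  show "seg q y \<subseteq> (\<lambda>t. cut_at t y) ` {ht q..ht y}"
  proof
    fix z assume "z \<in> seg q y"
    then have z: "z \<in> I y" "q \<in> I z" by (auto simp: seg_def)
    have "z = cut_at (ht z) y" "ht q \<le> ht z" "ht z \<le> ht y"
      using cut_at_ht[OF assms(1) z(1)] ht_mono[OF I_in[OF assms(1) z(1)] z(2)] ht_mono[OF assms(1) z(1)]
      by simp_all
    then show "z \<in> (\<lambda>t. cut_at t y) ` {ht q..ht y}" by auto
  qed
  show "(\<lambda>t. cut_at t y) ` {ht q..ht y} \<subseteq> seg q y"
  proof clarify
    fix t assume t: "t \<in> {ht q..ht y}"
    have "ht (cut_at t y) = t" using cut_at(2)[OF assms(1)] t ht_nonneg[OF I_in[OF assms]] by auto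
    then show "cut_at t y \<in> seg q y"
      using cut_at(1)[OF assms(1)] I_by_ht[OF assms(1,2)] t by (auto simp: seg_def)
  qed
qed

lemma seg_arc:
  assumes "y \<in> X" "q \<in> I y" "q \<noteq> y"
  obtains g where "arc g" "path_image g = seg q y" "pathstart g = q" "pathfinish g = y"
proof -
  define g where "g s = cut_at ((1 - s) * ht q + s * ht y) y" for s
  have q: "q \<in> X" "ht q < ht y" "0 \<le> ht q"
    using I_in[OF assms(1,2)] ht_strict[OF assms] ht_nonneg by auto
  have lin: "(\<lambda>s. (1 - s) * ht q + s * ht y) ` {0..1} = {ht q..ht y}"
    using closed_segment_eq_real_ivl[of "ht q" "ht y"] q closed_segment_image_interval[of "ht q" "ht y"] by simp
  have "path g" unfolding path_def g_def[abs_def]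
    by (intro continuous_cut_at_comp continuous_intros assms)
  moreover have "inj_on g {0..1}"
  proof (rule inj_onI)
    fix s t :: real assume st: "s \<in> {0..1}" "t \<in> {0..1}" "g s = g t"
    have "ht (g s) = (1 - s) * ht q + s * ht y" if "s \<in> {0..1}" for s
    proof -
      have "(1 - s) * ht q + s * ht y \<in> {ht q..ht y}" using lin that by blast
      then show ?thesis unfolding g_def using cut_at(2)[OF assms(1)] q by auto
    qed
    then have "(1 - s) * ht q + s * ht y = (1 - t) * ht q + t * ht y" using st by metis
    then have "(s - t) * (ht y - ht q) = 0" by (simp add: algebra_simps)
    then show "s = t" using q by auto
  qed
  moreover have "path_image g = seg q y"
  proof -
    have "path_image g = (\<lambda>t. cut_at t y) ` ((\<lambda>s. (1 - s) * ht q + s * ht y) ` {0..1})"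
      unfolding path_image_def g_def[abs_def] image_image ..
    then show ?thesis unfolding lin seg_image[OF assms(1,2)] .
  qed
  moreover have "pathstart g = q" "pathfinish g = y"
    using cut_at_ht[OF assms(1,2)] cut_at_ht[OF assms(1) I_self[OF assms(1)]]
    by (auto simp: g_def pathstart_def pathfinish_def)
  ultimately show thesis using that by (auto simp: arc_def)
qed

lemma seg_self: "y \<in> X \<Longrightarrow> seg y y = {y}"
  using I_antisym I_self by (auto simp: seg_def)

lemma seg_ends: "y \<in> X \<Longrightarrow> q \<in> I y \<Longrightarrow> q \<in> seg q y \<and> y \<in> seg q y"
  using I_self I_sub by (auto simp: seg_def)

lemma connected_seg: "y \<in> X \<Longrightarrow> q \<in> I y \<Longrightarrow> connected (seg q y)"
  using seg_arc[of y q] seg_self connected_arc_image by (metis connected_sing)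

lemma compact_seg: "y \<in> X \<Longrightarrow> q \<in> I y \<Longrightarrow> compact (seg q y)"
  using seg_arc[of y q] seg_self compact_arc_image by (metis compact_sing)

lemma connected_up:
  assumes "q \<in> X" shows "connected (up q)"
proof -
  have "up q = \<Union>(seg q ` up q)"
    using seg_ends I_in by (fastforce simp: up_def seg_def)
  moreover have "connected (\<Union>(seg q ` up q))"
  proof (rule connected_Union)
    have "q \<in> \<Inter>(seg q ` up q)" using seg_ends by (auto simp: up_def)
    then show "\<Inter>(seg q ` up q) \<noteq> {}" by blast
  qed (use connected_seg in \<open>auto simp: up_def\<close>)
  ultimately show ?thesis by simp
qed

lemma closed_up: "closed (up q)"
  unfolding closed_sequential_limits
proof (intro allI impI, elim conjE)
  fix f l assume f: "\<forall>n. f n \<in> up q" "f \<longlonglongrightarrow> l"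
  then have "f n \<in> X" "q \<in> I (f n)" for n by (auto simp: up_def)
  from closed_order[OF this f(2) tendsto_const] show "l \<in> up q" by (simp add: up_def)
qed

lemma ht_bounded: obtains M where "\<And>x. x \<in> X \<Longrightarrow> ht x \<le> M"
proof -
  have "compact (ht ` X)" by (intro compact_continuous_image continuous_ht compact_X)
  then have "bdd_above (ht ` X)" by (intro bounded_imp_bdd_above compact_imp_bounded)
  then show thesis using that unfolding bdd_above_def by blast
qed

lemma up_trans: "q \<in> I z \<Longrightarrow> up z \<subseteq> up q"
  using I_trans by (auto simp: up_def)

text \<open>Smoothness with a moving lower end: points of the two intervals are matched by height,
  and \<open>cut_at\<close> is uniformly continuous on compact sets.\<close>

lemma hausdorff_seg:
  assumes "y \<in> X" "q \<in> I y" "e > 0"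
  shows "\<exists>d>0. \<forall>q'\<in>X. \<forall>y'\<in>X. q' \<in> I y' \<longrightarrow> dist q' q < d \<longrightarrow> dist y' y < d \<longrightarrow>
    hausdorff_distance (seg q' y') (seg q y) < e"
proof -
  have q: "q \<in> X" using assms I_sub by blast
  obtain M where M: "\<And>x. x \<in> X \<Longrightarrow> ht x \<le> M" using ht_bounded by blast
  have "uniformly_continuous_on ({0..M} \<times> X) (\<lambda>(t, x). cut_at t x)"
    by (intro compact_uniformly_continuous continuous_on_subset[OF continuous_cut_at] compact_Times compact_X) auto
  then obtain d1 where d1: "d1 > 0" "\<And>a b. a \<in> {0..M} \<times> X \<Longrightarrow> b \<in> {0..M} \<times> X \<Longrightarrow> dist b a < d1 \<Longrightarrow>
      dist (case b of (t, x) \<Rightarrow> cut_at t x) (case a of (t, x) \<Rightarrow> cut_at t x) < e/2"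
    unfolding uniformly_continuous_on_def using assms(3) by (metis half_gt_zero)
  have uc: "dist (cut_at t x) (cut_at s z) < e/2"
    if "t \<in> {0..M}" "s \<in> {0..M}" "x \<in> X" "z \<in> X" "\<bar>t - s\<bar> < d1/2" "dist x z < d1/2" for t s x z
  proof -
    have "dist (t, x) (s, z) \<le> \<bar>t - s\<bar> + dist x z"
      unfolding dist_prod_def using sqrt_sum_squares_le_sum_abs[of "dist t s" "dist x z"] by (simp add: dist_real_def)
    then show ?thesis using d1(2)[of "(s, z)" "(t, x)"] that by auto
  qed
  obtain d2 where d2: "d2 > 0" "\<And>q'. q' \<in> X \<Longrightarrow> dist q' q < d2 \<Longrightarrow> dist (ht q') (ht q) < d1/2"
    using continuous_ht q d1(1) unfolding continuous_on_iff by (metis half_gt_zero)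
  have key: "\<exists>z'\<in>seg q' y'. dist z z' \<le> e/2"
    if h: "y \<in> X" "q \<in> I y" "y' \<in> X" "q' \<in> I y'" "\<bar>ht q' - ht q\<bar> < d1/2" "dist y' y < d1/2" "z \<in> seg q y" for q y q' y' z
  proof -
    have zI: "z \<in> I y" "q \<in> I z" using h(7) by (auto simp: seg_def)
    have z: "z = cut_at (ht z) y" "ht q \<le> ht z" "z \<in> X" "q \<in> X" "q' \<in> X"
      using cut_at_ht[OF h(1) zI(1)] ht_mono[OF I_in[OF h(1) zI(1)] zI(2)] I_in[OF h(1) zI(1)]
        I_in[OF h(1,2)] I_in[OF h(3,4)] by simp_all
    \<comment> \<open>The height of \<open>z\<close>, raised to that of the new lower end if
      necessary; excess over \<open>ht y'\<close> is clamped by \<open>cut_at\<close>.\<close>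
    define t where "t = max (ht z) (ht q')"
    have t: "t \<in> {0..M}" "\<bar>ht z - t\<bar> < d1/2" "ht q' \<le> t" using z(2) h(5) M[OF z(3)] M[OF z(5)] ht_nonneg[OF z(3)] unfolding t_def atLeastAtMost_iff
      by linarith+
    have "ht q' \<le> ht (cut_at t y')" using cut_at(2)[OF h(3)] t ht_mono[OF h(3,4)] by auto
    then have "cut_at t y' \<in> seg q' y'"
      using I_by_ht[OF h(3,4)] cut_at(1)[OF h(3)] by (auto simp: seg_def)
    moreover have "dist (cut_at (ht z) y) (cut_at t y') < e/2"
      using z h t M ht_nonneg by (intro uc) (auto simp: dist_commute)
    ultimately show ?thesis using z(1) by (metis less_imp_le)
  qed
  show ?thesis
  proof (intro exI[of _ "min d2 (d1/2)"] conjI ballI impI)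
    fix q' y' assume h: "q' \<in> X" "y' \<in> X" "q' \<in> I y'" "dist q' q < min d2 (d1/2)" "dist y' y < min d2 (d1/2)"
    have hq: "\<bar>ht q' - ht q\<bar> < d1/2" "\<bar>ht q - ht q'\<bar> < d1/2"
      using d2(2)[OF h(1)] h by (auto simp: dist_real_def abs_minus_commute)
    have "hausdorff_distance (seg q' y') (seg q y) \<le> e/2"
    proof (rule hausdorff_distance_le)
      show "seg q' y' \<noteq> {}" "seg q y \<noteq> {}" using seg_ends h assms by blast+
      show "\<exists>b\<in>seg q y. dist a b \<le> e/2" if "a \<in> seg q' y'" for a
        using key[OF h(2,3) assms(1,2) hq(2) _ that] h by (simp add: dist_commute)
      show "\<exists>a\<in>seg q' y'. dist b a \<le> e/2" if "b \<in> seg q y" for b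
        using key[OF assms(1,2) h(2,3) hq(1) _ that] h by simp
    qed
    then show "hausdorff_distance (seg q' y') (seg q y) < e" using assms(3) by simp
  qed (use d1 d2 in auto)
qed

end

section \<open>Level sets, maximal points and subdendroids\<close>

context rooted_dendroid begin

definition level where "level t = {x \<in> X. ht x = t}"

lemma compact_level: "compact (level t)"
proof -
  have "closedin (top_of_set X) (X \<inter> ht -` {t})"
    by (intro continuous_closedin_preimage continuous_ht) auto
  moreover have "X \<inter> ht -` {t} = level t" by (auto simp: level_def)
  ultimately show ?thesis using closedin_compact compact_X by metis
qed

lemma level_I: "x \<in> level t \<Longrightarrow> y \<in> I x \<Longrightarrow> y \<in> level t \<Longrightarrow> y = x"
  using ht_strict[of x y] by (auto simp: level_def)

lemma continuum_I_Un:
  assumes "x \<in> X" "y \<in> X" shows "continuum (I x \<union> I y)"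
  unfolding continuum_def
proof (intro conjI)
  have "p \<in> I x \<inter> I y" using assms p_in_I by blast
  then have "I x \<inter> I y \<noteq> {}" by blast
  then show "connected (I x \<union> I y)" using assms connected_I by (intro connected_Un)
qed (use assms I_ne compact_I in \<open>auto intro!: compact_Un\<close>)

lemma connected_Int_I_Un:
  assumes "x \<in> X" "y \<in> X" "continuum B" "B \<subseteq> X" shows "connected ((I x \<union> I y) \<inter> B)"
  using unicoherent_X continuum_I_Un[OF assms(1,2)] I_sub[OF assms(1)] I_sub[OF assms(2)] assms(3,4)
  unfolding hereditarily_unicoherent_def by (metis Un_least)

text \<open>The height is strictly monotone along arcs, so the continuum
  \<open>I x \<union> I y\<close> meets the closure of \<open>Z\<close> only in \<open>x\<close> and
  \<open>y\<close>. By unicoherence \<open>{x, y}\<close> is connected.\<close>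

lemma connected_level_subset:
  assumes Z: "connected Z" "Z \<subseteq> level t" "x \<in> Z" "y \<in> Z"
  shows "x = y"
proof -
  have cl: "closure Z \<subseteq> level t"
    using Z(2) compact_level compact_imp_closed closure_minimal by blast
  have xy: "x \<in> X" "y \<in> X" "x \<in> level t" "y \<in> level t" using Z by (auto simp: level_def)
  have "continuum (closure Z)"
    unfolding continuum_def
  proof (intro conjI)
    show "closure Z \<noteq> {}" using Z(3) by auto
    show "compact (closure Z)"
      using compact_Int_closed[OF compact_level[of t] closed_closure[of Z]] cl by (simp add: Int_absorb1)
    show "connected (closure Z)" using Z(1) by (rule connected_imp_connected_closure)
  qed
  moreover have "closure Z \<subseteq> X" using cl by (auto simp: level_def)
  ultimately have "connected ((I x \<union> I y) \<inter> closure Z)" using connected_Int_I_Un xy by blast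
  moreover have "(I x \<union> I y) \<inter> closure Z = {x, y}"
  proof
    show "(I x \<union> I y) \<inter> closure Z \<subseteq> {x, y}" using cl xy level_I by blast
    show "{x, y} \<subseteq> (I x \<union> I y) \<inter> closure Z" using Z closure_subset[of Z] I_self xy by blast
  qed
  ultimately have "connected {x, y}" by simp
  then show ?thesis
    using connected_finite_iff_sing[of "{x, y}"] by auto
qed

definition up_from where "up_from t F = {x \<in> X. t \<le> ht x \<and> cut_at t x \<in> F}"

lemma cut_at_level:
  assumes "x \<in> X" "0 \<le> t" "t \<le> ht x" shows "cut_at t x \<in> level t"
  using cut_at(2)[OF assms(1)] cut_at_in[OF assms(1)] assms by (auto simp: level_def)

lemma continuous_cut_at_fixed: "continuous_on X (cut_at t)"
  using continuous_cut_at_comp[of X "\<lambda>_. t" "\<lambda>x. x"] by auto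

lemma compact_up_from:
  assumes "closed F" shows "compact (up_from t F)"
proof -
  have "closedin (top_of_set X) (X \<inter> ht -` {t..})" "closedin (top_of_set X) (X \<inter> cut_at t -` F)"
    by (intro continuous_closedin_preimage continuous_ht continuous_cut_at_fixed assms closed_atLeast)+
  then have "closedin (top_of_set X) ((X \<inter> ht -` {t..}) \<inter> (X \<inter> cut_at t -` F))" by (rule closedin_Int)
  moreover have "(X \<inter> ht -` {t..}) \<inter> (X \<inter> cut_at t -` F) = up_from t F" by (auto simp: up_from_def)
  ultimately show ?thesis using closedin_compact compact_X by metis
qed

lemma cut_at_le:
  assumes "z \<in> X" "y \<in> I z" "0 \<le> t" "t \<le> ht y" shows "cut_at t z = cut_at t y"
proof -
  have y: "y \<in> X" using I_in assms by blast
  have "cut_at t y \<in> I z" using cut_at(1)[OF y] I_trans[OF assms(1,2)] by blast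
  moreover have "ht (cut_at t y) = max 0 (min t (ht z))"
    using cut_at(2)[OF y] ht_mono[OF assms(1,2)] assms by auto
  ultimately show ?thesis using cut_at_unique[OF assms(1)] by metis
qed

lemma up_from_up:
  assumes "y \<in> up_from t F" "z \<in> X" "y \<in> I z" "0 \<le> t" shows "z \<in> up_from t F"
  using assms cut_at_le[OF assms(2,3,4)] ht_mono[OF assms(2,3)] by (auto simp: up_from_def)

lemma openin_up_from:
  assumes "openin (top_of_set (level t)) F" "0 \<le> t"
  shows "openin (top_of_set X) {x \<in> X. t < ht x \<and> cut_at t x \<in> F}"
proof -
  have 1: "openin (top_of_set X) (X \<inter> ht -` {t<..})"
    by (intro continuous_openin_preimage_gen continuous_ht) auto
  have "openin (top_of_set (X \<inter> ht -` {t<..})) ((X \<inter> ht -` {t<..}) \<inter> cut_at t -` F)"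
    by (rule continuous_openin_preimage[OF continuous_on_subset[OF continuous_cut_at_fixed] _ assms(1)])
      (use cut_at_level assms in auto)
  then have "openin (top_of_set X) ((X \<inter> ht -` {t<..}) \<inter> cut_at t -` F)"
    using 1 openin_trans by blast
  moreover have "(X \<inter> ht -` {t<..}) \<inter> cut_at t -` F = {x \<in> X. t < ht x \<and> cut_at t x \<in> F}" by auto
  ultimately show ?thesis by simp
qed

lemma small_up_from:
  assumes e: "e \<in> X" "up e = {e}" and U: "open U" "e \<in> U"
  shows "\<exists>d>0. \<forall>t. ht e - d < t \<longrightarrow> t < ht e \<longrightarrow> 0 \<le> t \<longrightarrow>
    (\<exists>F. openin (top_of_set (level t)) F \<and> compact F \<and> cut_at t e \<in> F \<and> up_from t F \<subseteq> U)"
proof -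
  have "\<exists>d>0. \<forall>t. ht e - d < t \<longrightarrow> t < ht e \<longrightarrow> up (cut_at t e) \<subseteq> U"
  proof (rule ccontr)
    assume "\<not> ?thesis"
    then have "\<forall>n. \<exists>t. ht e - inverse (real (Suc n)) < t \<and> t < ht e \<and> \<not> up (cut_at t e) \<subseteq> U"
      by (metis inverse_positive_iff_positive of_nat_0_less_iff zero_less_Suc)
    then obtain t where t: "\<And>n. ht e - inverse (real (Suc n)) < t n" "\<And>n. t n < ht e"
      "\<And>n. \<not> up (cut_at (t n) e) \<subseteq> U" by metis
    then have "\<exists>y. y \<in> X - U \<and> cut_at (t n) e \<in> I y" for n unfolding up_def by blast
    then obtain y where y: "\<And>n. y n \<in> X - U" "\<And>n. cut_at (t n) e \<in> I (y n)" by metis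
    have "compact (X - U)" using compact_X U(1) by (rule compact_diff)
    then obtain l r where l: "l \<in> X - U" "strict_mono r" "(y \<circ> r) \<longlonglongrightarrow> l"
      using y(1) unfolding compact_def by blast
    have "t \<longlonglongrightarrow> ht e"
    proof (rule tendsto_sandwich)
      show "(\<lambda>n. ht e - inverse (real (Suc n))) \<longlonglongrightarrow> ht e"
        using tendsto_diff[OF tendsto_const LIMSEQ_inverse_real_of_nat] by simp
      show "(\<lambda>n. ht e) \<longlonglongrightarrow> ht e" by simp
    qed (use t in \<open>auto intro!: always_eventually less_imp_le\<close>)
    then have "(t \<circ> r) \<longlonglongrightarrow> ht e" using l(2) LIMSEQ_subseq_LIMSEQ by blast
    moreover have "continuous_on UNIV (\<lambda>t. cut_at t e)"
      using e by (intro continuous_cut_at_comp) auto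
    then have "isCont (\<lambda>t. cut_at t e) (ht e)" by (simp add: continuous_on_eq_continuous_at)
    ultimately have "(\<lambda>n. cut_at ((t \<circ> r) n) e) \<longlonglongrightarrow> cut_at (ht e) e"
      by (rule isCont_tendsto_compose[rotated])
    then have "(\<lambda>n. cut_at (t (r n)) e) \<longlonglongrightarrow> e"
      using cut_at_ht[OF e(1) I_self[OF e(1)]] by (simp add: comp_def)
    with closed_order[of "y \<circ> r" "\<lambda>n. cut_at (t (r n)) e" l e] have "e \<in> I l"
      using y l(3) by auto
    then have "l \<in> up e" using l by (auto simp: up_def)
    then show False using e l U by auto
  qed
  then obtain d where d: "d > 0" "\<And>t. ht e - d < t \<Longrightarrow> t < ht e \<Longrightarrow> up (cut_at t e) \<subseteq> U" by blast
  have "\<exists>F. openin (top_of_set (level t)) F \<and> compact F \<and> cut_at t e \<in> F \<and> up_from t F \<subseteq> U"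
    if t: "ht e - d < t" "t < ht e" "0 \<le> t" for t
  proof -
    define x where "x = cut_at t e"
    have x: "x \<in> level t" using t e by (simp add: x_def cut_at_level)
    \<comment> \<open>The points of the level that lie below some point of \<open>X - U\<close>;
      \<open>F\<close> has to miss them.\<close>
    define B where "B = cut_at t ` ((X - U) \<inter> ht -` {t..})"
    have "closedin (top_of_set (X - U)) ((X - U) \<inter> ht -` {t..})"
      by (intro continuous_closedin_preimage continuous_on_subset[OF continuous_ht]) auto
    then have "compact ((X - U) \<inter> ht -` {t..})"
      using closedin_compact compact_diff[OF compact_X U(1)] by metis
    then have "compact B" unfolding B_def
      by (intro compact_continuous_image continuous_on_subset[OF continuous_cut_at_fixed]) auto
    have "x \<notin> B"
    proof
      assume "x \<in> B"
      then obtain y where y: "y \<in> X" "y \<notin> U" "x = cut_at t y" by (auto simp: B_def)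
      then have "x \<in> I y" using cut_at(1) by metis
      then have "y \<in> up x" using y by (simp add: up_def)
      then show False using d(2)[OF t(1,2)] y by (auto simp: x_def)
    qed
    have "connected_component_set (level t) x = {x}"
    proof
      show "connected_component_set (level t) x \<subseteq> {x}"
        using connected_level_subset[OF connected_connected_component connected_component_subset] x
        by (metis connected_component_refl_eq mem_Collect_eq singletonI subsetI)
      show "{x} \<subseteq> connected_component_set (level t) x" using x by simp
    qed
    then have "{x} \<in> components (level t)" using x by (metis componentsI)
    then obtain F where F: "openin (top_of_set (level t)) F" "compact F" "{x} \<subseteq> F" "F \<subseteq> - B"
      using Sura_Bura_clopen_subset[of "level t" "{x}" "- B"] compact_level closed_imp_locally_compact
        compact_imp_closed \<open>compact B\<close> \<open>x \<notin> B\<close> by (metis Compl_iff compact_sing empty_subsetI insert_subset open_Compl)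
    have "up_from t F \<subseteq> U"
    proof
      fix y assume y: "y \<in> up_from t F"
      show "y \<in> U"
      proof (rule ccontr)
        assume "y \<notin> U"
        then have "cut_at t y \<in> B" using y by (auto simp: B_def up_from_def)
        then show False using y F(4) by (auto simp: up_from_def)
      qed
    qed
    then show ?thesis using F x_def by blast
  qed
  then show ?thesis using d(1) by blast
qed

text \<open>\<open>p\<close> is excluded because it can be an endpoint without being maximal, which
  calls for separate treatment.\<close>

definition Emax where "Emax = {e \<in> X. e \<noteq> p \<and> up e = {e}}"

lemma Emax_maximal: "e \<in> Emax \<Longrightarrow> y \<in> X \<Longrightarrow> e \<in> I y \<Longrightarrow> y = e"
  by (auto simp: Emax_def up_def)

lemma endpoints_subset: "endpoints X \<subseteq> insert p Emax"
proof
  fix e assume e: "e \<in> endpoints X"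
  show "e \<in> insert p Emax"
  proof (cases "e = p")
    case False
    have "y = e" if y: "y \<in> X" "e \<in> I y" for y
    proof -
      have "y \<noteq> p" using y False I_p by auto
      then obtain g where "arc g" "path_image g = I y" "pathstart g = y" "pathfinish g = p" "I y \<subseteq> X"
        using I_arc[OF y(1)] by metis
      then show ?thesis using e y(2) False unfolding endpoints_def by force
    qed
    then show ?thesis using False e I_self unfolding Emax_def up_def endpoints_def by blast
  qed simp
qed

text \<open>By unicoherence an arc lies in the union of the arcs from \<open>p\<close> to its two
  ends. A maximal point on it is thus below one of the ends, and equal to it.\<close>

lemma Emax_subset: "Emax \<subseteq> endpoints X"
proof
  fix e assume e: "e \<in> Emax"
  have eX: "e \<in> X" using e by (simp add: Emax_def)
  have "e = pathstart g \<or> e = pathfinish g"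
    if g: "arc g" "path_image g \<subseteq> X" "e \<in> path_image g" for g
  proof (rule ccontr)
    assume ne: "\<not> ?thesis"
    let ?u = "pathstart g" and ?v = "pathfinish g"
    have uv: "?u \<in> X" "?v \<in> X" "?u \<in> path_image g" "?v \<in> path_image g"
      using g(2) by auto
    have "continuum (path_image g)"
      using g(1) by (simp add: continuum_def compact_arc_image connected_arc_image)
    then have "connected ((I ?u \<union> I ?v) \<inter> path_image g)" using connected_Int_I_Un uv g(2) by blast
    then have "(I ?u \<union> I ?v) \<inter> path_image g = path_image g"
      using uv I_self by (intro connected_subset_arc_eq g(1)) auto
    then have "e \<in> I ?u \<union> I ?v" using g(3) by blast
    then show False using Emax_maximal[OF e] uv ne by auto
  qed
  then show "e \<in> endpoints X" using eX unfolding endpoints_def by blast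
qed

lemma path_connected_seg: "y \<in> X \<Longrightarrow> q \<in> I y \<Longrightarrow> path_connected (seg q y)"
  using seg_arc[of y q] seg_self path_connected_path_image arc_imp_path by (metis path_connected_singleton)

text \<open>\<open>K\<close> is compact as an image under \<open>cut_at\<close>. Its arcs from
  \<open>b\<close> are order intervals of \<open>X\<close>, so it is smooth at \<open>b\<close> by
  \<open>hausdorff_seg\<close> with fixed lower end, and points strictly inside these intervals are
  not endpoints.\<close>

lemma subdendroid:
  assumes D: "D \<noteq> {}" "compact D" "D \<subseteq> X" and b: "\<And>d. d \<in> D \<Longrightarrow> b \<in> I d"
  defines "K \<equiv> \<Union>(seg b ` D)"
  shows "smooth_dendroid K" "K \<subseteq> X" "endpoints K \<subseteq> insert b D"
proof -
  have Kiff: "y \<in> K \<longleftrightarrow> (\<exists>d\<in>D. y \<in> I d) \<and> b \<in> I y" for y unfolding K_def seg_def by blast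
  show KX: "K \<subseteq> X" using Kiff D(3) I_in by blast
  have bX: "b \<in> X" using D b I_in by blast
  have bK: "b \<in> K" using Kiff D(1) b I_self[OF bX] by blast
  have segK: "seg b x \<subseteq> K" if xK: "x \<in> K" for x
  proof
    fix z assume "z \<in> seg b x"
    then have z: "z \<in> I x" "b \<in> I z" by (auto simp: seg_def)
    obtain d where "d \<in> D" "x \<in> I d" using Kiff xK by blast
    then have "z \<in> I d" using z(1) I_trans D(3) by blast
    then show "z \<in> K" using Kiff \<open>d \<in> D\<close> z(2) by blast
  qed
  obtain M where M: "\<And>x. x \<in> X \<Longrightarrow> ht x \<le> M" using ht_bounded by blast
  have "K = (\<lambda>(t, d). cut_at t d) ` ({ht b..M} \<times> D)"
  proof
    show "K \<subseteq> (\<lambda>(t, d). cut_at t d) ` ({ht b..M} \<times> D)"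
    proof
      fix y assume "y \<in> K"
      then obtain d where d: "d \<in> D" "y \<in> seg b d" unfolding K_def by blast
      then obtain t where "t \<in> {ht b..ht d}" "y = cut_at t d" using seg_image[of d b] D(3) b by blast
      then show "y \<in> (\<lambda>(t, d). cut_at t d) ` ({ht b..M} \<times> D)"
        using d(1) M[of d] D(3) by (intro image_eqI[of _ _ "(t, d)"]) auto
    qed
    show "(\<lambda>(t, d). cut_at t d) ` ({ht b..M} \<times> D) \<subseteq> K"
    proof clarify
      fix t d assume t: "t \<in> {ht b..M}" "d \<in> D"
      have dX: "d \<in> X" "b \<in> I d" using t D(3) b by auto
      have "ht b \<le> ht (cut_at t d)"
        using cut_at(2)[OF dX(1)] t ht_mono[OF dX] by auto
      then have "b \<in> I (cut_at t d)" using I_by_ht[OF dX(1,2)] cut_at(1)[OF dX(1)] by blast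
      then show "cut_at t d \<in> K" using Kiff t(2) cut_at(1)[OF dX(1)] by blast
    qed
  qed
  moreover have "compact ((\<lambda>(t, d). cut_at t d) ` ({ht b..M} \<times> D))"
    by (intro compact_continuous_image continuous_on_subset[OF continuous_cut_at] compact_Times D) (use D in auto)
  ultimately have "compact K" by simp
  moreover have "connected K" unfolding K_def
  proof (rule connected_Union)
    have "b \<in> \<Inter>(seg b ` D)" using seg_ends b D(3) by blast
    then show "\<Inter>(seg b ` D) \<noteq> {}" by blast
  qed (use connected_seg b D(3) in auto)
  ultimately have "continuum K" using bK by (auto simp: continuum_def)
  moreover have huK: "hereditarily_unicoherent K"
    using unicoherent_X KX unfolding hereditarily_unicoherent_def by (meson order_trans)
  moreover have "arcwise_connected K"
    unfolding arcwise_connected_def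
  proof (intro ballI impI)
    fix x y assume xy: "x \<in> K" "y \<in> K" "x \<noteq> y"
    have xX: "x \<in> X" "y \<in> X" "b \<in> I x" "b \<in> I y" using xy KX Kiff by auto
    have "b \<in> seg b x \<inter> seg b y" using seg_ends xX by blast
    then have "seg b x \<inter> seg b y \<noteq> {}" by blast
    then have "path_connected (seg b x \<union> seg b y)"
      using xX by (intro path_connected_Un path_connected_seg)
    then obtain g where "arc g" "path_image g \<subseteq> seg b x \<union> seg b y" "pathstart g = x" "pathfinish g = y"
      using seg_ends xX xy(3) unfolding path_connected_arcwise by (metis UnI1 UnI2)
    then show "\<exists>g. arc g \<and> path_image g \<subseteq> K \<and> pathstart g = x \<and> pathfinish g = y"
      using segK xy by blast
  qed
  ultimately have dK: "dendroid K" by (simp add: dendroid_def)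
  have ab: "arc_between K x b = seg b x" if "x \<in> K" for x
  proof (cases "x = b")
    case True
    then show ?thesis using seg_self bX by (simp add: arc_between_def)
  next
    case False
    have x: "x \<in> X" "b \<in> I x" using that KX Kiff by auto
    obtain g where g: "arc g" "path_image g = seg b x" "pathstart g = b" "pathfinish g = x"
      using seg_arc[OF x] False by metis
    show ?thesis
      using arc_between_eq[OF huK arc_reversepath[OF g(1)]] g segK[OF that] by simp
  qed
  show "smooth_dendroid K"
    unfolding smooth_dendroid_def
  proof (intro conjI dK bexI[of _ b] bK allI impI, elim conjE)
    fix s x assume s: "\<forall>n::nat. s n \<in> K" "x \<in> K" "s \<longlonglongrightarrow> x"
    show "(\<lambda>n. hausdorff_distance (arc_between K (s n) b) (arc_between K x b)) \<longlonglongrightarrow> 0"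
    proof (rule LIMSEQ_I)
      fix r :: real assume r: "0 < r"
      have x: "x \<in> X" "b \<in> I x" using s KX Kiff by auto
      obtain d where d: "d > 0" "\<forall>q'\<in>X. \<forall>y'\<in>X. q' \<in> I y' \<longrightarrow> dist q' b < d \<longrightarrow> dist y' x < d \<longrightarrow>
        hausdorff_distance (seg q' y') (seg b x) < r" using hausdorff_seg[OF x r] by blast
      obtain N where N: "\<And>n. n \<ge> N \<Longrightarrow> dist (s n) x < d" using s(3) d(1) unfolding lim_sequentially by blast
      have "norm (hausdorff_distance (arc_between K (s n) b) (arc_between K x b) - 0) < r" if "n \<ge> N" for n
      proof -
        have sn: "s n \<in> X" "b \<in> I (s n)" using s KX Kiff by auto
        have "hausdorff_distance (seg b (s n)) (seg b x) < r" using d N[OF that] sn bX by auto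
        moreover have "0 \<le> hausdorff_distance (seg b (s n)) (seg b x)"
          using seg_ends[OF sn] seg_ends[OF x] by (intro hausdorff_nonneg compact_seg sn) auto
        ultimately show ?thesis using ab s by simp
      qed
      then show "\<exists>N. \<forall>n\<ge>N. norm (hausdorff_distance (arc_between K (s n) b) (arc_between K x b) - 0) < r" by blast
    qed
  qed
  show "endpoints K \<subseteq> insert b D"
  proof
    fix y assume y: "y \<in> endpoints K"
    then have "y \<in> K" by (simp add: endpoints_def)
    then obtain d where d: "d \<in> D" "y \<in> seg b d" unfolding K_def by blast
    have dX: "d \<in> X" "b \<in> I d" using d D(3) b by auto
    show "y \<in> insert b D"
    proof (cases "b = d")
      case True
      then show ?thesis using d seg_self dX by auto
    next
      case False
      obtain g where g: "arc g" "path_image g = seg b d" "pathstart g = b" "pathfinish g = d"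
        using seg_arc[OF dX False] by metis
      moreover have "seg b d \<subseteq> K" using d(1) by (auto simp: K_def)
      ultimately have "y = b \<or> y = d" using y d(2) unfolding endpoints_def by blast
      then show ?thesis using d(1) by blast
    qed
  qed
qed

text \<open>Let \<open>b\<close> be a lowest point of the closure. Cutting at height
  \<open>ht b\<close> sends the connected set \<open>C\<close> into a level, hence to one point,
  which by continuity is \<open>b\<close>. As \<open>b\<close> is in the closure, the endpoints of
  \<open>K\<close> lie between \<open>C\<close> and its closure even if \<open>b\<close> is one of
  them, and so they form a connected set.\<close>

lemma connected_Emax_subdendroid:
  assumes C: "connected C" "C \<subseteq> Emax" "u \<in> C" "v \<in> C" "u \<noteq> v"
  shows "\<exists>K\<subseteq>X. smooth_dendroid K \<and> (\<exists>x\<in>K. \<exists>y\<in>K. x \<noteq> y) \<and> connected (endpoints K)"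
proof -
  have CX: "C \<subseteq> X" using C(2) by (auto simp: Emax_def)
  define D where "D = closure C"
  have CD: "C \<subseteq> D" by (simp add: D_def closure_subset)
  have DX: "D \<subseteq> X" unfolding D_def using CX closed_X closure_minimal by blast
  have D: "compact D" "D \<noteq> {}"
  proof -
    show "compact D" using compact_X DX by (metis D_def closed_closure compact_Int_closed inf.absorb_iff2)
  qed (use CD C in blast)
  obtain b where b: "b \<in> D" "\<And>d. d \<in> D \<Longrightarrow> ht b \<le> ht d"
    using continuous_attains_inf[OF D continuous_on_subset[OF continuous_ht DX]] by blast
  have bX: "b \<in> X" using b DX by blast
  define f where "f = cut_at (ht b)"
  have contf: "continuous_on D f" unfolding f_def using continuous_cut_at_fixed DX continuous_on_subset by blast
  have lev: "f ` C \<subseteq> level (ht b)"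
    unfolding f_def using cut_at_level ht_nonneg[OF bX] b(2) CD CX by blast
  have "connected (f ` C)" using C(1) contf CD continuous_on_subset connected_continuous_image by blast
  then have const: "f c = f u" if "c \<in> C" for c
    using connected_level_subset[OF _ lev] that C(3) by blast
  have fD: "f d = f u" if "d \<in> D" for d
    using continuous_constant_on_closure[OF contf[unfolded D_def] const] that by (simp add: D_def)
  have "f b = b" unfolding f_def by (rule cut_at_ht[OF bX I_self[OF bX]])
  then have bI: "b \<in> I d" if "d \<in> D" for d
    using fD[OF that] fD[OF b(1)] cut_at(1)[of d "ht b"] DX that unfolding f_def by auto
  define K where "K = \<Union>(seg b ` D)"
  note K = subdendroid[OF D(2,1) DX bI, folded K_def]
  have CK: "C \<subseteq> K" unfolding K_def using seg_ends DX bI CD by blast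
  have "C \<subseteq> endpoints K"
  proof
    fix c assume c: "c \<in> C"
    then have "c \<in> endpoints X" using Emax_subset C(2) by blast
    then show "c \<in> endpoints K" using CK c K(2) unfolding endpoints_def by blast
  qed
  moreover have "endpoints K \<subseteq> closure C" using K(3) b(1) by (auto simp: D_def)
  ultimately have "connected (endpoints K)" using C(1) connected_intermediate_closure by blast
  then show ?thesis using K C CK by blast
qed

end

section \<open>Cantor sets of arcs\<close>

lemma compact_UNIV_bool_seq: "compact (UNIV :: (nat \<Rightarrow> bool) set)"
proof -
  have "compact_space (euclidean :: bool topology)"
    by (simp add: compact_space_def finite_imp_compact)
  then have "compact_space (product_topology (\<lambda>i::nat. euclidean :: bool topology) UNIV)"
    by (simp add: compact_space_product_topology)
  then show ?thesis
    by (simp add: euclidean_product_topology compact_space_def)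
qed

lemma open_cylinder: "open {b :: nat \<Rightarrow> bool. \<forall>i<n. b i = a i}"
proof -
  have "{b :: nat \<Rightarrow> bool. \<forall>i<n. b i = a i} = (\<Inter>i\<in>{..<n}. (\<lambda>b. b i) -` {a i})" by auto
  moreover have "open ((\<lambda>b :: nat \<Rightarrow> bool. b i) -` {a i})" for i
    by (intro open_vimage open_discrete continuous_on_product_coordinates)
  ultimately show ?thesis by (simp add: open_INT)
qed

text \<open>By Lindelof, deleting all open sets with countable trace on \<open>A\<close> loses only
  countably many points, and no remaining point is isolated.\<close>

lemma uncountable_condensation:
  fixes A :: "'a::{metric_space, second_countable_topology} set"
  assumes "uncountable A"
  obtains B where "B \<subseteq> A" "B \<noteq> {}" "\<And>x e. x \<in> B \<Longrightarrow> e > 0 \<Longrightarrow> \<exists>y\<in>B. y \<noteq> x \<and> dist y x < e"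
proof -
  define U where "U = {T. open T \<and> countable (A \<inter> T)}"
  obtain V where V: "V \<subseteq> U" "countable V" "\<Union>V = \<Union>U"
    using Lindelof[of U] unfolding U_def by blast
  have "countable (\<Union>T\<in>V. A \<inter> T)" using V by (intro countable_UN) (auto simp: U_def)
  moreover have "(\<Union>T\<in>V. A \<inter> T) = A \<inter> \<Union>U" using V(3) by blast
  ultimately have c: "countable (A \<inter> \<Union>U)" by simp
  define B where "B = A - \<Union>U"
  have "A = B \<union> (A \<inter> \<Union>U)" by (auto simp: B_def)
  then have "uncountable B" using assms c by (metis countable_Un)
  show thesis
  proof
    show "B \<subseteq> A" by (auto simp: B_def)
    show "B \<noteq> {}" using \<open>uncountable B\<close> by auto
    fix x and e :: real assume x: "x \<in> B" "e > 0"
    have "uncountable (A \<inter> ball x e)"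
    proof
      assume "countable (A \<inter> ball x e)"
      then have "ball x e \<in> U" by (simp add: U_def)
      then show False using x by (auto simp: B_def)
    qed
    moreover have "A \<inter> ball x e \<subseteq> (B \<inter> ball x e - {x}) \<union> (A \<inter> \<Union>U) \<union> {x}" by (auto simp: B_def)
    ultimately have "B \<inter> ball x e - {x} \<noteq> {}"
      using c countable_subset by (metis Un_empty_left countable_Un countable_empty countable_insert)
    then show "\<exists>y\<in>B. y \<noteq> x \<and> dist y x < e" by (auto simp: dist_commute)
  qed
qed

text \<open>A binary tree of balls with centres in \<open>P\<close> and radii at least halved at
  each step. One child keeps the centre, the other moves to a nearby point of \<open>P\<close>, and
  the common new radius is so small that \<open>G\<close> holds between the two balls. Limits along
  branches may leave \<open>P\<close>, but they stay in \<open>Z\<close> and in the balls, so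
  \<open>G\<close> persists.\<close>

lemma cantor_scheme:
  fixes Z :: "'z::heine_borel set" and G :: "'z \<Rightarrow> 'z \<Rightarrow> bool"
  assumes Z: "compact Z"
    and G: "\<And>x y. x \<in> Z \<Longrightarrow> y \<in> Z \<Longrightarrow> G x y \<Longrightarrow> \<exists>d>0. \<forall>x'\<in>Z \<inter> cball x d. \<forall>y'\<in>Z \<inter> cball y d. G x' y'"
      "\<And>x y. G x y \<Longrightarrow> G y x"
    and P: "P \<subseteq> Z" "P \<noteq> {}" "\<And>x e. x \<in> P \<Longrightarrow> e > 0 \<Longrightarrow> \<exists>y\<in>P. y \<noteq> x \<and> dist y x < e"
      "\<And>x y. x \<in> P \<Longrightarrow> y \<in> P \<Longrightarrow> x \<noteq> y \<Longrightarrow> G x y"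
  obtains f :: "(nat \<Rightarrow> bool) \<Rightarrow> 'z" where "continuous_on UNIV f" "range f \<subseteq> Z" "\<And>a b. a \<noteq> b \<Longrightarrow> G (f a) (f b)"
proof -
  have "\<forall>s. \<exists>t. fst s \<in> P \<and> snd s > 0 \<longrightarrow> fst t \<in> P \<and> 0 < snd t \<and> snd t \<le> snd s / 2 \<and> dist (fst t) (fst s) \<le> snd s / 2 \<and>
      (\<forall>x'\<in>Z \<inter> cball (fst s) (snd t). \<forall>y'\<in>Z \<inter> cball (fst t) (snd t). G x' y')"
  proof (intro allI)
    fix s :: "'z \<times> real"
    show "\<exists>t. fst s \<in> P \<and> snd s > 0 \<longrightarrow> fst t \<in> P \<and> 0 < snd t \<and> snd t \<le> snd s / 2 \<and> dist (fst t) (fst s) \<le> snd s / 2 \<and>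
      (\<forall>x'\<in>Z \<inter> cball (fst s) (snd t). \<forall>y'\<in>Z \<inter> cball (fst t) (snd t). G x' y')"
    proof (cases "fst s \<in> P \<and> snd s > 0")
      case True
      then obtain y where y: "y \<in> P" "y \<noteq> fst s" "dist y (fst s) < snd s / 2"
        using P(3)[of "fst s" "snd s / 2"] by auto
      then obtain d where d: "d > 0" "\<forall>x'\<in>Z \<inter> cball (fst s) d. \<forall>y'\<in>Z \<inter> cball y d. G x' y'"
        using G(1)[of "fst s" y] P(1) P(4)[of "fst s" y] True by blast
      show ?thesis
        by (rule exI[of _ "(y, min d (snd s / 2))"]) (use y d True in auto)
    qed blast
  qed
  from choice[OF this] obtain ch where ch: "\<And>s. fst s \<in> P \<Longrightarrow> snd s > 0 \<Longrightarrow>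
      fst (ch s) \<in> P \<and> 0 < snd (ch s) \<and> snd (ch s) \<le> snd s / 2 \<and> dist (fst (ch s)) (fst s) \<le> snd s / 2 \<and>
      (\<forall>x'\<in>Z \<inter> cball (fst s) (snd (ch s)). \<forall>y'\<in>Z \<inter> cball (fst (ch s)) (snd (ch s)). G x' y')"
    by blast
  obtain x0 where x0: "x0 \<in> P" using P(2) by blast
  define child where "child c s = ((if c then fst (ch s) else fst s), snd (ch s))" for c and s :: "'z \<times> real"
  define N where "N a n = rec_nat (x0, 1 :: real) (\<lambda>i s. child (a i) s) n" for a :: "nat \<Rightarrow> bool" and n
  have N0: "N a 0 = (x0, 1)" and NS: "N a (Suc n) = child (a n) (N a n)" for a n
    by (simp_all add: N_def)
  have inv: "fst (N a n) \<in> P" "0 < snd (N a n)" "snd (N a n) \<le> (1/2)^n" for a n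
  proof -
    have "fst (N a n) \<in> P \<and> 0 < snd (N a n) \<and> snd (N a n) \<le> (1/2)^n"
    proof (induction n)
      case (Suc n)
      then show ?case using ch[of "N a n"] by (auto simp: NS child_def)
    qed (simp add: N0 x0)
    then show "fst (N a n) \<in> P" "0 < snd (N a n)" "snd (N a n) \<le> (1/2)^n" by auto
  qed
  define F where "F a n = Z \<inter> cball (fst (N a n)) (snd (N a n))" for a n
  have Fdec: "F a (Suc n) \<subseteq> F a n" for a n
  proof -
    have c: "snd (ch (N a n)) \<le> snd (N a n) / 2" "dist (fst (ch (N a n))) (fst (N a n)) \<le> snd (N a n) / 2"
      using ch[OF inv(1,2)] by auto
    have "cball (fst (N a (Suc n))) (snd (N a (Suc n))) \<subseteq> cball (fst (N a n)) (snd (N a n))"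
    proof
      fix z assume "z \<in> cball (fst (N a (Suc n))) (snd (N a (Suc n)))"
      then have z: "dist (fst (N a (Suc n))) z \<le> snd (N a n) / 2" using c(1) by (simp add: NS child_def)
      have "dist (fst (N a n)) (fst (N a (Suc n))) \<le> snd (N a n) / 2"
        using c(2) inv(2)[of a n] by (auto simp: NS child_def dist_commute)
      then have "dist (fst (N a n)) z \<le> snd (N a n)"
        using z dist_triangle[of "fst (N a n)" z "fst (N a (Suc n))"] by linarith
      then show "z \<in> cball (fst (N a n)) (snd (N a n))" by simp
    qed
    then show ?thesis by (auto simp: F_def)
  qed
  have "\<exists>z. \<forall>n. z \<in> F a n" for a
  proof -
    have "\<Inter>(range (F a)) \<noteq> {}"
    proof (rule compact_nest)
      fix n
      show "compact (F a n)" unfolding F_def using Z by (simp add: compact_Int_closed)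
      show "F a n \<noteq> {}" unfolding F_def using inv[of a n] P(1) by (auto simp: less_imp_le intro!: exI[of _ "fst (N a n)"])
      show "F a n \<subseteq> F a m" if "m \<le> n" for m
        using lift_Suc_antimono_le[of "F a", OF Fdec that] .
    qed
    then show ?thesis by blast
  qed
  then obtain f where f: "\<And>a n. f a \<in> F a n" by metis
  have agree: "N a n = N b n" if "\<forall>i<n. b i = a i" for a b n
    using that by (induction n) (auto simp: N0 NS)
  show thesis
  proof
    show "range f \<subseteq> Z" using f[of _ 0] by (auto simp: F_def)
    show "continuous_on UNIV f"
      unfolding continuous_on_def
    proof (intro ballI tendstoI)
      fix a and e :: real assume "e > 0"
      then obtain n where "(1/2::real)^n < e/2" using real_arch_pow_inv[of "e/2" "1/2"] by auto
      then have n: "2 * (1/2::real)^n < e" by simp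
      have "dist (f b) (f a) < e" if "\<forall>i<n. b i = a i" for b
      proof -
        have "dist (fst (N a n)) (f b) \<le> snd (N a n)" "dist (fst (N a n)) (f a) \<le> snd (N a n)"
          using f[of b n] f[of a n] agree[OF that] by (auto simp: F_def)
        then have "dist (f b) (f a) \<le> 2 * snd (N a n)"
          using dist_triangle3[of "f b" "f a" "fst (N a n)"] by linarith
        then show ?thesis using inv(3)[of a n] n by linarith
      qed
      then show "\<forall>\<^sub>F b in at a within UNIV. dist (f b) (f a) < e"
        unfolding eventually_at_topological
        by (intro exI[of _ "{b. \<forall>i<n. b i = a i}"]) (auto simp: open_cylinder)
    qed
    have sep: "G (f a) (f b)" if n: "\<forall>i<n. b i = a i" "\<not> a n" "b n" for a b n
    proof -
      have "N b n = N a n" using agree[OF n(1)] by simp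
      then have "f a \<in> Z \<inter> cball (fst (N a n)) (snd (ch (N a n)))" "f b \<in> Z \<inter> cball (fst (ch (N a n))) (snd (ch (N a n)))"
        using f[of a "Suc n"] f[of b "Suc n"] n by (auto simp: F_def NS child_def)
      then show ?thesis using ch[OF inv(1,2), of a n] by blast
    qed
    fix a b :: "nat \<Rightarrow> bool" assume "a \<noteq> b"
    then have ex: "\<exists>n. a n \<noteq> b n" by auto
    define n where "n = (LEAST n. a n \<noteq> b n)"
    have n1: "a n \<noteq> b n" unfolding n_def by (rule LeastI_ex[OF ex])
    have n2: "a i = b i" if "i < n" for i
      using not_less_Least[of i "\<lambda>n. a n \<noteq> b n"] that unfolding n_def by blast
    show "G (f a) (f b)"
    proof (cases "a n")
      case True
      then have "G (f b) (f a)" using n1 n2 by (intro sep[where n = n]) auto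
      then show ?thesis by (rule G(2))
    next
      case False
      then show ?thesis using n1 n2 by (intro sep[where n = n]) auto
    qed
  qed
qed

text \<open>\<open>Cantor_set_of_arcs\<close> indexes by a set of reals, so the Cantor space is
  first embedded into \<open>{0..1}\<close>, by \<open>cantor_scheme\<close> with
  \<open>(\<noteq>)\<close> as the relation.\<close>

lemma Cantor_set_range:
  fixes g :: "(nat \<Rightarrow> bool) \<Rightarrow> 'z::metric_space"
  assumes "continuous_on UNIV g"
  obtains C :: "real set" and A where "Cantor_set C" "continuous_on C A" "A ` C = range g"
    "\<forall>c\<in>C. \<forall>d\<in>C. c \<noteq> d \<longrightarrow> (\<exists>a b. a \<noteq> b \<and> A c = g a \<and> A d = g b)"
proof -
  have ne: "\<exists>y\<in>{0..1}. y \<noteq> x \<and> dist y x < e" if "x \<in> {0..1}" "e > 0" for x e :: real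
  proof (cases "x < 1")
    case True
    then show ?thesis using that
      by (intro bexI[of _ "x + min (e/2) (1 - x)"]) (auto simp: dist_real_def min_def)
  next
    case False
    then show ?thesis using that
      by (intro bexI[of _ "max 0 (1 - e/2)"]) (auto simp: dist_real_def max_def)
  qed
  obtain \<phi> :: "(nat \<Rightarrow> bool) \<Rightarrow> real" where \<phi>: "continuous_on UNIV \<phi>" "\<And>a b. a \<noteq> b \<Longrightarrow> \<phi> a \<noteq> \<phi> b"
  proof (rule cantor_scheme[of "{0..1::real}" "(\<noteq>)" "{0..1}"])
    fix x y :: real assume "x \<noteq> y"
    then show "\<exists>d>0. \<forall>x'\<in>{0..1} \<inter> cball x d. \<forall>y'\<in>{0..1} \<inter> cball y d. x' \<noteq> y'"
      by (intro exI[of _ "\<bar>x - y\<bar> / 3"]) (auto simp: dist_real_def abs_if split: if_splits)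
  qed (use ne in auto)
  obtain k where k: "homeomorphism UNIV (range \<phi>) \<phi> k"
    using homeomorphism_compact[OF compact_UNIV_bool_seq \<phi>(1) refl] \<phi>(2) by (metis injI)
  show thesis
  proof
    show "Cantor_set (range \<phi>)"
      unfolding Cantor_set_def using k homeomorphic_def homeomorphic_sym by blast
    show "continuous_on (range \<phi>) (g \<circ> k)"
      using k assms by (intro continuous_on_compose) (auto simp: homeomorphism_def)
    show "(g \<circ> k) ` range \<phi> = range g"
      using k unfolding homeomorphism_def by (metis image_comp)
    show "\<forall>c\<in>range \<phi>. \<forall>d\<in>range \<phi>. c \<noteq> d \<longrightarrow> (\<exists>a b. a \<noteq> b \<and> (g \<circ> k) c = g a \<and> (g \<circ> k) d = g b)"
    proof (intro ballI impI)
      fix c d assume "c \<in> range \<phi>" "d \<in> range \<phi>" "c \<noteq> d"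
      then have "k c \<noteq> k d" using k unfolding homeomorphism_def by metis
      then show "\<exists>a b. a \<noteq> b \<and> (g \<circ> k) c = g a \<and> (g \<circ> k) d = g b" by auto
    qed
  qed
qed

context rooted_dendroid begin

lemma ht_tendsto:
  assumes "\<And>n. x n \<in> X" "l \<in> X" "x \<longlonglongrightarrow> l"
  shows "(\<lambda>n. ht (x n)) \<longlonglongrightarrow> ht l"
  using continuous_on_tendsto_compose[OF continuous_ht assms(3,2)] assms(1) by simp

text \<open>Uncountably many of the arcs have ends whose heights differ by at least one fixed
  \<open>e > 0\<close>. Such pairs of ends form a compact set, so limits of these arcs do not
  degenerate to points. Disjointness is an open condition on the ends, and the Cantor scheme is run
  on pairs of ends.\<close>

lemma Cantor_set_of_arcs_from_uncountable:
  assumes J: "uncountable J" "\<And>j. j \<in> J \<Longrightarrow> y j \<in> X" "\<And>j. j \<in> J \<Longrightarrow> q j \<in> I (y j)" "\<And>j. j \<in> J \<Longrightarrow> q j \<noteq> y j"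
    and disj: "\<And>i j. i \<in> J \<Longrightarrow> j \<in> J \<Longrightarrow> i \<noteq> j \<Longrightarrow> seg (q i) (y i) \<inter> seg (q j) (y j) = {}"
  shows "\<exists>\<A>. \<Union>\<A> \<subseteq> X \<and> Cantor_set_of_arcs \<A>"
proof -
  define Jn where "Jn n = {j \<in> J. inverse (real (Suc n)) \<le> ht (y j) - ht (q j)}" for n
  have "J = (\<Union>n. Jn n)"
  proof
    show "J \<subseteq> (\<Union>n. Jn n)"
    proof
      fix j assume j: "j \<in> J"
      then have "0 < ht (y j) - ht (q j)" using ht_strict[of "y j" "q j"] J by simp
      then obtain n where "inverse (real (Suc n)) < ht (y j) - ht (q j)" using reals_Archimedean by blast
      then show "j \<in> (\<Union>n. Jn n)" using j unfolding Jn_def by (auto intro: less_imp_le)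
    qed
  qed (auto simp: Jn_def)
  then obtain n where n: "uncountable (Jn n)" using J(1) countable_UN[of UNIV Jn] by fastforce
  define e where "e = inverse (real (Suc n))"
  have e: "e > 0" by (simp add: e_def)
  define Z where "Z = {z \<in> X \<times> X. fst z \<in> I (snd z) \<and> e \<le> ht (snd z) - ht (fst z)}"
  have "closed Z"
    unfolding closed_sequential_limits
  proof (intro allI impI, elim conjE)
    fix f l assume f: "\<forall>n. f n \<in> Z" "f \<longlonglongrightarrow> l"
    have fZ: "fst (f n) \<in> X" "snd (f n) \<in> X" "fst (f n) \<in> I (snd (f n))" "e \<le> ht (snd (f n)) - ht (fst (f n))" for n
      using f(1) by (auto simp: Z_def mem_Times_iff)
    have lim: "(\<lambda>n. fst (f n)) \<longlonglongrightarrow> fst l" "(\<lambda>n. snd (f n)) \<longlonglongrightarrow> snd l"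
      using f(2) by (auto intro: tendsto_intros)
    have l: "snd l \<in> X" "fst l \<in> I (snd l)" by (rule closed_order[OF fZ(2,3) lim(2,1)])+
    then have "fst l \<in> X" using I_in by blast
    have "(\<lambda>n. ht (snd (f n)) - ht (fst (f n))) \<longlonglongrightarrow> ht (snd l) - ht (fst l)"
      using lim fZ l(1) \<open>fst l \<in> X\<close> by (intro tendsto_diff ht_tendsto)
    then have "e \<le> ht (snd l) - ht (fst l)" by (rule LIMSEQ_le_const) (use fZ(4) in auto)
    then show "l \<in> Z" using l \<open>fst l \<in> X\<close> by (auto simp: Z_def mem_Times_iff)
  qed
  moreover have "X \<times> X \<inter> Z = Z" by (auto simp: Z_def)
  ultimately have Zc: "compact Z"
    using compact_Int_closed[OF compact_Times[OF compact_X compact_X]] by metis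
  define G where "G z w \<longleftrightarrow> seg (fst z) (snd z) \<inter> seg (fst w) (snd w) = {}" for z w :: "'a \<times> 'a"
  have Gopen: "\<exists>d>0. \<forall>z'\<in>Z \<inter> cball z d. \<forall>w'\<in>Z \<inter> cball w d. G z' w'" if zw: "z \<in> Z" "w \<in> Z" "G z w" for z w
  proof -
    have z: "snd z \<in> X" "fst z \<in> I (snd z)" and w: "snd w \<in> X" "fst w \<in> I (snd w)" using zw by (auto simp: Z_def)
    obtain r where r: "r > 0" "\<And>a b. a \<in> seg (fst z) (snd z) \<Longrightarrow> b \<in> seg (fst w) (snd w) \<Longrightarrow> r \<le> dist a b"
      using separate_compact_closed[OF compact_seg[OF z] compact_imp_closed[OF compact_seg[OF w]]] zw(3)
      unfolding G_def by blast
    obtain d1 where d1: "d1 > 0" "\<And>q' y'. q' \<in> X \<Longrightarrow> y' \<in> X \<Longrightarrow> q' \<in> I y' \<Longrightarrow> dist q' (fst z) < d1 \<Longrightarrow> dist y' (snd z) < d1 \<Longrightarrow>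
      hausdorff_distance (seg q' y') (seg (fst z) (snd z)) < r/2" using hausdorff_seg[OF z, of "r/2"] r(1) by auto
    obtain d2 where d2: "d2 > 0" "\<And>q' y'. q' \<in> X \<Longrightarrow> y' \<in> X \<Longrightarrow> q' \<in> I y' \<Longrightarrow> dist q' (fst w) < d2 \<Longrightarrow> dist y' (snd w) < d2 \<Longrightarrow>
      hausdorff_distance (seg q' y') (seg (fst w) (snd w)) < r/2" using hausdorff_seg[OF w, of "r/2"] r(1) by auto
    have near: "\<exists>b\<in>seg (fst z) (snd z). dist a b < r/2"
      if "z' \<in> Z" "z \<in> Z" "hausdorff_distance (seg (fst z') (snd z')) (seg (fst z) (snd z)) < r/2" "a \<in> seg (fst z') (snd z')" for z' z a
    proof -
      have zX: "snd z \<in> X" "fst z \<in> I (snd z)" "snd z' \<in> X" "fst z' \<in> I (snd z')" using that by (auto simp: Z_def)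
      have ne: "seg (fst z) (snd z) \<noteq> {}" using seg_ends[OF zX(1,2)] by blast
      have "infdist a (seg (fst z) (snd z)) < r/2"
        using infdist_le_hausdorff[OF compact_seg[OF zX(3,4)] ne that(4)] that(3) by simp
      then show ?thesis
        using infdist_attains_inf[OF compact_imp_closed[OF compact_seg[OF zX(1,2)]] ne, of a] by metis
    qed
    show ?thesis
    proof (intro exI[of _ "min d1 d2 / 2"] conjI ballI)
      fix z' w' assume h: "z' \<in> Z \<inter> cball z (min d1 d2 / 2)" "w' \<in> Z \<inter> cball w (min d1 d2 / 2)"
      have dz: "dist (fst z') (fst z) < d1" "dist (snd z') (snd z) < d1" "dist (fst w') (fst w) < d2" "dist (snd w') (snd w) < d2"
        using h dist_fst_le[of z z'] dist_snd_le[of z z'] dist_fst_le[of w w'] dist_snd_le[of w w'] d1(1) d2(1)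
        by (auto simp: dist_commute)
      have hz: "hausdorff_distance (seg (fst z') (snd z')) (seg (fst z) (snd z)) < r/2"
        "hausdorff_distance (seg (fst w') (snd w')) (seg (fst w) (snd w)) < r/2"
        using d1(2)[OF _ _ _ dz(1,2)] d2(2)[OF _ _ _ dz(3,4)] h by (auto simp: Z_def)
      show "G z' w'" unfolding G_def
      proof (rule ccontr)
        assume "seg (fst z') (snd z') \<inter> seg (fst w') (snd w') \<noteq> {}"
        then obtain a where a: "a \<in> seg (fst z') (snd z')" "a \<in> seg (fst w') (snd w')" by blast
        obtain b where b: "b \<in> seg (fst z) (snd z)" "dist a b < r/2" using near[OF _ zw(1) hz(1) a(1)] h by blast
        obtain c where c: "c \<in> seg (fst w) (snd w)" "dist a c < r/2" using near[OF _ zw(2) hz(2) a(2)] h by blast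
        show False using r(2)[OF b(1) c(1)] b(2) c(2) dist_triangle3[of b c a] by linarith
      qed
    qed (use d1 d2 in auto)
  qed
  define P0 where "P0 = (\<lambda>j. (q j, y j)) ` Jn n"
  have JJ: "j \<in> J" if "j \<in> Jn n" for j using that by (simp add: Jn_def)
  have "inj_on (\<lambda>j. (q j, y j)) (Jn n)"
  proof (rule inj_onI)
    fix i j assume ij: "i \<in> Jn n" "j \<in> Jn n" "(q i, y i) = (q j, y j)"
    show "i = j"
    proof (rule ccontr)
      assume "i \<noteq> j"
      then have "seg (q i) (y i) = {}" using disj[OF JJ JJ, OF ij(1,2)] ij(3) by simp
      then show False using seg_ends[OF J(2,3), OF JJ JJ, OF ij(1,1)] by simp
    qed
  qed
  then have "uncountable P0" unfolding P0_def using n countable_image_inj_on by blast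
  then obtain P where P: "P \<subseteq> P0" "P \<noteq> {}" "\<And>x e. x \<in> P \<Longrightarrow> e > 0 \<Longrightarrow> \<exists>y\<in>P. y \<noteq> x \<and> dist y x < e"
    using uncountable_condensation by blast
  have P0Z: "P0 \<subseteq> Z"
  proof
    fix z assume "z \<in> P0"
    then obtain j where j: "j \<in> Jn n" "z = (q j, y j)" by (auto simp: P0_def)
    then show "z \<in> Z" using J(2)[OF JJ] J(3)[OF JJ] I_in[OF J(2)[OF JJ] J(3)[OF JJ]] by (auto simp: Z_def Jn_def e_def)
  qed
  have PG: "G z w" if zw: "z \<in> P" "w \<in> P" "z \<noteq> w" for z w
  proof -
    obtain i j where "i \<in> Jn n" "z = (q i, y i)" "j \<in> Jn n" "w = (q j, y j)"
      using zw(1,2) P(1) unfolding P0_def by blast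
    then show ?thesis using disj[of i j] JJ zw(3) by (auto simp: G_def)
  qed
  obtain f :: "(nat \<Rightarrow> bool) \<Rightarrow> 'a \<times> 'a" where f: "continuous_on UNIV f" "range f \<subseteq> Z" "\<And>a b. a \<noteq> b \<Longrightarrow> G (f a) (f b)"
  proof (rule cantor_scheme[OF Zc Gopen _ _ P(2,3) PG])
    show "G x y \<Longrightarrow> G y x" for x y by (auto simp: G_def)
    show "P \<subseteq> Z" using P(1) P0Z by blast
  qed auto
  obtain C :: "real set" and A where C: "Cantor_set C" "continuous_on C A" "A ` C = range f"
    "\<forall>c\<in>C. \<forall>d\<in>C. c \<noteq> d \<longrightarrow> (\<exists>a b. a \<noteq> b \<and> A c = f a \<and> A d = f b)"
    by (rule Cantor_set_range[OF f(1)])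
  define B where "B c = seg (fst (A c)) (snd (A c))" for c
  have AZ: "A c \<in> Z" if "c \<in> C" for c using C(3) f(2) that by blast
  have AX: "snd (A c) \<in> X" "fst (A c) \<in> I (snd (A c))" "fst (A c) \<in> X" "fst (A c) \<noteq> snd (A c)" if "c \<in> C" for c
    using AZ[OF that] e by (auto simp: Z_def)
  have "Cantor_set_of_arcs (B ` C)"
    unfolding Cantor_set_of_arcs_def
  proof (intro exI[of _ C] exI[of _ B] conjI ballI)
    show "Cantor_set C" by fact
    show "\<exists>g. arc g \<and> path_image g = B c" if "c \<in> C" for c
      unfolding B_def using seg_arc[OF AX(1,2,4)[OF that]] by metis
    show "disjoint_family_on B C"
      unfolding disjoint_family_on_def B_def using C(4) f(3) unfolding G_def by metis
    show "((\<lambda>d. hausdorff_distance (B d) (B c)) \<longlongrightarrow> 0) (at c within C)" if c: "c \<in> C" for c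
    proof (rule tendstoI)
      fix r :: real assume "r > 0"
      then obtain d where d: "d > 0" "\<And>q' y'. q' \<in> X \<Longrightarrow> y' \<in> X \<Longrightarrow> q' \<in> I y' \<Longrightarrow> dist q' (fst (A c)) < d \<Longrightarrow>
        dist y' (snd (A c)) < d \<Longrightarrow> hausdorff_distance (seg q' y') (seg (fst (A c)) (snd (A c))) < r"
        using hausdorff_seg[OF AX(1,2)[OF c]] by metis
      have "(A \<longlongrightarrow> A c) (at c within C)" using C(2) c by (auto simp: continuous_on_def)
      then have ev: "\<forall>\<^sub>F x in at c within C. dist (A x) (A c) < d" using d(1) by (rule tendstoD)
      have "\<forall>\<^sub>F x in at c within C. x \<in> C" by (auto simp: eventually_at_filter)
      with ev show "\<forall>\<^sub>F x in at c within C. dist (hausdorff_distance (B x) (B c)) 0 < r"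
      proof eventually_elim
        case (elim x)
        have "hausdorff_distance (B x) (B c) < r"
          unfolding B_def
          by (rule d(2)) (use AX[OF elim(2)] elim(1) dist_fst_le[of "A x" "A c"] dist_snd_le[of "A x" "A c"] in auto)
        moreover have "0 \<le> hausdorff_distance (B x) (B c)"
          unfolding B_def using seg_ends[OF AX(1,2)[OF elim(2)]] seg_ends[OF AX(1,2)[OF c]]
          by (intro hausdorff_nonneg compact_seg AX elim) auto
        ultimately show ?case by simp
      qed
    qed
  qed auto
  moreover have "\<Union>(B ` C) \<subseteq> X"
    using AX I_in unfolding B_def seg_def by blast
  ultimately show ?thesis by blast
qed

end

section \<open>The planar order\<close>

context rooted_dendroid begin

text \<open>Lowering the cutting height from a bound \<open>M\<close> to \<open>0\<close> slides
  every point along its arc into \<open>p\<close>.\<close>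

lemma contractible_X: "contractible X"
proof -
  obtain M where M: "\<And>x. x \<in> X \<Longrightarrow> ht x \<le> M" using ht_bounded by blast
  define H where "H z = cut_at ((1 - fst z) * M) (snd z)" for z :: "real \<times> 'a"
  have "continuous_on ({0..1} \<times> X) H"
    unfolding H_def[abs_def] by (intro continuous_cut_at_comp continuous_intros) auto
  moreover have "H ` ({0..1} \<times> X) \<subseteq> X" using cut_at_in by (auto simp: H_def)
  moreover have "H (0, x) = x" if "x \<in> X" for x
    using cut_at_unique[OF that I_self[OF that]] M[OF that] ht_nonneg[OF that] by (simp add: H_def)
  moreover have "H (1, x) = p" if "x \<in> X" for x
    using cut_at_unique[OF that p_in_I[OF that]] ht_nonneg[OF that] ht_p by (simp add: H_def)
  ultimately have "homotopic_with_canon (\<lambda>x. True) X X id (\<lambda>x. p)"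
    by (subst homotopic_with) (auto intro!: exI[of _ H] simp flip: subtopology_Times)
  then show ?thesis unfolding contractible_def by blast
qed

text \<open>Maps from a contractible set to a sphere are nullhomotopic, so Borsuk's criterion
  applies.\<close>

lemma connected_complement_X:
  assumes "2 \<le> DIM('a)" shows "connected (- X)"
  using Borsuk_separation_theorem[OF compact_X assms] nullhomotopic_from_contractible[OF _ _ contractible_X]
  by metis

lemma connected_complement_I:
  assumes "2 \<le> DIM('a)" "x \<in> X" shows "connected (- I x)"
proof (cases "x = p")
  case True
  then show ?thesis using assms(1) I_p path_connected_punctured_universe[of p]
    by (simp add: path_connected_imp_connected)
next
  case False
  then obtain g where "arc g" "path_image g = I x" using I_arc[OF assms(2)] by metis
  then show ?thesis using connected_arc_complement[of g] assms(1) by simp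
qed

lemma connected_Int_I: "x \<in> X \<Longrightarrow> y \<in> X \<Longrightarrow> connected (I x \<inter> I y)"
  using unicoherent_X I_sub I_ne compact_I connected_I unfolding hereditarily_unicoherent_def continuum_def by metis

lemma I_path:
  assumes "x \<in> X" shows "\<exists>g. path g \<and> pathstart g = p \<and> pathfinish g = x \<and> path_image g = I x"
proof (cases "x = p")
  case True
  then show ?thesis using I_p by (intro exI[of _ "linepath p p"]) auto
next
  case False
  then obtain g where "arc g" "path_image g = I x" "pathstart g = x" "pathfinish g = p"
    using I_arc[OF assms] by metis
  then show ?thesis by (intro exI[of _ "reversepath g"]) (auto simp: arc_imp_path)
qed

end

section \<open>Transfer of the order from the complex plane\<close>

locale plane_dendroid = rooted_dendroid X p dn for X :: "(real^2) set" and p dn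
begin

text \<open>A disc in \<open>X\<close> would contain a triangle. One side and the union of the other
  two meet only in the two ends of that side, contrary to unicoherence.\<close>

lemma interior_X: "interior X = {}"
proof (rule ccontr)
  assume "interior X \<noteq> {}"
  then obtain x r where r: "r > 0" "cball x r \<subseteq> X"
    by (metis ex_in_conv mem_interior_cball)
  define u :: "real^2" where "u = r *\<^sub>R axis 1 1"
  define v :: "real^2" where "v = r *\<^sub>R axis 2 1"
  have uv: "norm u = r" "norm v = r" "u \<bullet> v = 0" "u \<bullet> u = r\<^sup>2" "v \<bullet> v = r\<^sup>2"
    using r(1) by (auto simp: u_def v_def inner_axis_axis power2_eq_square)
  define A where "A = closed_segment (x - u) (x + u)"
  define B where "B = closed_segment (x - u) (x + v) \<union> closed_segment (x + v) (x + u)"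
  have in_ball: "x - u \<in> cball x r" "x + u \<in> cball x r" "x + v \<in> cball x r"
    using uv by (auto simp: dist_norm)
  then have sub: "A \<subseteq> X" "B \<subseteq> X"
    using r(2) closed_segment_subset[OF _ _ convex_cball[of x r]] unfolding A_def B_def by blast+
  have "continuum A" "continuum B"
    unfolding continuum_def A_def B_def by (auto intro!: connected_Un compact_Un)
  then have con: "connected (A \<inter> B)" using unicoherent_X sub unfolding hereditarily_unicoherent_def by blast
  have "x - u \<noteq> x + u"
  proof
    assume eq: "x - u = x + u"
    have "2 *\<^sub>R u = (x + u) - (x - u)" by (simp add: scaleR_2)
    then have "u = 0" using eq by simp
    then show False using uv r(1) by simp
  qed
  then have "arc (linepath (x - u) (x + u))" by (rule arc_linepath)
  then have "A \<inter> B = A"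
    using connected_subset_arc_eq[of "linepath (x - u) (x + u)" "A \<inter> B"] con by (auto simp: A_def B_def)
  moreover have "x \<in> A"
    unfolding A_def in_segment by (intro exI[of _ "1/2"]) (simp add: algebra_simps flip: scaleR_add_left)
  ultimately have "x \<in> B" by blast
  then show False
    unfolding B_def
  proof
    assume "x \<in> closed_segment (x - u) (x + v)"
    then obtain t where t: "x = (1 - t) *\<^sub>R (x - u) + t *\<^sub>R (x + v)" by (auto simp: in_segment)
    then have eq: "t *\<^sub>R v = (1 - t) *\<^sub>R u" by (simp add: algebra_simps)
    have "t * (v \<bullet> v) = (t *\<^sub>R v) \<bullet> v" by simp
    also have "\<dots> = 0" unfolding eq using uv(3) by simp
    finally have "t = 0" using uv(5) r(1) by simp
    moreover have "(1 - t) * (u \<bullet> u) = ((1 - t) *\<^sub>R u) \<bullet> u" by simp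
    then have "(1 - t) * (u \<bullet> u) = 0" unfolding eq[symmetric] using uv(3) by (simp add: inner_commute)
    ultimately show False using uv(4) r(1) by simp
  next
    assume "x \<in> closed_segment (x + v) (x + u)"
    then obtain t where t: "x = (1 - t) *\<^sub>R (x + v) + t *\<^sub>R (x + u)" by (auto simp: in_segment)
    then have eq: "t *\<^sub>R u = (t - 1) *\<^sub>R v" by (simp add: algebra_simps)
    have "(t - 1) * (v \<bullet> v) = ((t - 1) *\<^sub>R v) \<bullet> v" by simp
    then have "(t - 1) * (v \<bullet> v) = 0" unfolding eq[symmetric] using uv(3) by simp
    then have "t = 1" using uv(5) r(1) by simp
    moreover have "t * (u \<bullet> u) = (t *\<^sub>R u) \<bullet> u" by simp
    then have "t * (u \<bullet> u) = 0" unfolding eq using uv(3) by (simp add: inner_commute)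
    ultimately show False using uv(4) r(1) by simp
  qed
qed

text \<open>Winding numbers need complex points. The isometry \<open>f\<close> also lifts
  \<open>X\<close> into the open upper half-plane, by a strict bound \<open>M\<close> on the
  norms.\<close>

lemma plane_order:
  assumes e: "e \<in> Emax"
  obtains a R where "a \<in> X" "e \<notin> I a"
    "\<And>x y. R x y \<Longrightarrow> x \<in> X - I a \<and> y \<in> X - I a \<and> x \<notin> I y \<and> y \<notin> I x"
    "\<And>x y. x \<in> X - I a \<Longrightarrow> y \<in> X - I a \<Longrightarrow> x \<notin> I y \<Longrightarrow> y \<notin> I x \<Longrightarrow> R x y \<longleftrightarrow> \<not> R y x"
    "\<And>x y. R x y \<Longrightarrow> \<exists>d>0. \<forall>x'\<in>X. \<forall>y'\<in>X. dist x' x < d \<longrightarrow> dist y' y < d \<longrightarrow> R x' y'"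
    "\<And>x y z. R x y \<Longrightarrow> R y z \<Longrightarrow> x \<notin> I z \<Longrightarrow> z \<notin> I x \<Longrightarrow> R x z"
proof -
  have eX: "e \<in> X" "e \<noteq> p" using e by (auto simp: Emax_def)
  obtain M where M: "\<And>x. x \<in> X \<Longrightarrow> norm x < M"
    using compact_imp_bounded[OF compact_X] bounded_pos_less by metis
  define f where "f z = Complex (z $ 1) (z $ 2 + M)" for z :: "real^2"
  define k :: "complex \<Rightarrow> real^2" where "k w = vector [Re w, Im w - M]" for w
  have kf: "k (f z) = z" for z by (simp add: k_def f_def vec_eq_iff forall_2)
  have fk: "f (k w) = w" for w by (simp add: k_def f_def complex_eq_iff)
  have fdist: "dist (f x) (f y) = dist x y" for x y
    by (simp add: f_def dist_norm norm_complex_def norm_vec_def L2_set_def sum_2 complex_diff)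
  have kdist: "dist (k x) (k y) = dist x y" for x y using fdist[of "k x" "k y"] by (simp add: fk)
  have contf: "continuous_on S f" for S
    unfolding continuous_on_iff by (metis fdist)
  have inj: "f x = f y \<longleftrightarrow> x = y" for x y by (metis kf)
  have memf: "w \<in> f ` S \<longleftrightarrow> k w \<in> S" for w S by (metis fk image_iff kf)
  have compl: "- f ` S = f ` (- S)" for S unfolding set_eq_iff Compl_iff memf by simp
  have ballf: "ball (f w) r = f ` ball w r" for w r
  proof -
    have "v \<in> ball (f w) r \<longleftrightarrow> v \<in> f ` ball w r" for v
      unfolding memf mem_ball using fdist[of w "k v"] by (simp add: fk)
    then show ?thesis by blast
  qed
  have X': "compact (f ` X)" "f ` X \<subseteq> {z. Im z > 0}" "interior (f ` X) = {}" "connected (- f ` X)"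
  proof -
    show "compact (f ` X)" by (intro compact_continuous_image contf compact_X)
    have "0 < x $ 2 + M" if "x \<in> X" for x :: "real^2"
      using M[OF that] component_le_norm_cart[of x 2] by linarith
    then show "f ` X \<subseteq> {z. Im z > 0}" by (auto simp: f_def)
    show "connected (- f ` X)"
      unfolding compl by (intro connected_continuous_image contf connected_complement_X) simp
    show "interior (f ` X) = {}"
    proof (rule ccontr)
      assume "interior (f ` X) \<noteq> {}"
      then obtain w r where "r > 0" "ball w r \<subseteq> f ` X" by (metis ex_in_conv mem_interior)
      then have "f ` ball (k w) r \<subseteq> f ` X" using ballf[of "k w" r] by (simp add: fk)
      then have "f z \<in> f ` X" if "z \<in> ball (k w) r" for z using that by blast
      then have "ball (k w) r \<subseteq> X" unfolding memf kf by blast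
      then have "k w \<in> interior X" using \<open>r > 0\<close> mem_interior by blast
      then show False using interior_X by simp
    qed
  qed
  define I' where "I' w = f ` I (k w)" for w
  have If: "I' (f x) = f ` I x" for x by (simp add: I'_def kf)
  obtain a' R' where R': "a' \<in> f ` X" "f e \<notin> I' a'"
    "\<And>x y. R' x y \<Longrightarrow> x \<in> f ` X - I' a' \<and> y \<in> f ` X - I' a' \<and> x \<notin> I' y \<and> y \<notin> I' x"
    "\<And>x y. x \<in> f ` X - I' a' \<Longrightarrow> y \<in> f ` X - I' a' \<Longrightarrow> x \<notin> I' y \<Longrightarrow> y \<notin> I' x \<Longrightarrow> R' x y \<longleftrightarrow> \<not> R' y x"
    "\<And>x y. R' x y \<Longrightarrow> \<exists>d>0. \<forall>x'\<in>f ` X. \<forall>y'\<in>f ` X. dist x' x < d \<longrightarrow> dist y' y < d \<longrightarrow> R' x' y'"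
    "\<And>x y z. R' x y \<Longrightarrow> R' y z \<Longrightarrow> x \<notin> I' z \<Longrightarrow> z \<notin> I' x \<Longrightarrow> R' x z"
  proof (rule planar_order[OF X', where I = I' and p = "f p" and e = "f e"])
    fix x assume "x \<in> f ` X"
    then have x: "k x \<in> X" by (simp add: memf)
    show "I' x \<subseteq> f ` X" unfolding I'_def using I_sub[OF x] by blast
    show "connected (- I' x)"
      unfolding I'_def compl by (intro connected_continuous_image contf connected_complement_I x) simp
    obtain g where "path g" "pathstart g = p" "pathfinish g = k x" "path_image g = I (k x)"
      using I_path[OF x] by blast
    then show "\<exists>g. path g \<and> pathstart g = f p \<and> pathfinish g = x \<and> path_image g = I' x"
      by (intro exI[of _ "f \<circ> g"])
        (auto simp: pathstart_compose pathfinish_compose path_image_compose I'_def fk intro!: path_continuous_image contf)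
    show "f e \<in> I' x \<Longrightarrow> x = f e"
    proof -
      assume "f e \<in> I' x"
      then have "e \<in> I (k x)" unfolding I'_def memf by (simp add: kf)
      then have "k x = e" using Emax_maximal[OF e x] by blast
      then show "x = f e" by (metis fk)
    qed
    show "\<exists>d>0. \<forall>x'\<in>f ` X. dist x' x < d \<longrightarrow> I' x' \<subseteq> (\<Union>w\<in>I' x. ball w r)" if "r > 0" for r
    proof -
      obtain d where d: "d > 0" "\<forall>y\<in>X. dist y (k x) < d \<longrightarrow> I y \<subseteq> (\<Union>w\<in>I (k x). ball w r)"
        using I_usc[OF x \<open>r > 0\<close>] by blast
      have "I' x' \<subseteq> (\<Union>w\<in>I' x. ball w r)" if "x' \<in> f ` X" "dist x' x < d" for x'
      proof -
        have "I (k x') \<subseteq> (\<Union>w\<in>I (k x). ball w r)"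
          using d(2) that by (simp add: memf kdist)
        then have "f ` I (k x') \<subseteq> (\<Union>w\<in>I (k x). f ` ball w r)" by blast
        then show ?thesis unfolding I'_def by (simp add: ballf)
      qed
      then show ?thesis using d(1) by blast
    qed
    fix y assume "y \<in> f ` X"
    then have y: "k y \<in> X" by (simp add: memf)
    have "I' x \<inter> I' y = f ` (I (k x) \<inter> I (k y))"
      unfolding set_eq_iff I'_def Int_iff memf by simp
    then show "connected (I' x \<inter> I' y)"
      using connected_continuous_image[OF contf connected_Int_I[OF x y]] by simp
  next
    show "f p \<in> f ` X" "f e \<in> f ` X" "f e \<noteq> f p" using p_in eX inj by auto
  qed (rule that)
  show thesis
  proof (rule that[of "k a'" "\<lambda>x y. R' (f x) (f y)"])
    have Ia: "f x \<in> I' a' \<longleftrightarrow> x \<in> I (k a')" "f x \<in> I' (f y) \<longleftrightarrow> x \<in> I y" "f x \<in> f ` X \<longleftrightarrow> x \<in> X" for x y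
      by (simp_all add: I'_def memf kf)
    show "k a' \<in> X" using R'(1) by (simp add: memf)
    show "e \<notin> I (k a')" using R'(2) Ia by simp
    show "R' (f x) (f y) \<Longrightarrow> x \<in> X - I (k a') \<and> y \<in> X - I (k a') \<and> x \<notin> I y \<and> y \<notin> I x" for x y
      using R'(3)[of "f x" "f y"] by (simp add: Ia)
    show "x \<in> X - I (k a') \<Longrightarrow> y \<in> X - I (k a') \<Longrightarrow> x \<notin> I y \<Longrightarrow> y \<notin> I x \<Longrightarrow> R' (f x) (f y) \<longleftrightarrow> \<not> R' (f y) (f x)" for x y
      by (rule R'(4)) (simp_all add: Ia)
    show "R' (f x) (f y) \<Longrightarrow> \<exists>d>0. \<forall>x'\<in>X. \<forall>y'\<in>X. dist x' x < d \<longrightarrow> dist y' y < d \<longrightarrow> R' (f x') (f y')" for x y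
      using R'(5)[of "f x" "f y"] by (simp add: fdist)
    show "R' (f x) (f y) \<Longrightarrow> R' (f y) (f z) \<Longrightarrow> x \<notin> I z \<Longrightarrow> z \<notin> I x \<Longrightarrow> R' (f x) (f z)" for x y z
      using R'(6)[of "f x" "f y" "f z"] by (simp add: Ia)
  qed
qed

end

text \<open>The relation \<open>R\<close> compares only points off the arc from the root to the accessible point \<open>a\<close>;
  the part of the dendroid above \<open>F\<close> avoids that arc.\<close>

locale planar_ends = rooted_dendroid X p dn for X :: "'a::euclidean_space set" and p dn +
  fixes a :: 'a and R :: "'a \<Rightarrow> 'a \<Rightarrow> bool" and t :: real and F :: "'a set"
  assumes a_in: "a \<in> X"
    and R_dom: "\<And>x y. R x y \<Longrightarrow> x \<in> X - I a \<and> y \<in> X - I a \<and> x \<notin> I y \<and> y \<notin> I x"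
    and R_total: "\<And>x y. x \<in> X - I a \<Longrightarrow> y \<in> X - I a \<Longrightarrow> x \<notin> I y \<Longrightarrow> y \<notin> I x \<Longrightarrow> R x y \<longleftrightarrow> \<not> R y x"
    and R_open: "\<And>x y. R x y \<Longrightarrow> \<exists>d>0. \<forall>x'\<in>X. \<forall>y'\<in>X. dist x' x < d \<longrightarrow> dist y' y < d \<longrightarrow> R x' y'"
    and R_trans: "\<And>x y z. R x y \<Longrightarrow> R y z \<Longrightarrow> x \<notin> I z \<Longrightarrow> z \<notin> I x \<Longrightarrow> R x z"
    and F: "compact F" "openin (top_of_set (level t)) F"
    and t_pos: "0 < t"
    and avoid: "up_from t F \<inter> I a = {}"
begin

definition N where "N = up_from t F"
definition S where "S = Emax \<inter> N"

text \<open>Reversal turns each statement about the right of an endpoint into one about its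
  left.\<close>

lemma reverse_ends: "planar_ends X p dn a (\<lambda>x y. R y x) t F"
proof unfold_locales
  fix x y
  show "R y x \<Longrightarrow> x \<in> X - I a \<and> y \<in> X - I a \<and> x \<notin> I y \<and> y \<notin> I x" using R_dom by blast
  show "R y x \<Longrightarrow> \<exists>d>0. \<forall>x'\<in>X. \<forall>y'\<in>X. dist x' x < d \<longrightarrow> dist y' y < d \<longrightarrow> R y' x'" using R_open by meson
  show "x \<in> X - I a \<Longrightarrow> y \<in> X - I a \<Longrightarrow> x \<notin> I y \<Longrightarrow> y \<notin> I x \<Longrightarrow> R y x \<longleftrightarrow> \<not> R x y" by (rule R_total)
  fix z
  show "R y x \<Longrightarrow> R z y \<Longrightarrow> x \<notin> I z \<Longrightarrow> z \<notin> I x \<Longrightarrow> R z x" by (rule R_trans)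
qed (use a_in F t_pos avoid in auto)

lemma N_X: "x \<in> N \<Longrightarrow> x \<in> X - I a"
  using avoid by (auto simp: N_def up_from_def)

lemma compact_N: "compact N"
  unfolding N_def using F(1) by (intro compact_up_from compact_imp_closed)

lemma N_up: "y \<in> N \<Longrightarrow> z \<in> X \<Longrightarrow> y \<in> I z \<Longrightarrow> z \<in> N"
  unfolding N_def using up_from_up t_pos by simp

lemma N_ht: "x \<in> N \<Longrightarrow> 0 < ht x" using t_pos by (auto simp: N_def up_from_def)

lemma S_memD: "x \<in> S \<Longrightarrow> x \<in> Emax" "x \<in> S \<Longrightarrow> x \<in> N" "x \<in> S \<Longrightarrow> x \<in> X" "x \<in> S \<Longrightarrow> x \<in> X - I a"
  using N_X[of x] by (auto simp: S_def Emax_def)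

lemma S_maximal: "x \<in> S \<Longrightarrow> y \<in> X \<Longrightarrow> x \<in> I y \<Longrightarrow> y = x"
  using Emax_maximal S_memD by blast

lemma R_asym: "R x y \<Longrightarrow> \<not> R y x"
  using R_total R_dom by meson

lemma R_irrefl: "\<not> R x x" using R_asym by blast

lemma S_total: "x \<in> S \<Longrightarrow> y \<in> S \<Longrightarrow> x \<noteq> y \<Longrightarrow> R x y \<longleftrightarrow> \<not> R y x"
  using S_maximal[of x y] S_maximal[of y x] S_memD[of x] S_memD[of y] by (intro R_total) blast+

lemma R_right_open: "R s x \<Longrightarrow> \<exists>d>0. \<forall>x'\<in>X. dist x' x < d \<longrightarrow> R s x'"
  and R_left_open: "R x s \<Longrightarrow> \<exists>d>0. \<forall>x'\<in>X. dist x' x < d \<longrightarrow> R x' s"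
  using R_open R_dom by (metis DiffD1 dist_self)+

text \<open>Distinct maximal points are incomparable, so on \<open>S\<close> the comparison is total
  and its conditional transitivity always applies.\<close>

sublocale ordered_space S R
proof
  fix x assume x: "x \<in> S"
  show "\<not> R x x" by (rule R_irrefl)
  have "\<exists>d>0. \<forall>x'\<in>S. dist x' y < d \<longrightarrow> R x' x" if "R y x" for y
    using R_left_open[OF that] S_memD by blast
  then show "openin (top_of_set S) {y \<in> S. R y x}"
    unfolding openin_euclidean_subtopology_iff by blast
  have "\<exists>d>0. \<forall>x'\<in>S. dist x' y < d \<longrightarrow> R x x'" if "R x y" for y
    using R_right_open[OF that] S_memD by blast
  then show "openin (top_of_set S) {y \<in> S. R x y}"
    unfolding openin_euclidean_subtopology_iff by blast
  fix y assume y: "y \<in> S"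
  show "x \<noteq> y \<Longrightarrow> R x y \<or> R y x" using S_total x y by blast
  fix z assume z: "z \<in> S" and xyz: "R x y" "R y z"
  have "x \<noteq> z" using xyz R_asym by blast
  then show "R x z" using xyz S_maximal x z S_memD by (intro R_trans[OF xyz]) blast+
qed

text \<open>A branch does not straddle an endpoint: \<open>up q\<close> is connected, all its points
  are incomparable with \<open>s\<close>, and lying on either side of \<open>s\<close> is an open
  condition.\<close>

lemma up_side:
  assumes s: "s \<in> Emax" "s \<in> X - I a" and q: "q \<in> X - I a" "q \<notin> I s"
    and m: "m \<in> up q" "m' \<in> up q" "R s m"
  shows "R s m'"
proof -
  have inc: "R s x \<longleftrightarrow> \<not> R x s" if x: "x \<in> up q" for x
  proof (rule R_total)
    have xq: "x \<in> X" "q \<in> I x" using x by (auto simp: up_def)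
    show "x \<in> X - I a" using xq q(1) I_trans[OF a_in] by blast
    show "x \<notin> I s" using xq q(2) I_trans[of s x] s(2) by blast
    show "s \<notin> I x" using Emax_maximal[OF s(1) xq(1)] xq(2) q(2) by blast
  qed (rule s(2))
  have conn: "connected (up q)" using connected_up q by blast
  show ?thesis
  proof (rule connected_induction_simple[where P = "R s", OF conn m])
    fix x assume x: "x \<in> up q"
    have "\<exists>d>0. \<forall>y\<in>up q. dist y x < d \<longrightarrow> (R s y \<longleftrightarrow> R s x)"
    proof (cases "R s x")
      case True
      then show ?thesis using R_right_open[OF True] by (auto simp: up_def)
    next
      case False
      then have "R x s" using inc x by blast
      then obtain d where "d > 0" "\<forall>y\<in>X. dist y x < d \<longrightarrow> R y s" using R_left_open by blast
      then show ?thesis using False R_asym by (metis (no_types, lifting) mem_Collect_eq up_def)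
    qed
    then obtain d where d: "d > 0" "\<And>y. y \<in> up q \<Longrightarrow> dist y x < d \<Longrightarrow> R s y \<longleftrightarrow> R s x" by blast
    show "\<exists>T. openin (top_of_set (up q)) T \<and> x \<in> T \<and> (\<forall>x\<in>T. \<forall>y\<in>T. R s x \<longrightarrow> R s y)"
    proof (intro exI[of _ "up q \<inter> ball x d"] conjI ballI)
      show "openin (top_of_set (up q)) (up q \<inter> ball x d)" by (simp add: openin_open_Int)
      show "x \<in> up q \<inter> ball x d" using d(1) x by simp
      fix y y' assume "y \<in> up q \<inter> ball x d" "y' \<in> up q \<inter> ball x d"
      then show "R s y \<longrightarrow> R s y'" using d(2)[of y] d(2)[of y'] by (simp add: dist_commute)
    qed
  qed
qed

lemma up_side':
  assumes "s \<in> Emax" "s \<in> X - I a" "q \<in> X - I a" "q \<notin> I s" "m \<in> up q" "m' \<in> up q" "R m s"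
  shows "R m' s"
proof -
  interpret rev: planar_ends X p dn a "\<lambda>x y. R y x" t F by (rule reverse_ends)
  show ?thesis using rev.up_side[of s q m m'] assms by blast
qed

lemma finite_least:
  assumes "finite W" "W \<noteq> {}" "W \<subseteq> S"
  shows "\<exists>m\<in>W. \<forall>w\<in>W. m = w \<or> R m w"
  using assms
proof (induction W rule: finite_ne_induct)
  case (insert x W)
  then obtain m where m: "m \<in> W" "\<forall>w\<in>W. m = w \<or> R m w" by auto
  have S: "x \<in> S" "m \<in> S" using insert m by auto
  show ?case
  proof (cases "R x m")
    case True
    have "\<forall>w\<in>W. x = w \<or> R x w"
    proof
      fix w assume w: "w \<in> W"
      then have "m = w \<or> R m w" "w \<in> S" using m insert by auto
      then show "x = w \<or> R x w" using True less_le_trans[OF S] by blast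
    qed
    then show ?thesis by blast
  next
    case False
    then have "m = x \<or> R m x" using not_less[OF S] by blast
    then show ?thesis using m by blast
  qed
qed auto

text \<open>A metric cluster point, other than \<open>s\<close>, of endpoints that tend to
  \<open>s\<close> from the right in the order.\<close>

definition right_cluster where
  "right_cluster s z \<longleftrightarrow> z \<in> N \<and> z \<noteq> s \<and>
     (\<forall>d>0. \<forall>w\<in>S. R s w \<longrightarrow> (\<exists>x\<in>S. R s x \<and> R x w \<and> dist x z < d)) \<and> (\<exists>w\<in>S. R s w)"

lemma right_clusterD:
  assumes "right_cluster s z"
  shows "z \<in> N" "z \<noteq> s" "z \<in> X"
    "\<And>d w. d > 0 \<Longrightarrow> w \<in> S \<Longrightarrow> R s w \<Longrightarrow> \<exists>x\<in>S. R s x \<and> R x w \<and> dist x z < d"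
    "\<exists>w\<in>S. R s w"
  using assms N_X unfolding right_cluster_def by blast+

text \<open>Otherwise every point of the compact set \<open>N - ball s e\<close> has a ball avoided
  by the endpoints between \<open>s\<close> and some \<open>w\<close>. Finitely many balls suffice,
  and before the least of their \<open>w\<close> no endpoint right of \<open>s\<close> is at
  distance \<open>e\<close> or more.\<close>

lemma irregular_right_cluster:
  assumes "s \<in> S" "\<not> right_regular s"
  shows "\<exists>z. right_cluster s z"
proof -
  obtain v where v: "v \<in> S" "R s v"
    and ne: "\<not> (\<forall>e>0. \<exists>w\<in>S. R s w \<and> (\<forall>x\<in>S. R s x \<longrightarrow> R x w \<longrightarrow> dist x s < e))"
    using assms(2) unfolding right_regular_def by blast
  obtain e where e0: "e > 0" "\<not> (\<exists>w\<in>S. R s w \<and> (\<forall>x\<in>S. R s x \<longrightarrow> R x w \<longrightarrow> dist x s < e))"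
    using ne by blast
  have e: "e > 0" "\<exists>x\<in>S. R s x \<and> R x w \<and> e \<le> dist x s" if "w \<in> S" "R s w" for w
  proof -
    show "e > 0" by fact
    show "\<exists>x\<in>S. R s x \<and> R x w \<and> e \<le> dist x s" using e0(2) that by (force simp: not_less)
  qed
  show ?thesis
  proof (rule ccontr)
    assume neg: "\<not> ?thesis"
    have "\<exists>d w. d > 0 \<and> w \<in> S \<and> R s w \<and> (\<forall>x\<in>S. R s x \<longrightarrow> R x w \<longrightarrow> d \<le> dist x z)"
      if "z \<in> N - ball s e" for z
    proof -
      have "\<not> right_cluster s z" "z \<noteq> s" "z \<in> N" using neg that e0(1) by auto
      then have "\<not> (\<forall>d>0. \<forall>w\<in>S. R s w \<longrightarrow> (\<exists>x\<in>S. R s x \<and> R x w \<and> dist x z < d))"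
        using v unfolding right_cluster_def by blast
      then obtain d w where dw: "d > 0" "w \<in> S" "R s w" "\<not> (\<exists>x\<in>S. R s x \<and> R x w \<and> dist x z < d)" by blast
      show ?thesis
      proof (intro exI[of _ d] exI[of _ w] conjI ballI impI dw(1-3))
        fix x assume "x \<in> S" "R s x" "R x w"
        then have "\<not> dist x z < d" using dw(4) by blast
        then show "d \<le> dist x z" by simp
      qed
    qed
    then obtain d w where dw: "\<And>z. z \<in> N - ball s e \<Longrightarrow> d z > (0::real) \<and> w z \<in> S \<and> R s (w z) \<and>
       (\<forall>x\<in>S. R s x \<longrightarrow> R x (w z) \<longrightarrow> d z \<le> dist x z)" by metis
    have "compact (N - ball s e)" using compact_N by (intro compact_diff) auto
    then obtain T where T: "T \<subseteq> N - ball s e" "finite T" "N - ball s e \<subseteq> (\<Union>z\<in>T. ball z (d z))"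
      by (rule compactE_image[of _ "N - ball s e" "\<lambda>z. ball z (d z)"]) (use dw in auto)
    have "finite (insert v (w ` T))" "insert v (w ` T) \<noteq> {}" "insert v (w ` T) \<subseteq> S"
      using T dw v by auto
    then obtain m where m: "m \<in> insert v (w ` T)" "\<forall>u\<in>insert v (w ` T). m = u \<or> R m u"
      using finite_least by blast
    have mS: "m \<in> S" "R s m" using m(1) T(1) dw v by auto
    obtain x where x: "x \<in> S" "R s x" "R x m" "e \<le> dist x s" using e(2)[OF mS] by blast
    then have "x \<in> N - ball s e" using S_memD(2) by (auto simp: dist_commute)
    then obtain z where z: "z \<in> T" "x \<in> ball z (d z)" using T(3) by blast
    have zN: "z \<in> N - ball s e" using z T by blast
    have "R x (w z)"
      using less_le_trans[OF x(1) mS(1) _ x(3), of "w z"] m(2) z(1) dw[OF zN] by blast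
    then have "d z \<le> dist x z" using dw[OF zN] x by blast
    then show False using z(2) by (simp add: dist_commute)
  qed
qed

lemma near_below:
  assumes z: "z \<in> X" "0 < ht z" and U: "open U" "z \<in> U"
  shows "\<exists>q\<in>I z. q \<noteq> z \<and> q \<in> U"
proof -
  have "continuous_on UNIV (\<lambda>t. cut_at t z)"
    using z by (intro continuous_cut_at_comp) auto
  then have "open ((\<lambda>t. cut_at t z) -` U)" using U(1) by (simp add: open_vimage)
  moreover have "ht z \<in> (\<lambda>t. cut_at t z) -` U" using cut_at_ht[OF z(1) I_self[OF z(1)]] U(2) by simp
  ultimately obtain e where e: "e > 0" "ball (ht z) e \<subseteq> (\<lambda>t. cut_at t z) -` U"
    by (meson openE)
  define r where "r = max 0 (ht z - e / 2)"
  have r: "0 \<le> r" "r < ht z" "r \<in> ball (ht z) e" using e(1) z(2) by (auto simp: r_def dist_real_def)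
  then have "ht (cut_at r z) = r" using cut_at(2)[OF z(1)] by simp
  then have "cut_at r z \<noteq> z" using r(2) by auto
  then show ?thesis using cut_at(1)[OF z(1)] e(2) r(3) by blast
qed

text \<open>Each irregular \<open>s\<close> receives an arc: if its cluster point \<open>z s\<close>
  lies on \<open>I s\<close>, the upper part of the stretch between them, otherwise a piece ending
  at \<open>z s\<close> and off \<open>I s\<close>. Endpoints close to \<open>s\<close> in the order
  come near \<open>z s\<close>, and \<open>up_side\<close> turns this into disjointness of the
  arcs.\<close>

lemma countable_right_irregular:
  assumes noC: "\<not> (\<exists>\<A>. \<Union>\<A> \<subseteq> X \<and> Cantor_set_of_arcs \<A>)"
  shows "countable {s \<in> S. \<not> right_regular s}"
proof -
  obtain z where z: "\<And>s. s \<in> S \<Longrightarrow> \<not> right_regular s \<Longrightarrow> right_cluster s (z s)"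
    using irregular_right_cluster by metis
  define J1 where "J1 = {s \<in> S. \<not> right_regular s \<and> z s \<in> I s}"
  define J2 where "J2 = {s \<in> S. \<not> right_regular s \<and> z s \<notin> I s}"
  have "countable J1"
  proof (rule ccontr)
    assume unc: "uncountable J1"
    \<comment> \<open>Half-way in height: the closed set \<open>up (q s)\<close> misses
      \<open>z s\<close>, and \<open>q s\<close> is in \<open>N\<close> because it is above
      \<open>z s\<close>.\<close>
    define q where "q s = cut_at ((ht (z s) + ht s) / 2) s" for s
    have q: "q s \<in> I s" "q s \<noteq> s" "q s \<in> N" "z s \<notin> up (q s)" if s: "s \<in> J1" for s
    proof -
      have s': "s \<in> X" "s \<in> S" "z s \<in> I s" "right_cluster s (z s)" using s z S_memD by (auto simp: J1_def)
      have ht: "ht (z s) < ht s" "0 \<le> ht (z s)"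
        using ht_strict[OF s'(1,3)] right_clusterD[OF s'(4)] ht_nonneg by auto
      show qs: "q s \<in> I s" unfolding q_def by (rule cut_at(1)[OF s'(1)])
      have hq: "ht (q s) = (ht (z s) + ht s) / 2" unfolding q_def using cut_at(2)[OF s'(1)] ht by simp
      then show "q s \<noteq> s" using ht by auto
      have "z s \<in> I (q s)" using I_by_ht[OF s'(1,3) qs] hq ht by simp
      then show "q s \<in> N" using N_up right_clusterD(1)[OF s'(4)] I_in[OF s'(1) qs] by blast
      show "z s \<notin> up (q s)"
      proof
        assume "z s \<in> up (q s)"
        then have "ht (q s) \<le> ht (z s)" using ht_mono by (auto simp: up_def)
        then show False using hq ht by simp
      qed
    qed
    \<comment> \<open>An endpoint \<open>x'\<close> between \<open>s\<close> and \<open>x\<close>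
      close to \<open>z s\<close> is not above \<open>q s\<close>. If \<open>x\<close> were above
      \<open>q s\<close>, then \<open>s\<close> and \<open>x\<close> would share a branch that has
      points on both sides of \<open>x'\<close>.\<close>
    have last: "q s \<notin> I x" if s: "s \<in> J1" and x: "x \<in> S" "R s x" for s x
    proof
      assume qx: "q s \<in> I x"
      have sS: "s \<in> S" "right_cluster s (z s)" using s z by (auto simp: J1_def)
      have "open (- up (q s))" using closed_up by (simp add: open_Compl)
      then obtain d where d: "d > 0" "ball (z s) d \<subseteq> - up (q s)" using q(4)[OF s] by (meson ComplI openE)
      obtain x' where x': "x' \<in> S" "R s x'" "R x' x" "dist x' (z s) < d"
        using right_clusterD(4)[OF sS(2) d(1) x] by blast
      have "x' \<notin> up (q s)" using d(2) x'(4) by (auto simp: dist_commute)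
      then have "q s \<notin> I x'" using S_memD[OF x'(1)] by (simp add: up_def)
      moreover have "x \<in> up (q s)" "s \<in> up (q s)" using qx q(1)[OF s] x sS S_memD by (auto simp: up_def)
      ultimately have "R x' s"
        using up_side[OF S_memD(1,4)[OF x'(1)] N_X[OF q(3)[OF s]]] x'(3) by blast
      then show False using x'(2) R_asym by blast
    qed
    have disj: "seg (q i) i \<inter> seg (q j) j = {}" if ij: "i \<in> J1" "j \<in> J1" "R i j" for i j
    proof (rule ccontr)
      assume "seg (q i) i \<inter> seg (q j) j \<noteq> {}"
      then obtain y where "q i \<in> I y" "y \<in> I j" by (auto simp: seg_def)
      moreover have "j \<in> S" using ij by (simp add: J1_def)
      ultimately show False using last[OF ij(1) _ ij(3)] I_trans[OF S_memD(3)] by blast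
    qed
    have "\<exists>\<A>. \<Union>\<A> \<subseteq> X \<and> Cantor_set_of_arcs \<A>"
    proof (rule Cantor_set_of_arcs_from_uncountable[OF unc, where y = "\<lambda>s. s" and q = q])
      fix i j assume ij: "i \<in> J1" "j \<in> J1" "i \<noteq> j"
      then have "R i j \<or> R j i" using total[of i j] by (auto simp: J1_def)
      then show "seg (q i) i \<inter> seg (q j) j = {}" using disj ij by blast
    qed (use q S_memD in \<open>auto simp: J1_def\<close>)
    then show False using noC by blast
  qed
  moreover have "countable J2"
  proof (rule ccontr)
    assume unc: "uncountable J2"
    have J2: "s \<in> S" "right_cluster s (z s)" "z s \<notin> I s" "s \<notin> I (z s)" "R s (z s)" if s: "s \<in> J2" for s
    proof -
      show s': "s \<in> S" "right_cluster s (z s)" "z s \<notin> I s" using s z by (auto simp: J2_def)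
      note c = right_clusterD[OF s'(2)]
      show sz: "s \<notin> I (z s)" using S_maximal[OF s'(1) c(3)] c(2) by blast
      show "R s (z s)"
      proof (rule ccontr)
        assume "\<not> R s (z s)"
        then have "R (z s) s" using R_total[OF S_memD(4)[OF s'(1)] N_X[OF c(1)] sz s'(3)] by blast
        then obtain d where d: "d > 0" "\<forall>x\<in>X. dist x (z s) < d \<longrightarrow> R x s" using R_left_open by blast
        obtain w where "w \<in> S" "R s w" using c(5) by blast
        then obtain x where "x \<in> S" "R s x" "dist x (z s) < d" using c(4)[OF d(1)] by blast
        then show False using d(2) S_memD(3) R_asym by blast
      qed
    qed
    have "\<exists>q\<in>I (z s). q \<noteq> z s \<and> q \<in> - I s \<inter> - I a" if s: "s \<in> J2" for s
    proof (rule near_below)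
      note c = right_clusterD[OF J2(2)[OF s]]
      show "z s \<in> X" "0 < ht (z s)" using c N_ht by auto
      show "open (- I s \<inter> - I a)"
        using closed_I a_in S_memD(3)[OF J2(1)[OF s]] by (intro open_Int open_Compl)
      show "z s \<in> - I s \<inter> - I a" using J2(3)[OF s] N_X[OF c(1)] by blast
    qed
    then obtain q where q: "\<And>s. s \<in> J2 \<Longrightarrow> q s \<in> I (z s) \<and> q s \<noteq> z s \<and> q s \<notin> I s \<and> q s \<notin> I a"
      by (metis ComplD IntD1 IntD2)
    have zX: "z s \<in> X" if "s \<in> J2" for s using right_clusterD(3)[OF J2(2)[OF that]] .
    \<comment> \<open>If the arcs met, \<open>z i\<close> would belong to the branch above
      \<open>q j\<close>, which is entirely to the right of \<open>j\<close>; but endpoints between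
      \<open>i\<close> and \<open>j\<close> come arbitrarily close to \<open>z i\<close>.\<close>
    have disj: "seg (q i) (z i) \<inter> seg (q j) (z j) = {}" if ij: "i \<in> J2" "j \<in> J2" "R i j" for i j
    proof (rule ccontr)
      assume "seg (q i) (z i) \<inter> seg (q j) (z j) \<noteq> {}"
      then obtain y where y: "y \<in> I (z i)" "q j \<in> I y" by (auto simp: seg_def)
      then have zi: "z i \<in> up (q j)" using I_trans[OF zX[OF ij(1)]] zX[OF ij(1)] by (auto simp: up_def)
      have zj: "z j \<in> up (q j)" using q ij zX by (auto simp: up_def)
      have "q j \<in> X - I a" using q[OF ij(2)] I_in zX[OF ij(2)] by blast
      then have "R j (z i)"
        using up_side[OF S_memD(1,4)[OF J2(1)[OF ij(2)]] _ _ zj zi J2(5)[OF ij(2)]] q[OF ij(2)] by blast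
      then obtain d where d: "d > 0" "\<forall>x\<in>X. dist x (z i) < d \<longrightarrow> R j x" using R_right_open by blast
      obtain x where "x \<in> S" "R x j" "dist x (z i) < d"
        using right_clusterD(4)[OF J2(2)[OF ij(1)] d(1) J2(1)[OF ij(2)] ij(3)] by blast
      then show False using d(2) S_memD(3) R_asym by blast
    qed
    have "\<exists>\<A>. \<Union>\<A> \<subseteq> X \<and> Cantor_set_of_arcs \<A>"
    proof (rule Cantor_set_of_arcs_from_uncountable[OF unc, where y = z and q = q])
      fix i j assume ij: "i \<in> J2" "j \<in> J2" "i \<noteq> j"
      then have "R i j \<or> R j i" using total[of i j] J2(1) by blast
      then show "seg (q i) (z i) \<inter> seg (q j) (z j) = {}" using disj ij by blast
    qed (use q zX in auto)
    then show False using noC by blast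
  qed
  moreover have "{s \<in> S. \<not> right_regular s} = J1 \<union> J2" by (auto simp: J1_def J2_def)
  ultimately show ?thesis by simp
qed

lemma countable_irregular:
  assumes noC: "\<not> (\<exists>\<A>. \<Union>\<A> \<subseteq> X \<and> Cantor_set_of_arcs \<A>)"
  shows "countable {s \<in> S. \<not> (right_regular s \<and> left_regular s)}"
proof -
  interpret rev: planar_ends X p dn a "\<lambda>x y. R y x" t F by (rule reverse_ends)
  have "rev.right_regular s = left_regular s" for s
    unfolding rev.right_regular_def left_regular_def by blast
  then have "countable {s \<in> S. \<not> left_regular s}"
    using rev.countable_right_irregular[OF noC] by simp
  moreover have "{s \<in> S. \<not> (right_regular s \<and> left_regular s)} = {s \<in> S. \<not> right_regular s} \<union> {s \<in> S. \<not> left_regular s}"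
    by blast
  ultimately show ?thesis using countable_right_irregular[OF noC] by simp
qed

end

section \<open>Clopen neighbourhoods of endpoints\<close>

context ordered_space begin

lemma cut_empty: "cut {}" and cut_S: "cut S"
  by (auto simp: cut_def)

lemma cut_clopen:
  assumes "cut L" shows "L \<subseteq> S" "openin (top_of_set S) L" "closedin (top_of_set S) L"
  using assms openin_imp_subset[of euclidean S L] by (auto simp: cut_def closedin_def)

lemma cut_down_closed: "cut L \<Longrightarrow> x \<in> L \<Longrightarrow> y \<in> S \<Longrightarrow> y \<sqsubseteq> x \<Longrightarrow> y \<in> L"
  by (auto simp: cut_def)

lemma cut_subset: "cut L \<Longrightarrow> x \<in> L \<Longrightarrow> x \<in> S" using cut_clopen(1) by blast

text \<open>A pair of cuts \<open>(L, M)\<close> with \<open>M \<subseteq> L\<close> encodes the order-convex clopen set \<open>L - M\<close>.\<close>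

definition box :: "'a set \<times> 'a set \<Rightarrow> 'a set" where "box c = fst c - snd c"

text \<open>Regularity bounds distances on an order interval around \<open>s\<close>, and cuts
  placed inside this interval make it clopen. At an end of the order, \<open>S\<close> or
  \<open>{}\<close> serves as the cut.\<close>

lemma small_box:
  assumes s: "s \<in> S" "right_regular s" "left_regular s" "e > 0"
    and sep: "\<And>u v. u \<in> S \<Longrightarrow> v \<in> S \<Longrightarrow> u \<sqsubset> v \<Longrightarrow> \<exists>L. cut L \<and> u \<in> L \<and> v \<notin> L"
  shows "\<exists>c. cut (fst c) \<and> cut (snd c) \<and> snd c \<subseteq> fst c \<and> s \<in> box c \<and> box c \<subseteq> ball s e"
proof -
  have "\<exists>L. cut L \<and> s \<in> L \<and> (\<forall>x\<in>L. s \<sqsubset> x \<longrightarrow> dist x s < e)"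
  proof (cases "\<exists>v\<in>S. s \<sqsubset> v")
    case True
    then obtain w where w: "w \<in> S" "s \<sqsubset> w" "\<And>x. x \<in> S \<Longrightarrow> s \<sqsubset> x \<Longrightarrow> x \<sqsubset> w \<Longrightarrow> dist x s < e"
      using s(2,4) unfolding right_regular_def by blast
    obtain L where L: "cut L" "s \<in> L" "w \<notin> L" using sep[OF s(1) w(1,2)] by blast
    have "dist x s < e" if x: "x \<in> L" "s \<sqsubset> x" for x
    proof -
      have xS: "x \<in> S" using cut_subset L x by blast
      have "x \<sqsubset> w" using not_less[OF xS w(1)] cut_down_closed[OF L(1) x(1) w(1)] L(3) by blast
      then show ?thesis using w(3)[OF xS x(2)] by blast
    qed
    then show ?thesis using L by blast
  next
    case False
    then show ?thesis using cut_S s(1) by blast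
  qed
  then obtain L where L: "cut L" "s \<in> L" "\<And>x. x \<in> L \<Longrightarrow> s \<sqsubset> x \<Longrightarrow> dist x s < e" by blast
  have "\<exists>M. cut M \<and> s \<notin> M \<and> (\<forall>x\<in>S - M. x \<sqsubset> s \<longrightarrow> dist x s < e)"
  proof (cases "\<exists>v\<in>S. v \<sqsubset> s")
    case True
    then obtain w where w: "w \<in> S" "w \<sqsubset> s" "\<And>x. x \<in> S \<Longrightarrow> x \<sqsubset> s \<Longrightarrow> w \<sqsubset> x \<Longrightarrow> dist x s < e"
      using s(3,4) unfolding left_regular_def by blast
    obtain M where M: "cut M" "w \<in> M" "s \<notin> M" using sep[OF w(1) s(1) w(2)] by blast
    have "dist x s < e" if x: "x \<in> S - M" "x \<sqsubset> s" for x
    proof -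
      have "w \<sqsubset> x" using not_less[of w x] cut_down_closed[OF M(1,2), of x] x(1) w(1) by blast
      then show ?thesis using w(3)[of x] x by blast
    qed
    then show ?thesis using M by blast
  next
    case False
    then show ?thesis using cut_empty by blast
  qed
  then obtain M where M: "cut M" "s \<notin> M" "\<And>x. x \<in> S - M \<Longrightarrow> x \<sqsubset> s \<Longrightarrow> dist x s < e" by blast
  have "M \<subseteq> L"
  proof
    fix x assume x: "x \<in> M"
    then have xS: "x \<in> S" using cut_subset M by blast
    have "x \<sqsubset> s" using not_less[OF xS s(1)] cut_down_closed[OF M(1) x s(1)] M(2) by blast
    then show "x \<in> L" using cut_down_closed[OF L(1,2) xS] by blast
  qed
  moreover have "L - M \<subseteq> ball s e"
  proof
    fix x assume x: "x \<in> L - M"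
    then have xS: "x \<in> S" using cut_subset L by blast
    consider "x = s" | "s \<sqsubset> x" | "x \<sqsubset> s" using total[OF xS s(1)] by blast
    then show "x \<in> ball s e" using L(3)[of x] M(3)[of x] x xS s(4) by cases (auto simp: dist_commute)
  qed
  ultimately show ?thesis using L M by (intro exI[of _ "(L, M)"]) (auto simp: box_def)
qed

text \<open>Subtracting the earlier boxes would destroy convexity. Instead, \<open>s\<close> is
  grouped with those points of its first box that lie on the same side of each earlier box as
  \<open>s\<close>. These classes are finite intersections of clopen convex sets, and two of them
  are equal or disjoint.\<close>

lemma disjoint_boxes:
  assumes c: "\<And>n::nat. cut (fst (c n))" "\<And>n. cut (snd (c n))" "\<And>n. snd (c n) \<subseteq> fst (c n)"
    and Z: "Z \<subseteq> (\<Union>n. box (c n))"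
  obtains \<J> where "Z \<subseteq> \<Union>\<J>" "\<And>J. J \<in> \<J> \<Longrightarrow> J \<inter> Z \<noteq> {}" "\<And>J. J \<in> \<J> \<Longrightarrow> \<exists>n. J \<subseteq> box (c n)"
    "\<And>J. J \<in> \<J> \<Longrightarrow> openin (top_of_set S) J" "\<And>J. J \<in> \<J> \<Longrightarrow> closedin (top_of_set S) J"
    "\<And>J K. J \<in> \<J> \<Longrightarrow> K \<in> \<J> \<Longrightarrow> J \<inter> K \<noteq> {} \<Longrightarrow> J = K"
    "\<And>J x y z. J \<in> \<J> \<Longrightarrow> x \<in> J \<Longrightarrow> z \<in> J \<Longrightarrow> y \<in> S \<Longrightarrow> x \<sqsubset> y \<Longrightarrow> y \<sqsubset> z \<Longrightarrow> y \<in> J"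
proof -
  define i where "i s = (LEAST n. s \<in> box (c n))" for s
  define side where "side s k = (if s \<in> snd (c k) then snd (c k) else S - fst (c k))" for s k
  define cls where "cls s = box (c (i s)) \<inter> \<Inter>((\<lambda>k. side s k) ` {..<i s})" for s
  have iZ: "s \<in> box (c (i s))" if "s \<in> Z" for s
    using LeastI_ex[of "\<lambda>n. s \<in> box (c n)"] Z that unfolding i_def by blast
  have il: "s \<notin> box (c k)" if "k < i s" for s k
    using not_less_Least that unfolding i_def by blast
  have ZS: "Z \<subseteq> S" using iZ cut_subset c(1) unfolding box_def by blast
  have side_disj: "side s k \<inter> box (c k) = {}" for s k by (auto simp: side_def box_def)
  have side_self: "s \<in> side s k" if "s \<in> S" "s \<notin> box (c k)" for s k
    using that by (auto simp: side_def box_def)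
  have side_eq: "side y k = side s k" if "y \<in> side s k" for s y k
    using that c(3)[of k] by (auto simp: side_def split: if_splits)
  have box_clopen: "openin (top_of_set S) (box (c n))" "closedin (top_of_set S) (box (c n))" for n
  proof -
    note L = cut_clopen[OF c(1)[of n]] and M = cut_clopen[OF c(2)[of n]]
    show "openin (top_of_set S) (box (c n))" unfolding box_def using L(2) M(3) by (rule openin_diff)
    show "closedin (top_of_set S) (box (c n))" unfolding box_def using L(3) M(2) by (rule closedin_diff)
  qed
  have side_clopen: "openin (top_of_set S) (side s k)" "closedin (top_of_set S) (side s k)" for s k
    using cut_clopen[OF c(1)[of k]] cut_clopen[OF c(2)[of k]] by (auto simp: side_def)
  have clopen: "openin (top_of_set S) (cls s)" "closedin (top_of_set S) (cls s)" for s
  proof -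
    have eq: "cls s = \<Inter>(insert (box (c (i s))) (side s ` {..<i s}))" by (simp add: cls_def)
    show "openin (top_of_set S) (cls s)" unfolding eq
      by (intro openin_Inter) (use box_clopen side_clopen in auto)
    show "closedin (top_of_set S) (cls s)" unfolding eq
      by (intro closedin_Inter) (use box_clopen side_clopen in auto)
  qed
  have self: "s \<in> cls s" if "s \<in> Z" for s
    using iZ[OF that] il ZS that side_self unfolding cls_def by blast
  have ieq: "i y = i s" if y: "y \<in> cls s" for s y
  proof -
    have "y \<in> box (c (i s))" "\<And>k. k < i s \<Longrightarrow> y \<notin> box (c k)"
      using y side_disj unfolding cls_def by blast+
    then show ?thesis unfolding i_def[of y] by (intro Least_equality) (meson not_le)+
  qed
  have cls_eq: "cls y = cls s" if y: "y \<in> cls s" for s y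
  proof -
    have "side y k = side s k" if "k < i s" for k using y side_eq that unfolding cls_def by blast
    then show ?thesis unfolding cls_def ieq[OF y] by simp
  qed
  have conv: "y \<in> cls s" if h: "x \<in> cls s" "z \<in> cls s" "y \<in> S" "x \<sqsubset> y" "y \<sqsubset> z" for s x y z
  proof -
    have "y \<in> box (c (i s))"
    proof -
      have "z \<in> fst (c (i s))" "x \<notin> snd (c (i s))" "x \<in> S" using h cut_subset c(1) by (auto simp: cls_def box_def)
      then show ?thesis unfolding box_def using cut_down_closed[OF c(1)] cut_down_closed[OF c(2)] h by blast
    qed
    moreover have "y \<in> side s k" if k: "k < i s" for k
    proof -
      have xz: "x \<in> side s k" "z \<in> side s k" using h k by (auto simp: cls_def)
      have "x \<in> S" using h(1) clopen(1)[of s] openin_imp_subset by blast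
      show ?thesis
      proof (cases "s \<in> snd (c k)")
        case True
        then show ?thesis using xz cut_down_closed[OF c(2)] h \<open>x \<in> S\<close> by (auto simp: side_def)
      next
        case False
        then show ?thesis using xz cut_down_closed[OF c(1)] h \<open>x \<in> S\<close> by (auto simp: side_def)
      qed
    qed
    ultimately show ?thesis unfolding cls_def by blast
  qed
  show thesis
  proof (rule that[of "cls ` Z"])
    show "Z \<subseteq> \<Union>(cls ` Z)" using self by blast
    show "J \<inter> Z \<noteq> {}" if "J \<in> cls ` Z" for J using that self by blast
    show "\<exists>n. J \<subseteq> box (c n)" if "J \<in> cls ` Z" for J using that unfolding cls_def by blast
    show "openin (top_of_set S) J" "closedin (top_of_set S) J" if "J \<in> cls ` Z" for J using that clopen by auto
    show "J = K" if JK: "J \<in> cls ` Z" "K \<in> cls ` Z" "J \<inter> K \<noteq> {}" for J K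
    proof -
      obtain s s' y where "J = cls s" "K = cls s'" "y \<in> cls s" "y \<in> cls s'" using JK by blast
      then show ?thesis using cls_eq by metis
    qed
    show "y \<in> J" if "J \<in> cls ` Z" "x \<in> J" "z \<in> J" "y \<in> S" "x \<sqsubset> y" "y \<sqsubset> z" for J x y z
      using that conv by blast
  qed
qed

end

section \<open>Small clopen sets of endpoints\<close>

context planar_ends begin

lemma maximal_above:
  assumes "x \<in> X" "0 < ht x" shows "\<exists>e\<in>Emax. x \<in> I e"
proof -
  have "up x \<subseteq> X" by (auto simp: up_def)
  then have "compact (up x)" using compact_Int_closed[OF compact_X closed_up] by (metis inf.absorb_iff2)
  moreover have "x \<in> up x" using assms I_self by (simp add: up_def)
  ultimately obtain e where e: "e \<in> up x" "\<And>y. y \<in> up x \<Longrightarrow> ht y \<le> ht e"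
    using continuous_attains_sup[of "up x" ht] continuous_on_subset[OF continuous_ht \<open>up x \<subseteq> X\<close>] by blast
  have eX: "e \<in> X" "x \<in> I e" using e(1) by (auto simp: up_def)
  have "up e = {e}"
  proof
    show "up e \<subseteq> {e}"
    proof
      fix y assume y: "y \<in> up e"
      then have "y \<in> up x" using up_trans[OF eX(2)] by blast
      then show "y \<in> {e}" using e(2)[of y] ht_strict[of y e] y by (force simp: up_def)
    qed
    show "{e} \<subseteq> up e" using eX I_self by (simp add: up_def)
  qed
  moreover have "e \<noteq> p" using ht_mono[OF eX] assms(2) ht_p by auto
  ultimately show ?thesis using eX by (auto simp: Emax_def)
qed

text \<open>Let \<open>s n\<close> be a point of \<open>G\<close> in the convex set that contains
  \<open>f n\<close>. These points are cofinal to the left of \<open>y\<close> in the order. By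
  compactness they cluster at some \<open>x\<close> in \<open>G\<close>, and an endpoint above
  \<open>x\<close> would lie to the right of every \<open>s n\<close> and still to the left of
  \<open>y\<close>.\<close>

lemma no_left_limit:
  assumes G: "compact G" "G \<subseteq> level r" "up_from r G \<subseteq> N" "0 \<le> r"
    and \<J>: "\<And>J. J \<in> \<J> \<Longrightarrow> J \<inter> (G \<inter> S) \<noteq> {}" "\<And>J. J \<in> \<J> \<Longrightarrow> closedin (top_of_set S) J"
      "\<And>J K. J \<in> \<J> \<Longrightarrow> K \<in> \<J> \<Longrightarrow> J \<inter> K \<noteq> {} \<Longrightarrow> J = K"
      "\<And>J x y z. J \<in> \<J> \<Longrightarrow> x \<in> J \<Longrightarrow> z \<in> J \<Longrightarrow> y \<in> S \<Longrightarrow> R x y \<Longrightarrow> R y z \<Longrightarrow> y \<in> J"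
    and y: "y \<in> S" "y \<notin> up_from r G" "y \<notin> \<Union>\<J>"
    and f: "\<And>n::nat. f n \<in> \<Union>\<J>" "\<And>n. R (f n) y" "f \<longlonglongrightarrow> y"
  shows False
proof -
  have "\<exists>K. K \<in> \<J> \<and> f n \<in> K" for n using f(1)[of n] by blast
  then obtain J where J: "\<And>n. J n \<in> \<J>" "\<And>n. f n \<in> J n" by metis
  have "\<exists>s. s \<in> J n \<and> s \<in> G \<and> s \<in> S" for n using \<J>(1)[OF J(1)[of n]] by blast
  then obtain s where s: "\<And>n. s n \<in> J n" "\<And>n. s n \<in> G" "\<And>n. s n \<in> S" by metis
  have JS: "K \<subseteq> S" if "K \<in> \<J>" for K using \<J>(2)[OF that] closedin_imp_subset by blast
  have fS: "f n \<in> S" for n using J JS by blast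
  have sy: "R (s n) y" for n
  proof (rule ccontr)
    assume "\<not> R (s n) y"
    then have "y = s n \<or> R y (s n)" using not_less[OF s(3) y(1)] by blast
    moreover have "y \<noteq> s n" using s(1) J(1) y(3) by blast
    ultimately have "y \<in> J n" using \<J>(4)[OF J(1) J(2) s(1) y(1) f(2)] by blast
    then show False using y(3) J(1) by blast
  qed
  have evS: "\<forall>\<^sub>F n in sequentially. P (f n)" if "d > 0" "\<And>x. x \<in> S \<Longrightarrow> dist x y < d \<Longrightarrow> P x" for P d
    using tendstoD[OF f(3) that(1)] by eventually_elim (use that(2) fS in blast)
  \<comment> \<open>Eventually \<open>f n\<close> is to the right of \<open>w\<close> and its set
    \<open>J n\<close> does not contain \<open>w\<close>; by convexity \<open>s n\<close> is to the
    right of \<open>w\<close> too.\<close>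
  have A: "\<forall>\<^sub>F n in sequentially. R w (s n)" if w: "w \<in> S" "R w y" for w
  proof -
    obtain d where d: "d > 0" "\<forall>x\<in>X. dist x y < d \<longrightarrow> R w x" using R_right_open[OF w(2)] by blast
    have 1: "\<forall>\<^sub>F n in sequentially. R w (f n)" by (rule evS[OF d(1)]) (use d(2) S_memD(3) in blast)
    have 2: "\<forall>\<^sub>F n in sequentially. w \<notin> J n"
    proof (cases "\<exists>K\<in>\<J>. w \<in> K")
      case True
      then obtain K where K: "K \<in> \<J>" "w \<in> K" by blast
      have "openin (top_of_set S) (S - K)" using \<J>(2)[OF K(1)] by (simp add: closedin_def)
      moreover have "y \<in> S - K" using y K by blast
      ultimately obtain d where d: "d > 0" "\<And>x. x \<in> S \<Longrightarrow> dist x y < d \<Longrightarrow> x \<in> S - K"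
        unfolding openin_euclidean_subtopology_iff by blast
      have "\<forall>\<^sub>F n in sequentially. f n \<in> S - K" by (rule evS[OF d(1)]) (use d(2) in blast)
      then show ?thesis
      proof eventually_elim
        case (elim n)
        then have "J n \<noteq> K" using J(2) by blast
        then show ?case using \<J>(3)[OF J(1) K(1)] K(2) by blast
      qed
    next
      case False
      then show ?thesis using J(1) by auto
    qed
    from 1 2 show ?thesis
    proof eventually_elim
      case (elim n)
      show ?case
      proof (rule ccontr)
        assume "\<not> R w (s n)"
        then have "s n = w \<or> R (s n) w" using not_less[OF w(1) s(3)] by blast
        moreover have "s n \<noteq> w" using elim(2) s(1) by blast
        ultimately have "w \<in> J n" using \<J>(4)[OF J(1) s(1) J(2) w(1) _ elim(1)] by blast
        then show False using elim(2) by blast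
      qed
    qed
  qed
  obtain x k where x: "x \<in> G" "strict_mono k" "(s \<circ> k) \<longlonglongrightarrow> x"
    using G(1) s(2) unfolding compact_def by blast
  have evx: "\<exists>n. Q (s (k n)) \<and> P (s (k n))" if P: "d > 0" "\<And>z. z \<in> X \<Longrightarrow> dist z x < d \<Longrightarrow> P z"
    and Q: "\<forall>\<^sub>F n in sequentially. Q (s n)" for P Q d
  proof -
    have "\<forall>\<^sub>F n in sequentially. dist ((s \<circ> k) n) x < d" using tendstoD[OF x(3) P(1)] .
    moreover have "\<forall>\<^sub>F n in sequentially. Q (s (k n))"
      using eventually_subseq[OF x(2) Q] .
    ultimately have "\<forall>\<^sub>F n in sequentially. Q (s (k n)) \<and> P (s (k n))"
      by eventually_elim (use P(2) s(3) S_memD(3) in auto)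
    then show ?thesis unfolding eventually_sequentially by blast
  qed
  have xl: "x \<in> level r" "x \<in> X" "ht x = r" using x(1) G(2) by (auto simp: level_def)
  have xu: "x \<in> up_from r G"
    using cut_at_ht[OF xl(2) I_self[OF xl(2)]] xl x(1) by (simp add: up_from_def)
  have xN: "x \<in> N" using xu G(3) by blast
  have "x \<noteq> y" using xu y(2) by blast
  have xy: "x \<notin> I y" using up_from_up[OF xu S_memD(3)[OF y(1)] _ G(4)] y(2) by blast
  have yx: "y \<notin> I x" using S_maximal[OF y(1) xl(2)] \<open>x \<noteq> y\<close> by blast
  have sl: "s n \<in> level r" for n using s(2) G(2) by blast
  have "\<not> R y x"
  proof
    assume "R y x"
    then obtain d where "d > 0" "\<forall>z\<in>X. dist z x < d \<longrightarrow> R y z" using R_right_open by blast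
    then obtain n where "R y (s (k n))" using evx[of d "R y" "\<lambda>_. True"] by auto
    then show False using sy R_asym by blast
  qed
  then have Rxy: "R x y" using R_total[OF N_X[OF xN] S_memD(4)[OF y(1)] xy yx] by blast
  \<comment> \<open>A subsequence of the \<open>s n\<close> converges to \<open>x\<close>, but by
    \<open>A\<close> they eventually pass to the right of each fixed \<open>s m\<close>.\<close>
  have no: "\<not> R x (s m)" for m
  proof
    assume "R x (s m)"
    then obtain d where d: "d > 0" "\<forall>z\<in>X. dist z x < d \<longrightarrow> R z (s m)" using R_left_open by blast
    then obtain n where "R (s m) (s (k n))" "R (s (k n)) (s m)"
      using evx[of d "\<lambda>z. R z (s m)" "R (s m)"] A[OF s(3) sy] by auto
    then show False using R_asym by blast
  qed
  have ns: "x \<noteq> s m" for m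
  proof
    assume "x = s m"
    then have "x \<in> S" using s(3) by blast
    then have "\<forall>\<^sub>F n in sequentially. R x (s n)" using A Rxy by blast
    then show False using no eventually_happens by fastforce
  qed
  have below: "R (s n) x" and sx: "x \<notin> I (s n)" for n
  proof -
    have "s n \<in> X" using s(3) S_memD by blast
    have "s n \<notin> I x" using level_I[OF xl(1) _ sl] ns by blast
    moreover show "x \<notin> I (s n)" using level_I[OF sl _ xl(1)] ns by blast
    ultimately show "R (s n) x"
      using R_total[OF S_memD(4)[OF s(3)] N_X[OF xN]] no by blast
  qed
  \<comment> \<open>\<open>x\<close> need not be an endpoint; \<open>up_side\<close> transfers its
    position to one above it.\<close>
  obtain e where e: "e \<in> Emax" "x \<in> I e" using maximal_above[OF xl(2) N_ht[OF xN]] by blast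
  have eX: "e \<in> X" using e by (simp add: Emax_def)
  have eS: "e \<in> S" using N_up[OF xN eX e(2)] e(1) by (simp add: S_def)
  have up: "x \<in> up x" "e \<in> up x" using I_self xl e eX by (auto simp: up_def)
  have "R e y" by (rule up_side'[OF S_memD(1,4)[OF y(1)] N_X[OF xN] xy up Rxy])
  then have "\<forall>\<^sub>F n in sequentially. R e (s n)" using A eS by blast
  then obtain n where "R e (s n)" using eventually_happens by fastforce
  moreover have "R (s n) e" by (rule up_side[OF S_memD(1,4)[OF s(3)] N_X[OF xN] sx up below])
  ultimately show False using R_asym by blast
qed

text \<open>\<open>up_from r G\<close> is closed, but its openness is only clear at points higher
  than \<open>r\<close>. The convex sets in \<open>\<J>\<close> provide neighbourhoods of the
  endpoints at height \<open>r\<close>, which are regular by the choice of \<open>r\<close>, and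
  \<open>no_left_limit\<close> with its mirror image shows that the union remains closed in
  \<open>S\<close>.\<close>

lemma clopen_neighbourhood:
  assumes e0: "e0 \<in> Emax" "t < ht e0" "cut_at t e0 \<in> F" and eps: "0 < \<epsilon>"
    and noC: "\<not> (\<exists>\<A>. \<Union>\<A> \<subseteq> X \<and> Cantor_set_of_arcs \<A>)"
    and noB: "\<not> (\<exists>K\<subseteq>X. smooth_dendroid K \<and> (\<exists>x\<in>K. \<exists>y\<in>K. x \<noteq> y) \<and> connected (endpoints K))"
  shows "\<exists>U. openin (top_of_set Emax) U \<and> closedin (top_of_set Emax) U \<and> e0 \<in> U \<and> U \<subseteq> ball e0 \<epsilon>"
proof -
  define D where "D = {s \<in> S. \<not> (right_regular s \<and> left_regular s)}"
  have cD: "countable D" unfolding D_def by (rule countable_irregular[OF noC])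
  have sep: "\<exists>L. cut L \<and> u \<in> L \<and> v \<notin> L" if uv: "u \<in> S" "v \<in> S" "R u v" for u v
  proof (rule ccontr)
    assume neg: "\<not> ?thesis"
    interpret un: unseparated S R u v
      by unfold_locales (use uv neg in blast)+
    have "connected un.C" by (rule un.connected_interval) (use cD D_def in simp)
    moreover have "un.C \<subseteq> Emax" using un.C_S S_memD by blast
    moreover have "u \<noteq> v" using uv R_irrefl by blast
    ultimately show False using connected_Emax_subdendroid[of un.C u v] un.uv_C noB by blast
  qed
  have e0X: "e0 \<in> X" "up e0 = {e0}" using e0 by (auto simp: Emax_def)
  define W where "W = {x \<in> X. t < ht x \<and> cut_at t x \<in> F}"
  have "openin (top_of_set X) W" unfolding W_def by (rule openin_up_from) (use F t_pos in auto)
  then obtain V where V: "open V" "W = X \<inter> V" unfolding openin_open by blast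
  have WN: "W \<subseteq> N" by (auto simp: W_def N_def up_from_def)
  \<comment> \<open>All points of \<open>Emax\<close> in \<open>O1\<close> belong to
    \<open>S\<close>, so a subset of \<open>O1\<close> that is open in \<open>S\<close> is open in
    \<open>Emax\<close>.\<close>
  define O1 where "O1 = V \<inter> ball e0 \<epsilon>"
  have O1: "open O1" "e0 \<in> O1" using V e0 e0X eps by (auto simp: O1_def W_def)
  have O1N: "X \<inter> O1 \<subseteq> W" using V by (auto simp: O1_def)
  obtain d where d: "d > 0" "\<And>r. ht e0 - d < r \<Longrightarrow> r < ht e0 \<Longrightarrow> 0 \<le> r \<Longrightarrow>
    \<exists>G. openin (top_of_set (level r)) G \<and> compact G \<and> cut_at r e0 \<in> G \<and> up_from r G \<subseteq> O1"
    using small_up_from[OF e0X O1] by blast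
  have "uncountable {max (ht e0 - d) 0<..<ht e0}"
    using d(1) e0(2) t_pos by (simp add: uncountable_open_interval)
  moreover have "countable (ht ` D)" using cD by simp
  ultimately have "\<exists>r. r \<in> {max (ht e0 - d) 0<..<ht e0} \<and> r \<notin> ht ` D"
    by (metis countable_subset subsetI)
  then obtain r where r: "ht e0 - d < r" "0 < r" "r < ht e0" "r \<notin> ht ` D" by auto
  obtain G where G: "openin (top_of_set (level r)) G" "compact G" "cut_at r e0 \<in> G" "up_from r G \<subseteq> O1"
    using d(2)[OF r(1,3)] r(2) by auto
  have Gl: "G \<subseteq> level r" using G(1) openin_imp_subset by blast
  have upX: "up_from r G \<subseteq> X \<inter> O1" using G(4) by (auto simp: up_from_def)
  have upN: "up_from r G \<subseteq> N" using upX O1N WN by blast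
  have Gup: "G \<subseteq> up_from r G"
  proof
    fix x assume x: "x \<in> G"
    then have "x \<in> X" "ht x = r" using Gl by (auto simp: level_def)
    then show "x \<in> up_from r G" using cut_at_ht[OF _ I_self, of x] x by (auto simp: up_from_def)
  qed
  define Z where "Z = G \<inter> S"
  have Zbox: "\<exists>c. cut (fst c) \<and> cut (snd c) \<and> snd c \<subseteq> fst c \<and> s \<in> box c \<and> box c \<subseteq> O1" if s: "s \<in> Z" for s
  proof -
    have "s \<in> O1" "s \<in> S" "ht s = r" using s Gup G(4) Gl by (auto simp: Z_def level_def)
    then obtain e where e: "e > 0" "ball s e \<subseteq> O1" using O1(1) by (meson openE)
    have "s \<notin> D" using r(4) \<open>ht s = r\<close> by blast
    then have reg: "right_regular s" "left_regular s" using \<open>s \<in> S\<close> by (auto simp: D_def)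
    have "\<exists>c. cut (fst c) \<and> cut (snd c) \<and> snd c \<subseteq> fst c \<and> s \<in> box c \<and> box c \<subseteq> ball s e"
      by (rule small_box[OF \<open>s \<in> S\<close> reg e(1) sep])
    then show ?thesis using e(2) by (meson order_trans)
  qed
  then obtain c where c: "\<And>s. s \<in> Z \<Longrightarrow> cut (fst (c s)) \<and> cut (snd (c s)) \<and> snd (c s) \<subseteq> fst (c s) \<and> s \<in> box (c s) \<and> box (c s) \<subseteq> O1"
    by metis
  have "\<exists>T. open T \<and> box (c s) = S \<inter> T" if "s \<in> Z" for s
  proof -
    have "openin (top_of_set S) (box (c s))"
      unfolding box_def using c[OF that] cut_clopen by (intro openin_diff) auto
    then show ?thesis unfolding openin_open by blast
  qed
  then obtain T where T: "\<And>s. s \<in> Z \<Longrightarrow> open (T s) \<and> box (c s) = S \<inter> T s" by metis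
  \<comment> \<open>A sequence of boxes is required, since \<open>disjoint_boxes\<close> refers to
    the first box containing a point.\<close>
  obtain \<T> where \<T>: "\<T> \<subseteq> T ` Z" "countable \<T>" "\<Union>\<T> = \<Union>(T ` Z)"
    using Lindelof[of "T ` Z"] T by blast
  obtain Z0 where Z0: "Z0 \<subseteq> Z" "countable Z0" "\<T> = T ` Z0"
    using countable_subset_image[of \<T> T Z] \<T>(1,2) by blast
  define b where "b n = (if Z0 = {} then ({}, {}) else c (from_nat_into Z0 n))" for n
  have b: "cut (fst (b n))" "cut (snd (b n))" "snd (b n) \<subseteq> fst (b n)" "box (b n) \<subseteq> O1" for n
    using c[of "from_nat_into Z0 n"] from_nat_into[of Z0 n] Z0(1) cut_empty
    by (auto simp: b_def box_def)
  have Zb: "Z \<subseteq> (\<Union>n. box (b n))"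
  proof
    fix s assume s: "s \<in> Z"
    then have "s \<in> T s" "s \<in> S" using c[OF s] T[OF s] by auto
    then have "s \<in> \<Union>\<T>" using \<T>(3) s by blast
    then obtain s' where s': "s' \<in> Z0" "s \<in> T s'" using Z0(3) by blast
    then have "s \<in> box (c s')" using T[of s'] Z0(1) \<open>s \<in> S\<close> by blast
    moreover obtain n where "from_nat_into Z0 n = s'" using from_nat_into_surj[OF Z0(2) s'(1)] by blast
    ultimately show "s \<in> (\<Union>n. box (b n))" using s'(1) by (auto simp: b_def)
  qed
  obtain \<J> where \<J>: "Z \<subseteq> \<Union>\<J>" "\<And>J. J \<in> \<J> \<Longrightarrow> J \<inter> Z \<noteq> {}" "\<And>J. J \<in> \<J> \<Longrightarrow> \<exists>n. J \<subseteq> box (b n)"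
    "\<And>J. J \<in> \<J> \<Longrightarrow> openin (top_of_set S) J" "\<And>J. J \<in> \<J> \<Longrightarrow> closedin (top_of_set S) J"
    "\<And>J K. J \<in> \<J> \<Longrightarrow> K \<in> \<J> \<Longrightarrow> J \<inter> K \<noteq> {} \<Longrightarrow> J = K"
    "\<And>J x y z. J \<in> \<J> \<Longrightarrow> x \<in> J \<Longrightarrow> z \<in> J \<Longrightarrow> y \<in> S \<Longrightarrow> R x y \<Longrightarrow> R y z \<Longrightarrow> y \<in> J"
    by (rule disjoint_boxes[of b Z]) (use b Zb in blast)+
  define U where "U = (S \<inter> up_from r G) \<union> \<Union>\<J>"
  have JS: "\<Union>\<J> \<subseteq> S" using \<J>(4) openin_imp_subset by blast
  have US: "U \<subseteq> S" using JS by (auto simp: U_def)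
  have UO: "U \<subseteq> O1" using G(4) \<J>(3) b(4) unfolding U_def by blast
  have U_open: "openin (top_of_set S) U"
  proof -
    have "openin (top_of_set S) (S \<inter> {x \<in> X. r < ht x \<and> cut_at r x \<in> G})"
    proof -
      have "openin (top_of_set X) {x \<in> X. r < ht x \<and> cut_at r x \<in> G}"
        by (rule openin_up_from[OF G(1)]) (use r in simp)
      then obtain H where H: "open H" "{x \<in> X. r < ht x \<and> cut_at r x \<in> G} = X \<inter> H"
        unfolding openin_open by blast
      have "S \<subseteq> X" using S_memD by blast
      then have "S \<inter> (X \<inter> H) = S \<inter> H" by blast
      then show ?thesis unfolding H(2) using H(1) by (simp add: openin_open_Int)
    qed
    moreover have "openin (top_of_set S) (\<Union>\<J>)" using \<J>(4) by (intro openin_Union) auto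
    moreover have "U = (S \<inter> {x \<in> X. r < ht x \<and> cut_at r x \<in> G}) \<union> \<Union>\<J>"
    proof -
      have "x \<in> \<Union>\<J>" if x: "x \<in> S" "x \<in> up_from r G" "\<not> r < ht x" for x
      proof -
        have "x \<in> X" "ht x = r" "cut_at r x \<in> G" using x by (auto simp: up_from_def)
        then have "x \<in> G" using cut_at_ht[OF _ I_self, of x] by simp
        then show ?thesis using x \<J>(1) by (auto simp: Z_def)
      qed
      moreover have "x \<in> up_from r G" if "x \<in> X" "r < ht x" "cut_at r x \<in> G" for x
        using that by (simp add: up_from_def)
      moreover have "x \<in> X" "cut_at r x \<in> G" if "x \<in> up_from r G" for x
        using that by (auto simp: up_from_def)
      ultimately show ?thesis unfolding U_def by blast
    qed
    ultimately show ?thesis using openin_Un by metis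
  qed
  have limit_U: "y \<in> U" if f: "\<forall>n::nat. f n \<in> U" "f \<longlonglongrightarrow> y" and y: "y \<in> S" for f y
  proof -
    show "y \<in> U"
    proof (rule ccontr)
      assume nU: "y \<notin> U"
      then have yn: "y \<notin> up_from r G" "y \<notin> \<Union>\<J>" using y by (auto simp: U_def)
      have "open (- up_from r G)"
        using compact_up_from[OF compact_imp_closed[OF G(2)]] compact_imp_closed by blast
      then have "\<forall>\<^sub>F n in sequentially. f n \<in> - up_from r G" using f(2) yn(1) by (intro topological_tendstoD) auto
      then obtain m where m: "\<And>n. n \<ge> m \<Longrightarrow> f n \<notin> up_from r G" by (auto simp: eventually_sequentially)
      define g where "g n = f (n + m)" for n
      have g: "g n \<in> \<Union>\<J>" "g n \<in> S" "g n \<noteq> y" for n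
      proof -
        show "g n \<in> \<Union>\<J>" using f(1) m[of "n + m"] by (auto simp: U_def g_def)
        then show "g n \<in> S" "g n \<noteq> y" using JS yn(2) by auto
      qed
      have glim: "g \<longlonglongrightarrow> y" unfolding g_def[abs_def] using f(2) by (rule LIMSEQ_ignore_initial_segment)
      have sub: "(g \<circ> k) \<longlonglongrightarrow> y" if "strict_mono k" for k using LIMSEQ_subseq_LIMSEQ[OF glim that] .
      interpret rev: planar_ends X p dn a "\<lambda>x y. R y x" t F by (rule reverse_ends)
      have GJ: "\<And>J. J \<in> \<J> \<Longrightarrow> J \<inter> (G \<inter> S) \<noteq> {}" using \<J>(2) by (simp add: Z_def)
      have r0: "0 \<le> r" using r by simp
      show False
      proof (cases "infinite {n. R (g n) y}")
        case True
        then obtain k :: "nat \<Rightarrow> nat" where k: "strict_mono k" "\<And>n. k n \<in> {n. R (g n) y}" using infinite_enumerate by blast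
        show False
        proof (rule no_left_limit[OF G(2) Gl upN r0 GJ \<J>(5,6) \<J>(7) y yn _ _ sub[OF k(1)]])
          show "(g \<circ> k) n \<in> \<Union>\<J>" for n using g(1) by simp
          show "R ((g \<circ> k) n) y" for n using k(2) by simp
        qed
      next
        case False
        have "UNIV = {n. R (g n) y} \<union> {n. R y (g n)}" using total[OF g(2) y g(3)] by blast
        then have "infinite {n. R y (g n)}" using False by (metis finite_Un infinite_UNIV_nat)
        then obtain k :: "nat \<Rightarrow> nat" where k: "strict_mono k" "\<And>n. k n \<in> {n. R y (g n)}" using infinite_enumerate by blast
        show False
        proof (rule rev.no_left_limit[OF G(2) Gl upN r0 GJ \<J>(5,6) _ y yn _ _ sub[OF k(1)]])
          show "w \<in> J" if "J \<in> \<J>" "x \<in> J" "z \<in> J" "w \<in> S" "R w x" "R z w" for J x w z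
            by (rule \<J>(7)[OF that(1,3,2,4,6,5)])
          show "(g \<circ> k) n \<in> \<Union>\<J>" for n using g(1) by simp
          show "R y ((g \<circ> k) n)" for n using k(2) by simp
        qed
      qed
    qed
  qed
  have "y \<in> U" if "y \<in> S" "y \<in> closure U" for y
    using limit_U that unfolding closure_sequential by metis
  then have "U = S \<inter> closure U" using US closure_subset[of U] by auto
  then have U_closed: "closedin (top_of_set S) U" by (metis closed_closure closedin_closed)
  have SE: "S \<subseteq> Emax" by (auto simp: S_def)
  show ?thesis
  proof (intro exI[of _ U] conjI)
    have "closedin (top_of_set Emax) S"
      unfolding S_def by (intro closedin_closed_Int compact_imp_closed compact_N)
    then show "closedin (top_of_set Emax) U" using U_closed closedin_trans by blast
    have "Emax \<inter> O1 \<subseteq> S" using O1N WN unfolding S_def Emax_def by blast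
    moreover have "U \<subseteq> Emax \<inter> O1" using US SE UO by blast
    ultimately have "openin (top_of_set (Emax \<inter> O1)) U"
      using openin_subset_trans[OF U_open] by blast
    moreover have "openin (top_of_set Emax) (Emax \<inter> O1)" using O1(1) by (simp add: openin_open_Int)
    ultimately show "openin (top_of_set Emax) U" using openin_trans by blast
    show "U \<subseteq> ball e0 \<epsilon>" using UO by (auto simp: O1_def)
    have "e0 \<in> up_from r G" using e0X r G(3) by (simp add: up_from_def)
    then show "e0 \<in> U" using upN e0(1) by (auto simp: U_def S_def)
  qed
qed

end


text \<open>Small clopen neighbourhoods of the other points,
  chosen of diameter proportional to the distance from \<open>z\<close>, only accumulate at \<open>z\<close>.\<close>

lemma clopen_neighbourhood_of_last_point:
  fixes S :: "'a::{metric_space, second_countable_topology} set"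
  assumes z: "z \<in> S"
    and W: "\<And>x e. x \<in> S \<Longrightarrow> x \<noteq> z \<Longrightarrow> 0 < e \<Longrightarrow>
      \<exists>U. openin (top_of_set S) U \<and> closedin (top_of_set S) U \<and> x \<in> U \<and> U \<subseteq> ball x e"
    and e: "0 < e"
  shows "\<exists>U. openin (top_of_set S) U \<and> closedin (top_of_set S) U \<and> z \<in> U \<and> U \<subseteq> ball z e"
proof -
  have "\<exists>U. openin (top_of_set S) U \<and> closedin (top_of_set S) U \<and> x \<in> U \<and> U \<subseteq> ball x (dist x z / 2)"
    if "x \<in> S - {z}" for x using W[of x "dist x z / 2"] that by auto
  then obtain U where U: "\<And>x. x \<in> S - {z} \<Longrightarrow> openin (top_of_set S) (U x) \<and> closedin (top_of_set S) (U x) \<and>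
      x \<in> U x \<and> U x \<subseteq> ball x (dist x z / 2)" by metis
  have "\<exists>T. open T \<and> U x = S \<inter> T" if "x \<in> S - {z}" for x using U[OF that] unfolding openin_open by blast
  then obtain T where T: "\<And>x. x \<in> S - {z} \<Longrightarrow> open (T x) \<and> U x = S \<inter> T x" by metis
  obtain \<T> where \<T>: "\<T> \<subseteq> T ` (S - {z})" "countable \<T>" "\<Union>\<T> = \<Union>(T ` (S - {z}))"
    using Lindelof[of "T ` (S - {z})"] T by blast
  obtain Z where Z: "Z \<subseteq> S - {z}" "countable Z" "\<T> = T ` Z"
    using countable_subset_image[of \<T> T "S - {z}"] \<T>(1,2) by blast
  define V where "V n = (if Z = {} then {} else U (from_nat_into Z n))" for n
  have V: "openin (top_of_set S) (V n)" "closedin (top_of_set S) (V n)" for n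
    using U[of "from_nat_into Z n"] from_nat_into[of Z n] Z(1) by (auto simp: V_def)
  \<comment> \<open>Points of the piece chosen for a centre \<open>w\<close> have distances from
    \<open>z\<close> between \<open>1/2\<close> and \<open>3/2\<close> of \<open>dist w z\<close>;
    hence the factor \<open>3\<close>.\<close>
  have Vdist: "dist x z < 3 * dist y z" if xy: "x \<in> V n" "y \<in> V n" for x y n
  proof -
    define w where "w = from_nat_into Z n"
    have w: "w \<in> S - {z}" "x \<in> U w" "y \<in> U w"
      using xy from_nat_into[of Z n] Z(1) by (auto simp: V_def w_def split: if_splits)
    then have "dist w x < dist w z / 2" "dist w y < dist w z / 2" using U[OF w(1)] by auto
    then show ?thesis
      using dist_triangle[of x z w] dist_triangle[of w z y] by (simp add: dist_commute)
  qed
  have Vcover: "\<exists>n. x \<in> V n" if x: "x \<in> S" "x \<noteq> z" for x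
  proof -
    have "x \<in> T x" using U[of x] T[of x] x by auto
    then have "x \<in> \<Union>\<T>" using \<T>(3) x by blast
    then obtain y where y: "y \<in> Z" "x \<in> T y" using Z(3) by blast
    then have "x \<in> U y" using T[of y] Z(1) x by blast
    moreover obtain n where "from_nat_into Z n = y" using from_nat_into_surj[OF Z(2) y(1)] by blast
    ultimately show ?thesis using y(1) by (auto simp: V_def)
  qed
  define D where "D n = V n - (\<Union>k<n. V k)" for n
  have D: "openin (top_of_set S) (D n)" for n
    unfolding D_def by (intro openin_diff V closedin_Union) (use V in auto)
  have Dcover: "\<exists>n. x \<in> D n" if x: "x \<in> S" "x \<noteq> z" for x
  proof -
    obtain m where "x \<in> V m" using Vcover[OF x] by blast
    then have "x \<in> V (LEAST n. x \<in> V n)" by (rule LeastI)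
    moreover have "x \<notin> V k" if "k < (LEAST n. x \<in> V n)" for k using not_less_Least[OF that] .
    ultimately show ?thesis unfolding D_def by blast
  qed
  have Ddisj: "m = n" if "x \<in> D m" "x \<in> D n" for x m n
    using that unfolding D_def by (metis DiffE UN_I lessThan_iff linorder_neqE_nat)
  \<comment> \<open>Pieces reaching distance \<open>e\<close> from \<open>z\<close> are removed as a
    whole. By \<open>Vdist\<close> they stay more than \<open>e/3\<close> away, so they do not
    accumulate at \<open>z\<close>.\<close>
  define M where "M = {n. \<exists>y\<in>D n. e \<le> dist y z}"
  define G where "G = (\<Union>n\<in>M. D n)"
  have far: "e < 3 * dist x z" if x: "x \<in> G" for x
  proof -
    obtain n y where "x \<in> V n" "y \<in> V n" "e \<le> dist y z" using x by (auto simp: G_def M_def D_def)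
    then show ?thesis using Vdist[of y n x] by linarith
  qed
  have GS: "G \<subseteq> S" using D openin_imp_subset unfolding G_def by blast
  have Gopen: "openin (top_of_set S) G" unfolding G_def using D by (intro openin_Union) auto
  have "openin (top_of_set S) (S - G)"
    unfolding openin_subopen[of _ "S - G"]
  proof
    fix y assume y: "y \<in> S - G"
    show "\<exists>T. openin (top_of_set S) T \<and> y \<in> T \<and> T \<subseteq> S - G"
    proof (cases "y = z")
      case True
      have "S \<inter> ball z (e/3) \<subseteq> S - G"
      proof
        fix x assume x: "x \<in> S \<inter> ball z (e/3)"
        then have "3 * dist x z < e" by (simp add: dist_commute)
        then show "x \<in> S - G" using far[of x] x by force
      qed
      then show ?thesis using True z e
        by (intro exI[of _ "S \<inter> ball z (e/3)"]) (auto simp: openin_open_Int)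
    next
      case False
      obtain n where n: "y \<in> D n" using Dcover False y by blast
      have "n \<notin> M" using n y by (auto simp: G_def)
      then have "D n \<inter> G = {}" using Ddisj unfolding G_def by blast
      then show ?thesis using D[of n] n openin_imp_subset by (intro exI[of _ "D n"]) blast
    qed
  qed
  moreover have "closedin (top_of_set S) (S - G)" using Gopen by (simp add: closedin_def GS double_diff)
  moreover have "z \<in> S - G" using far[of z] z e by auto
  moreover have "S - G \<subseteq> ball z e"
  proof
    fix x assume x: "x \<in> S - G"
    show "x \<in> ball z e"
    proof (rule ccontr)
      assume "x \<notin> ball z e"
      then have d: "e \<le> dist x z" by (simp add: dist_commute)
      then have "x \<noteq> z" using e by auto
      then obtain n where "x \<in> D n" using Dcover x by blast
      then show False using d x by (auto simp: G_def M_def)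
    qed
  qed
  ultimately show ?thesis by blast
qed

text \<open>A clopen set has empty frontier, which has dimension \<open>-1\<close>.\<close>

lemma dim_le_0_if_clopen_neighbourhoods:
  fixes S :: "'a::metric_space set"
  assumes "\<And>x e. x \<in> S \<Longrightarrow> 0 < e \<Longrightarrow>
      \<exists>U. openin (top_of_set S) U \<and> closedin (top_of_set S) U \<and> x \<in> U \<and> U \<subseteq> ball x e"
  shows "top_of_set S dim_le 0"
proof (rule dimension_le.intros)
  fix V a assume V: "openin (top_of_set S) V" "a \<in> V"
  have aS: "a \<in> S" using V openin_imp_subset by blast
  obtain e where e: "e > 0" "\<And>y. y \<in> S \<Longrightarrow> dist y a < e \<Longrightarrow> y \<in> V"
    using V unfolding openin_euclidean_subtopology_iff by blast
  obtain U where U: "openin (top_of_set S) U" "closedin (top_of_set S) U" "a \<in> U" "U \<subseteq> ball a e"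
    using assms[OF aS e(1)] by blast
  have "U \<subseteq> V"
  proof
    fix y assume y: "y \<in> U"
    then have "y \<in> S" using U(1) openin_imp_subset by blast
    then show "y \<in> V" using e(2) U(4) y by (auto simp: dist_commute)
  qed
  moreover have "top_of_set S frontier_of U = {}"
    using U(1,2) by (metis frontier_of_eq_empty openin_subset)
  moreover have "subtopology (top_of_set S) {} dim_le -1"
    by (rule dimension_le.intros) (auto dest: openin_subset)
  ultimately show "\<exists>U. a \<in> U \<and> U \<subseteq> V \<and> openin (top_of_set S) U \<and>
      subtopology (top_of_set S) (top_of_set S frontier_of U) dim_le 0 - 1"
    using U by auto
qed simp

section \<open>Endpoint sets of dimension zero\<close>

context plane_dendroid begin

text \<open>The order depends on \<open>e0\<close>: the part above \<open>F\<close> is chosen so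
  small around \<open>e0\<close> that it avoids the arc \<open>I a\<close>, on which
  \<open>R\<close> compares nothing.\<close>

lemma clopen_neighbourhood_in_plane:
  assumes e: "e0 \<in> Emax" and eps: "0 < \<epsilon>"
    and noC: "\<not> (\<exists>\<A>. \<Union>\<A> \<subseteq> X \<and> Cantor_set_of_arcs \<A>)"
    and noB: "\<not> (\<exists>K\<subseteq>X. smooth_dendroid K \<and> (\<exists>x\<in>K. \<exists>y\<in>K. x \<noteq> y) \<and> connected (endpoints K))"
  shows "\<exists>U. openin (top_of_set Emax) U \<and> closedin (top_of_set Emax) U \<and> e0 \<in> U \<and> U \<subseteq> ball e0 \<epsilon>"
proof -
  obtain a R where aR: "a \<in> X" "e0 \<notin> I a"
    "\<And>x y. R x y \<Longrightarrow> x \<in> X - I a \<and> y \<in> X - I a \<and> x \<notin> I y \<and> y \<notin> I x"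
    "\<And>x y. x \<in> X - I a \<Longrightarrow> y \<in> X - I a \<Longrightarrow> x \<notin> I y \<Longrightarrow> y \<notin> I x \<Longrightarrow> R x y \<longleftrightarrow> \<not> R y x"
    "\<And>x y. R x y \<Longrightarrow> \<exists>d>0. \<forall>x'\<in>X. \<forall>y'\<in>X. dist x' x < d \<longrightarrow> dist y' y < d \<longrightarrow> R x' y'"
    "\<And>x y z. R x y \<Longrightarrow> R y z \<Longrightarrow> x \<notin> I z \<Longrightarrow> z \<notin> I x \<Longrightarrow> R x z"
    by (rule plane_order[OF e]) blast
  have e0: "e0 \<in> X" "up e0 = {e0}" "e0 \<noteq> p" using e by (auto simp: Emax_def)
  have ht0: "0 < ht e0" using ht_strict[OF e0(1) p_in_I[OF e0(1)]] e0(3) ht_p by auto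
  have "open (- I a)" using closed_I[OF aR(1)] by (simp add: open_Compl)
  then obtain d where d: "d > 0" "\<And>r. ht e0 - d < r \<Longrightarrow> r < ht e0 \<Longrightarrow> 0 \<le> r \<Longrightarrow>
    \<exists>G. openin (top_of_set (level r)) G \<and> compact G \<and> cut_at r e0 \<in> G \<and> up_from r G \<subseteq> - I a"
    using small_up_from[OF e0(1,2)] aR(2) by (metis ComplI)
  define t where "t = (max (ht e0 - d) 0 + ht e0) / 2"
  have t: "ht e0 - d < t" "t < ht e0" "0 < t" using d(1) ht0 by (auto simp: t_def)
  obtain F where F: "openin (top_of_set (level t)) F" "compact F" "cut_at t e0 \<in> F" "up_from t F \<subseteq> - I a"
    using d(2)[OF t(1,2)] t(3) by auto
  interpret ends: planar_ends X p dn a R t F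
  proof unfold_locales
    show "a \<in> X" "compact F" "openin (top_of_set (level t)) F" "0 < t" by fact+
    show "up_from t F \<inter> I a = {}" using F(4) by blast
    fix x y
    show "R x y \<Longrightarrow> x \<in> X - I a \<and> y \<in> X - I a \<and> x \<notin> I y \<and> y \<notin> I x" by (rule aR(3))
    show "x \<in> X - I a \<Longrightarrow> y \<in> X - I a \<Longrightarrow> x \<notin> I y \<Longrightarrow> y \<notin> I x \<Longrightarrow> R x y \<longleftrightarrow> \<not> R y x"
      by (rule aR(4))
    show "R x y \<Longrightarrow> \<exists>d>0. \<forall>x'\<in>X. \<forall>y'\<in>X. dist x' x < d \<longrightarrow> dist y' y < d \<longrightarrow> R x' y'" by (rule aR(5))
    fix z
    show "R x y \<Longrightarrow> R y z \<Longrightarrow> x \<notin> I z \<Longrightarrow> z \<notin> I x \<Longrightarrow> R x z" by (rule aR(6))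
  qed
  show ?thesis
    by (rule ends.clopen_neighbourhood[OF e t(2) F(3) eps noC noB])
qed

end

theorem corollary23:
  fixes X :: "(real^2) set"
  assumes "smooth_dendroid X"
    and "has_dimension (top_of_set (endpoints X)) 1"
  shows "(\<exists>K. K \<subseteq> X \<and> Bellamy_dendroid K) \<or>
         (\<exists>\<A>. \<Union>\<A> \<subseteq> X \<and> Cantor_set_of_arcs \<A>)"
proof (rule ccontr)
  assume neg: "\<not> ?thesis"
  then have noC: "\<not> (\<exists>\<A>. \<Union>\<A> \<subseteq> X \<and> Cantor_set_of_arcs \<A>)" by blast
  have noB: "\<not> (\<exists>K\<subseteq>X. smooth_dendroid K \<and> (\<exists>x\<in>K. \<exists>y\<in>K. x \<noteq> y) \<and> connected (endpoints K))"
    using neg unfolding Bellamy_dendroid_def by blast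
  obtain p where p: "p \<in> X" and smooth: "\<And>s x. (\<forall>n::nat. s n \<in> X) \<and> x \<in> X \<and> s \<longlonglongrightarrow> x \<longrightarrow>
        (\<lambda>n. hausdorff_distance (arc_between X (s n) p) (arc_between X x p)) \<longlonglongrightarrow> 0"
    using assms(1) unfolding smooth_dendroid_def by blast
  obtain Q where Q: "countable Q" "Q \<subseteq> X" "X \<subseteq> closure Q" using separable by blast
  have "Q \<noteq> {}" using Q(3) p by auto
  define dn where "dn = from_nat_into Q"
  have dn: "range dn = Q" unfolding dn_def using \<open>Q \<noteq> {}\<close> Q(1) by (rule range_from_nat_into)
  interpret plane_dendroid X p dn
    by unfold_locales (use assms(1) p smooth Q dn in \<open>auto simp: smooth_dendroid_def\<close>)
  define E where "E = endpoints X"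
  have EE: "Emax \<subseteq> E" "E \<subseteq> insert p Emax" using Emax_subset endpoints_subset by (auto simp: E_def)
  have nbhd: "\<exists>U. openin (top_of_set E) U \<and> closedin (top_of_set E) U \<and> x \<in> U \<and> U \<subseteq> ball x e"
    if x: "x \<in> E" "x \<noteq> p" "0 < e" for x e
  proof -
    have xE: "x \<in> Emax" using x EE by blast
    \<comment> \<open>A radius below \<open>dist x p\<close> keeps \<open>p\<close> out, so that
      \<open>E\<close> and \<open>Emax\<close> agree near \<open>x\<close>.\<close>
    define r where "r = min e (dist x p / 2)"
    have r: "0 < r" "r \<le> e" "r < dist x p" using x by (auto simp: r_def min_def)
    obtain U where U: "openin (top_of_set Emax) U" "closedin (top_of_set Emax) U" "x \<in> U" "U \<subseteq> ball x r"
      using clopen_neighbourhood_in_plane[OF xE r(1) noC noB] by blast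
    have Er: "E \<inter> cball x r = Emax \<inter> cball x r" "E \<inter> ball x r = Emax \<inter> ball x r" using EE r(3) by auto
    have "closedin (top_of_set (Emax \<inter> cball x r)) U"
      by (rule closedin_subset_trans[OF U(2)]) (use U(4) closedin_imp_subset[OF U(2)] ball_subset_cball in blast)+
    moreover have "closedin (top_of_set E) (Emax \<inter> cball x r)"
      unfolding Er(1)[symmetric] by (simp add: closedin_closed_Int)
    ultimately have "closedin (top_of_set E) U" using closedin_trans by blast
    moreover have "openin (top_of_set (Emax \<inter> ball x r)) U"
      by (rule openin_subset_trans[OF U(1)]) (use U(4) openin_imp_subset[OF U(1)] in blast)+
    moreover have "openin (top_of_set E) (Emax \<inter> ball x r)"
      unfolding Er(2)[symmetric] by (simp add: openin_open_Int)
    ultimately have "openin (top_of_set E) U" "closedin (top_of_set E) U" using openin_trans by blast+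
    moreover have "U \<subseteq> ball x e" using U(4) subset_ball[OF r(2)] by (rule order_trans)
    ultimately show ?thesis using U(3) by blast
  qed
  have "top_of_set E dim_le 0"
  proof (rule dim_le_0_if_clopen_neighbourhoods)
    fix x and e :: real assume x: "x \<in> E" "0 < e"
    show "\<exists>U. openin (top_of_set E) U \<and> closedin (top_of_set E) U \<and> x \<in> U \<and> U \<subseteq> ball x e"
    proof (cases "x = p")
      case True
      \<comment> \<open>Only \<open>p\<close> can be an endpoint that is not maximal, and small
        clopen neighbourhoods of all other points produce one of \<open>p\<close>.\<close>
      show ?thesis
        using clopen_neighbourhood_of_last_point[of p E e] nbhd x True by blast
    qed (use nbhd x in blast)
  qed
  then show False using assms(2) by (simp add: has_dimension_def E_def)
qed

end
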